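(* Let $(M,g)$ be a transverse Riemann-Lorentz space with tangent radical and singular hypersurface $\Sigma$. Let $\mathcal A,\mathcal B\in\mathfrak{X}(M)$, with restrictions $A,B$ to $\Sigma$, be such that $\mathrm{rank}(g_{\mathcal A^o\wedge\mathcal B^o})=2$, $\mathrm{rank}(g_{A\wedge B})=1$ and $R\in A\wedge B$. (a) $K_{\mathcal A^o\wedge\mathcal B^o}\cong0$ if and only if $\langle R(\mathcal A,\mathcal B)\mathcal A,\mathcal B\rangle|_\Sigma=0$ (i.e. $\langle R(\mathcal A^o,\mathcal B^o)\mathcal A^o,\mathcal B^o\rangle\cong0$ and its smooth extension vanishes on $\Sigma$); and this implies $\nu(A)=0=\nu(B)$. (b) Consider the assertions: (1) for all such $A,B$: if $\nu(A)=0=\nu(B)$ (equivalently, $\dim\mathrm{Span}(A^S,B^S)=1$), then $\langle R(A,B)A,B\rangle=0$ (i.e. it is well-defined and equal to $0$); (2) $\Sigma$ is $III$-flat; (3) $\Sigma$ is $II$-flat; (4) for all such $A,B$: if $\nu(A)=0=\nu(B)$, then $\langle R(A,B)A,B\rangle$ is well-defined. Then (1) $\Leftrightarrow$ (2) $\Rightarrow$ (3) $\Leftrightarrow$ (4).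
   Context: $M$ is a connected smooth manifold of dimension $m>2$ with a smooth symmetric $(0,2)$-tensor field $g=\langle\cdot,\cdot\rangle$ which fails to have maximal rank exactly on a nonempty set $\Sigma\subset M$. $(M,g)$ is a transverse singular space if in every local coordinate system $\det(g_{ab})$ has nonzero differential at the points of $\Sigma$; then $\Sigma$ is a smooth hypersurface (the singular hypersurface) and the radical $Rad_p=\{v\in T_pM: g(v,\cdot)=0\}$, $p\in\Sigma$, is one-dimensional. Tangent radical: $Rad_p\subset T_p\Sigma$ for all $p\in\Sigma$. Riemann-Lorentz: the signature of $g$ changes from Riemannian to Lorentzian across $\Sigma$. $\mathfrak{X}_\Sigma$: smooth vector fields along $\Sigma$; $\mathfrak{X}(\Sigma)$: those tangent to $\Sigma$. For $\mathcal A\in\mathfrak{X}(M)$, $\mathcal A^o=\mathcal A|_{M-\Sigma}$; $\mathcal A$ is an extension of $A=\mathcal A|_\Sigma$. Everything is local: $M$ may be replaced by a small neighbourhood of (a point of) $\Sigma$, and vector fields may be only locally defined. Dual connection: $2\square_{\mathcal A}\mathcal B(\mathcal C)=\mathcal A\langle\mathcal B,\mathcal C\rangle+\mathcal B\langle\mathcal C,\mathcal A\rangle-\mathcal C\langle\mathcal A,\mathcal B\rangle+\langle[\mathcal A,\mathcal B],\mathcal C\rangle-\langle[\mathcal B,\mathcal C],\mathcal A\rangle+\langle[\mathcal C,\mathcal A],\mathcal B\rangle$. For a radical vector field $R'$ along $\Sigma$, $II_{R'}(A,B):=\square_AB(R')$ is a well-defined symmetric $C^\infty(\Sigma)$-bilinear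 map on $\mathfrak{X}_\Sigma$. The main normal $N\in\mathfrak{X}_\Sigma$ satisfies $\langle N,T\Sigma\rangle=0$, $II_{R'}(N,N)=0$ for radical $R'$, $\langle N,N\rangle=1$ (unique up to sign). Second fundamental form: the symmetric tensor $\mathcal H(X,Y):=\square_XY(N)=-\square_XN(Y)$ on $\Sigma$. The main radical vector field $R\in\mathfrak{X}(\Sigma)$ is in the radical distribution with $\mathcal H(R,R)=-1$ (unique up to sign, the sign of $N$ being chosen to make this possible). $II:=II_R$. Canonical screen distribution: $S_p:=\{v\in T_p\Sigma:\mathcal H(v,R(p))=0\}$, a complement of $Rad_p$ in $T_p\Sigma$; $\Gamma(S)$ is its module of sections. Each $A\in\mathfrak{X}_\Sigma$ decomposes as $A=\nu(A)N+A^S+\rho(A)R$, where $A^S\in\Gamma(S)$ is the screen component, $\nu(A)=\langle A,N\rangle$, $\rho(A)=-\mathcal H(A-\nu(A)N,R)$. $\Sigma$ is $II$-flat if $II(V,W)=0$ for all $V,W\in\Gamma(S)$ (equivalently $II(X,Y)=0$ for all $X,Y\in\mathfrak{X}(\Sigma)$). Let $\nabla$ be the Levi-Civita connection on $M-\Sigma$. If $\Sigma$ is $II$-flat, then for extensions $\mathcal X,\mathcal Y$ of $X,Y\in\mathfrak{X}(\Sigma)$ the field $\nabla_{\mathcal X^o}\mathcal Y^o$ extends smoothly to a field $\nabla_{\mathcal X}\mathcal Y$ on $M$, and $III(X,Y,Z):=II(\nabla_{\mathcal X}\mathcal Y|_\Sigma,Z)$, $X,Y,Z\in\mathfrak{X}(\Sigma)$,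 is independent of the extensions and $C^\infty(\Sigma)$-trilinear. $\Sigma$ is $III$-flat if it is $II$-flat and $III(V,W,R)=0$ for all $V,W\in\Gamma(S)$ (equivalently, $II$-flat and $\mathcal H(V,W)=0$ for all $V,W\in\Gamma(S)$). Curvature on $M-\Sigma$: $R(\mathcal A,\mathcal B)\mathcal C=\nabla_{\mathcal A}\nabla_{\mathcal B}\mathcal C-\nabla_{\mathcal B}\nabla_{\mathcal A}\mathcal C-\nabla_{[\mathcal A,\mathcal B]}\mathcal C$. $A\wedge B$ denotes the plane field spanned by linearly independent $A,B$, $g_{A\wedge B}$ the Gram matrix of $A,B$. Sectional curvature on $M-\Sigma$ (with this sign convention): $K_{\mathcal A^o\wedge\mathcal B^o}:=\langle R(\mathcal A^o,\mathcal B^o)\mathcal A^o,\mathcal B^o\rangle/\det(g_{\mathcal A^o\wedge\mathcal B^o})$. For a smooth function $F$ on $M-\Sigma$, $F\cong0$ means that $F$ extends smoothly to $M$. For $A,B\in\mathfrak{X}_\Sigma$, "$\langle R(A,B)A,B\rangle$ is well-defined" means: for all extensions $\mathcal A,\mathcal B,\mathcal C,\mathcal D\in\mathfrak{X}(M)$ of $A,B,A,B$ respectively, $\langle R(\mathcal A^o,\mathcal B^o)\mathcal C^o,\mathcal D^o\rangle\cong0$, and the restriction to $\Sigma$ of its smooth extension depends only on $A,B$; that restriction is then denoted $\langle R(A,B)A,B\rangle$. All conditions on $A,B$ are required at every point of (the domain in) $\Sigma$.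
   Formalization: In (b)(1) only "ν(A)=0=ν(B) implies dim Span(A^S,B^S)=1" is stated; the converse is false (A=R, B=N+V with V a nonzero screen field has dim 1 but ν(B)=1), so (1) and (4) use the condition ν(A)=0=ν(B). *)

theory Defs
  imports "HOL-Analysis.Analysis"
begin

section \<open>Smooth manifolds\<close>

text \<open>Both predicates are meant for open domains only.\<close>

primrec Ck_on :: "nat \<Rightarrow> 'a::real_normed_vector set \<Rightarrow> ('a \<Rightarrow> 'b::real_normed_vector) \<Rightarrow> bool" where
  "Ck_on 0 S f \<longleftrightarrow> continuous_on S f"
| "Ck_on (Suc k) S f \<longleftrightarrow>
     (\<forall>x\<in>S. f differentiable (at x)) \<and> (\<forall>v. Ck_on k S (\<lambda>x. frechet_derivative f (at x) v))"

definition smooth_on :: "'a::real_normed_vector set \<Rightarrow> ('a \<Rightarrow> 'b::real_normed_vector) \<Rightarrow> bool" where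
  "smooth_on S f \<longleftrightarrow> (\<forall>k. Ck_on k S f)"

text \<open>The manifold is the whole type \<open>'a\<close>; its model space is \<open>real^'n\<close>. A chart is a pair of its
  domain and its coordinate map (whose values off the domain are irrelevant).\<close>

type_synonym ('a, 'n) chart = "'a set \<times> ('a \<Rightarrow> real^'n)"

definition cinv :: "('a, 'n::finite) chart \<Rightarrow> real^'n \<Rightarrow> 'a" where
  "cinv c = inv_into (fst c) (snd c)"

definition is_chart :: "('a::topological_space, 'n::finite) chart \<Rightarrow> bool" where
  "is_chart c \<longleftrightarrow> open (fst c) \<and> open (snd c ` fst c)
     \<and> homeomorphism (fst c) (snd c ` fst c) (snd c) (cinv c)"

definition compatible :: "('a, 'n::finite) chart \<Rightarrow> ('a, 'n) chart \<Rightarrow> bool" where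
  "compatible c d \<longleftrightarrow>
     smooth_on (snd c ` (fst c \<inter> fst d)) (snd d \<circ> cinv c) \<and>
     smooth_on (snd d ` (fst c \<inter> fst d)) (snd c \<circ> cinv d)"

text \<open>A smooth structure is a maximal atlas, so that its members are exactly the smooth local
  coordinate systems.\<close>

definition smooth_structure :: "('a::{t2_space,second_countable_topology}, 'n::finite) chart set \<Rightarrow> bool" where
  "smooth_structure \<A> \<longleftrightarrow>
     (\<forall>c\<in>\<A>. is_chart c) \<and> (\<Union>c\<in>\<A>. fst c) = UNIV \<and>
     (\<forall>c\<in>\<A>. \<forall>d\<in>\<A>. compatible c d) \<and>
     (\<forall>c. is_chart c \<and> (\<forall>d\<in>\<A>. compatible c d) \<longrightarrow> c \<in> \<A>)"

text \<open>Every tangent space is identified with \<open>real^'n\<close>: a tangent vector at \<open>p\<close> is represented by its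
  components in a chart chosen once and for all at \<open>p\<close>. Its components in another chart \<open>c\<close> around
  \<open>p\<close> are \<open>vec_coords \<A> c p v\<close>. A vector field is thus a function \<open>'a \<Rightarrow> real^'n\<close>; as the chosen
  chart may jump from point to point, its smoothness is expressed through its components in charts.\<close>

definition chart_at :: "('a, 'n::finite) chart set \<Rightarrow> 'a \<Rightarrow> ('a, 'n) chart" where
  "chart_at \<A> p = (SOME c. c \<in> \<A> \<and> p \<in> fst c)"

definition vec_coords :: "('a, 'n::finite) chart set \<Rightarrow> ('a, 'n) chart \<Rightarrow> 'a \<Rightarrow> real^'n \<Rightarrow> real^'n" where
  "vec_coords \<A> c p =
     frechet_derivative (snd c \<circ> cinv (chart_at \<A> p)) (at (snd (chart_at \<A> p) p))"

text \<open>The \<open>a\<close>-th coordinate vector at \<open>p\<close> of the chart \<open>c\<close>.\<close>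

definition coord_vec :: "('a, 'n::finite) chart set \<Rightarrow> ('a, 'n) chart \<Rightarrow> 'a \<Rightarrow> 'n \<Rightarrow> real^'n" where
  "coord_vec \<A> c p a =
     frechet_derivative (snd (chart_at \<A> p) \<circ> cinv c) (at (snd c p)) (axis a 1)"

definition field_coords :: "('a, 'n::finite) chart set \<Rightarrow> ('a, 'n) chart \<Rightarrow> ('a \<Rightarrow> real^'n) \<Rightarrow> real^'n \<Rightarrow> real^'n" where
  "field_coords \<A> c X = (\<lambda>x. vec_coords \<A> c (cinv c x) (X (cinv c x)))"

definition smooth_fun :: "('a, 'n::finite) chart set \<Rightarrow> 'a set \<Rightarrow> ('a \<Rightarrow> real) \<Rightarrow> bool" where
  "smooth_fun \<A> U f \<longleftrightarrow> (\<forall>c\<in>\<A>. smooth_on (snd c ` (fst c \<inter> U)) (f \<circ> cinv c))"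

definition smooth_field :: "('a, 'n::finite) chart set \<Rightarrow> 'a set \<Rightarrow> ('a \<Rightarrow> real^'n) \<Rightarrow> bool" where
  "smooth_field \<A> U X \<longleftrightarrow> (\<forall>c\<in>\<A>. smooth_on (snd c ` (fst c \<inter> U)) (field_coords \<A> c X))"

definition deriv_along :: "('a, 'n::finite) chart set \<Rightarrow> ('a \<Rightarrow> real^'n) \<Rightarrow> ('a \<Rightarrow> real) \<Rightarrow> 'a \<Rightarrow> real" where
  "deriv_along \<A> X f p =
     frechet_derivative (f \<circ> cinv (chart_at \<A> p)) (at (snd (chart_at \<A> p) p)) (X p)"

definition bracket :: "('a, 'n::finite) chart set \<Rightarrow> ('a \<Rightarrow> real^'n) \<Rightarrow> ('a \<Rightarrow> real^'n) \<Rightarrow> 'a \<Rightarrow> real^'n" where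
  "bracket \<A> X Y p = (let c = chart_at \<A> p in
     frechet_derivative (field_coords \<A> c Y) (at (snd c p)) (X p)
     - frechet_derivative (field_coords \<A> c X) (at (snd c p)) (Y p))"


section \<open>Transverse singular metrics\<close>

type_synonym ('a, 'n) metric = "'a \<Rightarrow> real^'n \<Rightarrow> real^'n \<Rightarrow> real"

text \<open>The matrix \<open>(g\<^sub>a\<^sub>b)\<close> in the chart \<open>c\<close>, as a function of the coordinates.\<close>

definition coord_matrix :: "('a, 'n::finite) chart set \<Rightarrow> ('a, 'n) metric \<Rightarrow> ('a, 'n) chart \<Rightarrow> real^'n \<Rightarrow> real^'n^'n" where
  "coord_matrix \<A> g c x =
     (\<chi> a b. g (cinv c x) (coord_vec \<A> c (cinv c x) a) (coord_vec \<A> c (cinv c x) b))"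

definition smooth_symmetric_tensor :: "('a, 'n::finite) chart set \<Rightarrow> ('a, 'n) metric \<Rightarrow> bool" where
  "smooth_symmetric_tensor \<A> g \<longleftrightarrow>
     (\<forall>p. bilinear (g p) \<and> (\<forall>v w. g p v w = g p w v)) \<and>
     (\<forall>c\<in>\<A>. smooth_on (snd c ` fst c) (coord_matrix \<A> g c))"

definition sing :: "('a, 'n::finite) metric \<Rightarrow> 'a set" where
  "sing g = {p. rank (\<chi> i j. g p (axis i 1) (axis j 1) :: real^'n^'n) < CARD('n)}"

definition Rad :: "('a, 'n::finite) metric \<Rightarrow> 'a \<Rightarrow> (real^'n) set" where
  "Rad g p = {v. \<forall>w. g p v w = 0}"

definition transverse_singular :: "('a, 'n::finite) chart set \<Rightarrow> ('a, 'n) metric \<Rightarrow> bool" where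
  "transverse_singular \<A> g \<longleftrightarrow> smooth_symmetric_tensor \<A> g \<and> sing g \<noteq> {} \<and>
     (\<forall>c\<in>\<A>. \<forall>p \<in> fst c \<inter> sing g.
        frechet_derivative (\<lambda>x. det (coord_matrix \<A> g c x)) (at (snd c p)) \<noteq> (\<lambda>v. 0))"

text \<open>The tangent space of the singular hypersurface at one of its points, as the set of
  velocities of smooth curves lying in it.\<close>

definition sing_tangent :: "('a, 'n::finite) chart set \<Rightarrow> ('a, 'n) metric \<Rightarrow> 'a \<Rightarrow> (real^'n) set" where
  "sing_tangent \<A> g p = {v. \<exists>\<gamma> e. e > 0 \<and> \<gamma> 0 = p \<and>
     (\<forall>t\<in>{-e<..<e}. \<gamma> t \<in> sing g \<inter> fst (chart_at \<A> p)) \<and>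
     smooth_on {-e<..<e} (snd (chart_at \<A> p) \<circ> \<gamma>) \<and>
     vector_derivative (snd (chart_at \<A> p) \<circ> \<gamma>) (at 0) = v}"

definition tangent_radical :: "('a, 'n::finite) chart set \<Rightarrow> ('a, 'n) metric \<Rightarrow> bool" where
  "tangent_radical \<A> g \<longleftrightarrow> (\<forall>p\<in>sing g. Rad g p \<subseteq> sing_tangent \<A> g p)"

definition metric_index :: "('a, 'n::finite) metric \<Rightarrow> 'a \<Rightarrow> nat" where
  "metric_index g p = Max {dim W |W. subspace W \<and> (\<forall>v\<in>W. v \<noteq> 0 \<longrightarrow> g p v v < 0)}"

definition riemannian_at :: "('a, 'n::finite) metric \<Rightarrow> 'a \<Rightarrow> bool" where
  "riemannian_at g p \<longleftrightarrow> Rad g p = {0} \<and> metric_index g p = 0"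

definition lorentzian_at :: "('a, 'n::finite) metric \<Rightarrow> 'a \<Rightarrow> bool" where
  "lorentzian_at g p \<longleftrightarrow> Rad g p = {0} \<and> metric_index g p = 1"

definition riemann_lorentz :: "('a::topological_space, 'n::finite) metric \<Rightarrow> bool" where
  "riemann_lorentz g \<longleftrightarrow>
     (\<forall>p. p \<notin> sing g \<longrightarrow> riemannian_at g p \<or> lorentzian_at g p) \<and>
     sing g \<subseteq> closure {p. riemannian_at g p} \<inter> closure {p. lorentzian_at g p}"


section \<open>Dual connection, Levi-Civita connection, curvature\<close>

definition dual_conn :: "('a, 'n::finite) chart set \<Rightarrow> ('a, 'n) metric
    \<Rightarrow> ('a \<Rightarrow> real^'n) \<Rightarrow> ('a \<Rightarrow> real^'n) \<Rightarrow> ('a \<Rightarrow> real^'n) \<Rightarrow> 'a \<Rightarrow> real" where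
  "dual_conn \<A> g X Y Z p =
     (deriv_along \<A> X (\<lambda>q. g q (Y q) (Z q)) p
      + deriv_along \<A> Y (\<lambda>q. g q (Z q) (X q)) p
      - deriv_along \<A> Z (\<lambda>q. g q (X q) (Y q)) p
      + g p (bracket \<A> X Y p) (Z p)
      - g p (bracket \<A> Y Z p) (X p)
      + g p (bracket \<A> Z X p) (Y p)) / 2"

text \<open>The Levi-Civita connection, given by the Koszul formula; meaningful off \<open>sing g\<close>.\<close>

definition nabla :: "('a::topological_space, 'n::finite) chart set \<Rightarrow> ('a, 'n) metric
    \<Rightarrow> ('a \<Rightarrow> real^'n) \<Rightarrow> ('a \<Rightarrow> real^'n) \<Rightarrow> 'a \<Rightarrow> real^'n" where
  "nabla \<A> g X Y p = (THE v. \<forall>U Z. open U \<and> p \<in> U \<and> smooth_field \<A> U Z \<longrightarrow>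
     g p v (Z p) = dual_conn \<A> g X Y Z p)"

definition riem :: "('a::topological_space, 'n::finite) chart set \<Rightarrow> ('a, 'n) metric
    \<Rightarrow> ('a \<Rightarrow> real^'n) \<Rightarrow> ('a \<Rightarrow> real^'n) \<Rightarrow> ('a \<Rightarrow> real^'n) \<Rightarrow> 'a \<Rightarrow> real^'n" where
  "riem \<A> g X Y Z p =
     nabla \<A> g X (nabla \<A> g Y Z) p - nabla \<A> g Y (nabla \<A> g X Z) p
     - nabla \<A> g (bracket \<A> X Y) Z p"

definition gram :: "('a, 'n::finite) metric \<Rightarrow> 'a \<Rightarrow> real^'n \<Rightarrow> real^'n \<Rightarrow> real^2^2" where
  "gram g p v w = vector [vector [g p v v, g p v w], vector [g p w v, g p w w]]"

definition sect_curv :: "('a::topological_space, 'n::finite) chart set \<Rightarrow> ('a, 'n) metric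
    \<Rightarrow> ('a \<Rightarrow> real^'n) \<Rightarrow> ('a \<Rightarrow> real^'n) \<Rightarrow> 'a \<Rightarrow> real" where
  "sect_curv \<A> g X Y p = g p (riem \<A> g X Y X p) (Y p) / det (gram g p (X p) (Y p))"

text \<open>The values of \<open>F\<close> on \<open>sing g\<close> are ignored: \<open>F\<close> stands for a function on \<open>U - sing g\<close>, and \<open>F'\<close>
  is its smooth extension to \<open>U\<close>.\<close>

definition smooth_extension :: "('a, 'n::finite) chart set \<Rightarrow> ('a, 'n) metric \<Rightarrow> 'a set
    \<Rightarrow> ('a \<Rightarrow> real) \<Rightarrow> ('a \<Rightarrow> real) \<Rightarrow> bool" where
  "smooth_extension \<A> g U F F' \<longleftrightarrow> smooth_fun \<A> U F' \<and> (\<forall>p \<in> U - sing g. F' p = F p)"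

text \<open>\<open>\<langle>R(A,B)A,B\<rangle>\<close>, for the restrictions \<open>A\<close>, \<open>B\<close> of \<open>X\<close>, \<open>Y\<close> to \<open>sing g\<close>, is well-defined on
  \<open>U \<inter> sing g\<close> and equal to \<open>h\<close> there. The existence of some such \<open>h\<close> says that it is
  well-defined.\<close>

definition sing_curv :: "('a::topological_space, 'n::finite) chart set \<Rightarrow> ('a, 'n) metric \<Rightarrow> 'a set
    \<Rightarrow> ('a \<Rightarrow> real^'n) \<Rightarrow> ('a \<Rightarrow> real^'n) \<Rightarrow> ('a \<Rightarrow> real) \<Rightarrow> bool" where
  "sing_curv \<A> g U X Y h \<longleftrightarrow>
     (\<forall>X' Y' Z' W'.
        smooth_field \<A> U X' \<and> smooth_field \<A> U Y' \<and> smooth_field \<A> U Z' \<and> smooth_field \<A> U W' \<and>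
        (\<forall>p \<in> U \<inter> sing g. X' p = X p \<and> Y' p = Y p \<and> Z' p = X p \<and> W' p = Y p) \<longrightarrow>
        (\<exists>F. smooth_extension \<A> g U (\<lambda>p. g p (riem \<A> g X' Y' Z' p) (W' p)) F \<and>
             (\<forall>p \<in> U \<inter> sing g. F p = h p)))"


section \<open>Geometry of the singular hypersurface\<close>

text \<open>\<open>II\<^sub>R\<close>, \<open>\<H>\<close> and \<open>III\<close> are tensors, so they are given as forms on tangent vectors at a point
  \<open>p\<close> of \<open>sing g\<close>: each is the common value obtained from all local smooth extensions of its
  arguments. The argument \<open>r\<close> of \<open>II\<close> is a radical vector at \<open>p\<close>, the vectors \<open>x\<close>, \<open>y\<close> in
  \<open>\<H>\<close> and \<open>III\<close> are tangent to \<open>sing g\<close>.\<close>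

definition II :: "('a::topological_space, 'n::finite) chart set \<Rightarrow> ('a, 'n) metric
    \<Rightarrow> 'a \<Rightarrow> real^'n \<Rightarrow> real^'n \<Rightarrow> real^'n \<Rightarrow> real" where
  "II \<A> g p r a b = (THE s. \<forall>U X Y Z.
     open U \<and> p \<in> U \<and> smooth_field \<A> U X \<and> smooth_field \<A> U Y \<and> smooth_field \<A> U Z \<and>
     X p = a \<and> Y p = b \<and> Z p = r \<longrightarrow> dual_conn \<A> g X Y Z p = s)"

definition tangent_field :: "('a, 'n::finite) chart set \<Rightarrow> ('a, 'n) metric \<Rightarrow> 'a set \<Rightarrow> ('a \<Rightarrow> real^'n) \<Rightarrow> bool" where
  "tangent_field \<A> g U X \<longleftrightarrow> smooth_field \<A> U X \<and> (\<forall>q \<in> U \<inter> sing g. X q \<in> sing_tangent \<A> g q)"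

text \<open>In \<open>\<H>\<close> the vector \<open>n\<close> is the value of the main normal at \<open>p\<close>.\<close>

definition \<H> :: "('a::topological_space, 'n::finite) chart set \<Rightarrow> ('a, 'n) metric
    \<Rightarrow> 'a \<Rightarrow> real^'n \<Rightarrow> real^'n \<Rightarrow> real^'n \<Rightarrow> real" where
  "\<H> \<A> g p n x y = (THE s. \<forall>U X Y Z.
     open U \<and> p \<in> U \<and> tangent_field \<A> g U X \<and> tangent_field \<A> g U Y \<and> smooth_field \<A> U Z \<and>
     X p = x \<and> Y p = y \<and> Z p = n \<longrightarrow> dual_conn \<A> g X Y Z p = s)"

text \<open>Together the two conditions determine \<open>N\<close> pointwise, and \<open>R\<close> pointwise up to sign. Hence \<open>N\<close> and
  (for a suitable choice of signs, locally) \<open>R\<close> are smooth. This is not required here: a global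
  smooth \<open>R\<close> need not exist, and the sign of \<open>R(p)\<close> is immaterial for everything below, where \<open>\<rho>\<close>,
  \<open>II\<close> and \<open>III\<close> are only multiplied by \<open>R\<close> or tested for vanishing.\<close>

definition main_normal :: "('a::topological_space, 'n::finite) chart set \<Rightarrow> ('a, 'n) metric \<Rightarrow> ('a \<Rightarrow> real^'n) \<Rightarrow> bool" where
  "main_normal \<A> g N \<longleftrightarrow> (\<forall>p\<in>sing g.
     (\<forall>v\<in>sing_tangent \<A> g p. g p (N p) v = 0) \<and>
     (\<forall>r\<in>Rad g p. II \<A> g p r (N p) (N p) = 0) \<and>
     g p (N p) (N p) = 1)"

definition main_radical :: "('a::topological_space, 'n::finite) chart set \<Rightarrow> ('a, 'n) metric
    \<Rightarrow> ('a \<Rightarrow> real^'n) \<Rightarrow> ('a \<Rightarrow> real^'n) \<Rightarrow> bool" where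
  "main_radical \<A> g N R \<longleftrightarrow> (\<forall>p\<in>sing g. R p \<in> Rad g p \<and> \<H> \<A> g p (N p) (R p) (R p) = -1)"

definition screen :: "('a::topological_space, 'n::finite) chart set \<Rightarrow> ('a, 'n) metric
    \<Rightarrow> ('a \<Rightarrow> real^'n) \<Rightarrow> ('a \<Rightarrow> real^'n) \<Rightarrow> 'a \<Rightarrow> (real^'n) set" where
  "screen \<A> g N R p = {v \<in> sing_tangent \<A> g p. \<H> \<A> g p (N p) v (R p) = 0}"

definition \<nu> :: "('a, 'n::finite) metric \<Rightarrow> ('a \<Rightarrow> real^'n) \<Rightarrow> 'a \<Rightarrow> real^'n \<Rightarrow> real" where
  "\<nu> g N p v = g p v (N p)"

definition \<rho> :: "('a::topological_space, 'n::finite) chart set \<Rightarrow> ('a, 'n) metric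
    \<Rightarrow> ('a \<Rightarrow> real^'n) \<Rightarrow> ('a \<Rightarrow> real^'n) \<Rightarrow> 'a \<Rightarrow> real^'n \<Rightarrow> real" where
  "\<rho> \<A> g N R p v = - \<H> \<A> g p (N p) (v - \<nu> g N p v *\<^sub>R N p) (R p)"

definition screen_part :: "('a::topological_space, 'n::finite) chart set \<Rightarrow> ('a, 'n) metric
    \<Rightarrow> ('a \<Rightarrow> real^'n) \<Rightarrow> ('a \<Rightarrow> real^'n) \<Rightarrow> 'a \<Rightarrow> real^'n \<Rightarrow> real^'n" where
  "screen_part \<A> g N R p v = v - \<nu> g N p v *\<^sub>R N p - \<rho> \<A> g N R p v *\<^sub>R R p"

definition II_flat :: "('a::topological_space, 'n::finite) chart set \<Rightarrow> ('a, 'n) metric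
    \<Rightarrow> ('a \<Rightarrow> real^'n) \<Rightarrow> ('a \<Rightarrow> real^'n) \<Rightarrow> bool" where
  "II_flat \<A> g N R \<longleftrightarrow>
     (\<forall>p\<in>sing g. \<forall>v\<in>screen \<A> g N R p. \<forall>w\<in>screen \<A> g N R p. II \<A> g p (R p) v w = 0)"

text \<open>\<open>D\<close> is the smooth extension of \<open>\<nabla>\<^sub>XY\<close> across \<open>sing g\<close>, which exists if \<open>sing g\<close> is II-flat.\<close>

definition III :: "('a::topological_space, 'n::finite) chart set \<Rightarrow> ('a, 'n) metric
    \<Rightarrow> ('a \<Rightarrow> real^'n) \<Rightarrow> 'a \<Rightarrow> real^'n \<Rightarrow> real^'n \<Rightarrow> real^'n \<Rightarrow> real" where
  "III \<A> g R p x y z = (THE s. \<forall>U X Y D.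
     open U \<and> p \<in> U \<and> tangent_field \<A> g U X \<and> tangent_field \<A> g U Y \<and> X p = x \<and> Y p = y \<and>
     smooth_field \<A> U D \<and> (\<forall>q \<in> U - sing g. D q = nabla \<A> g X Y q) \<longrightarrow>
     II \<A> g p (R p) (D p) z = s)"

definition III_flat :: "('a::topological_space, 'n::finite) chart set \<Rightarrow> ('a, 'n) metric
    \<Rightarrow> ('a \<Rightarrow> real^'n) \<Rightarrow> ('a \<Rightarrow> real^'n) \<Rightarrow> bool" where
  "III_flat \<A> g N R \<longleftrightarrow> II_flat \<A> g N R \<and>
     (\<forall>p\<in>sing g. \<forall>v\<in>screen \<A> g N R p. \<forall>w\<in>screen \<A> g N R p. III \<A> g R p v w (R p) = 0)"

text \<open>\<open>X\<close> and \<open>Y\<close> are smooth vector fields on the open set \<open>U\<close> spanning a plane field that is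
  nondegenerate off \<open>sing g\<close>, and of rank 1 and containing the radical on \<open>sing g\<close>.\<close>

definition radical_plane :: "('a::topological_space, 'n::finite) chart set \<Rightarrow> ('a, 'n) metric
    \<Rightarrow> ('a \<Rightarrow> real^'n) \<Rightarrow> 'a set \<Rightarrow> ('a \<Rightarrow> real^'n) \<Rightarrow> ('a \<Rightarrow> real^'n) \<Rightarrow> bool" where
  "radical_plane \<A> g R U X Y \<longleftrightarrow> open U \<and> smooth_field \<A> U X \<and> smooth_field \<A> U Y \<and>
     (\<forall>p\<in>U. X p \<noteq> Y p \<and> independent {X p, Y p}) \<and>
     (\<forall>p \<in> U - sing g. rank (gram g p (X p) (Y p)) = 2) \<and>
     (\<forall>p \<in> U \<inter> sing g. rank (gram g p (X p) (Y p)) = 1 \<and> R p \<in> span {X p, Y p})"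

end

theory Submission
  imports Defs
begin

text \<open>Near a point of the hypersurface one works in a chart in which the hypersurface is a coordinate
  hyperplane. Let \<open>r\<close> be a radical vector and \<open>\<Gamma>\<close> the Christoffel symbols of the first kind; then
  \<open>II\<^sub>r(a, b) = \<Gamma>(a, b, r)\<close> and \<open>\<H>(a, b) = \<Gamma>(a, b, N)\<close>. The adjugate of the metric is a nonzero multiple of
  \<open>r \<otimes> r\<close> on the hypersurface and its determinant vanishes to first order there. Hence the only
  singular part of \<open>\<langle>R(A,B)C,D\<rangle>\<close> is a multiple of
  \<open>(II\<^sub>r(A,C) II\<^sub>r(B,D) - II\<^sub>r(B,C) II\<^sub>r(A,D)) / det g\<close>, and a smooth function vanishing on the hypersurface is
  smoothly divisible by \<open>det g\<close>.

  For a plane containing \<open>r\<close> the numerator reduces to \<open>-II\<^sub>r(r,B)\<^sup>2\<close>, which vanishes only if \<open>B\<close> is tangent, whereas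
  the Gram determinant vanishes exactly to first order; this is (a). Perturbing one argument by a
  transverse field times \<open>det g\<close> changes the value on the hypersurface by a multiple of \<open>II\<^sub>r(B,B)\<close>,
  which gives the equivalence of (3) and (4). If \<open>II\<close> vanishes, differentiating
  this identity along the hypersurface shows that \<open>\<langle>R(r,v)r,v\<rangle> = \<H>(r,r)\<H>(v,v) - \<H>(r,v)\<^sup>2\<close>, which
  gives the equivalence of (1) and (2) since \<open>III(v,w,r)\<close> is a nonzero multiple of \<open>\<H>(v,w)\<close>.\<close>


section \<open>Calculus of \<open>C\<^sup>k\<close> maps\<close>

text \<open>The inverse metric does not exist on the hypersurface, so the connection is written as
  \<open>adj_vec\<close> of the first-kind symbols divided by \<open>det\<close>: the adjugate is
  polynomial in the metric, hence smooth up to the hypersurface, and everything singular sits in one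
  scalar denominator. Transversality enters through Jacobi's formula: the derivative of
  \<open>det\<close> along w is a nonzero multiple of that of the metric on (r, r). This makes the
  radical a line and identifies \<open>Gam\<close>(a, r, r) with a nonzero multiple of the normal
  component of a; tangency of the radical then gives \<open>Gam\<close>(r, r, r) = 0. Since \<H>(r,
  r) = -1, the expression \<H>(r, r)\<H>(v, v) - \<H>(r, v)^2 is minus \<H>(s, s) for the screen
  component s of v, which is why vanishing on all planes means vanishing on the screen. Connection
  vectors at the hypersurface are determined only modulo the radical; curvature values there are
  expressed through any representative, and flatness makes the choice irrelevant.\<close>

lemma Ck_on_cong:
  assumes "open S" "\<And>x. x \<in> S \<Longrightarrow> f x = g x"
  shows "Ck_on k S f \<longleftrightarrow> Ck_on k S g"
  using assms(2)
proof (induction k arbitrary: f g)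
  case 0
  then show ?case by (auto intro: continuous_on_cong[THEN iffD1])
next
  case (Suc k)
  have d: "(f has_derivative D) (at x) \<longleftrightarrow> (g has_derivative D) (at x)" if "x \<in> S" for x D
    using has_derivative_transform_within_open[OF _ assms(1) that, of f D UNIV g]
      has_derivative_transform_within_open[OF _ assms(1) that, of g D UNIV f] Suc.prems by auto
  \<comment> \<open>\<open>frechet_derivative\<close> is a choice among all derivatives; both maps
    have the same candidates, so the chosen values agree even without differentiability.\<close>
  have "frechet_derivative f (at x) = frechet_derivative g (at x)" if "x \<in> S" for x
    using d[OF that] by (simp add: frechet_derivative_def)
  then have "Ck_on k S (\<lambda>x. frechet_derivative f (at x) v) \<longleftrightarrow> Ck_on k S (\<lambda>x. frechet_derivative g (at x) v)" for v
    by (intro Suc.IH) auto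
  moreover have "f differentiable (at x) \<longleftrightarrow> g differentiable (at x)" if "x \<in> S" for x
    using d[OF that] by (simp add: differentiable_def)
  ultimately show ?case by simp
qed

lemma Ck_on_SucI:
  assumes "open S" "\<And>x. x \<in> S \<Longrightarrow> (f has_derivative f' x) (at x)"
    and "\<And>v. Ck_on k S (\<lambda>x. f' x v)"
  shows "Ck_on (Suc k) S f"
proof -
  have "frechet_derivative f (at x) = f' x" if "x \<in> S" for x
    using frechet_derivative_at[OF assms(2)[OF that]] by simp
  then have "Ck_on k S (\<lambda>x. frechet_derivative f (at x) v) \<longleftrightarrow> Ck_on k S (\<lambda>x. f' x v)" for v
    by (intro Ck_on_cong[OF assms(1)]) auto
  then show ?thesis using assms by (auto simp: differentiable_def)
qed

lemma Ck_on_SucD: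
  assumes "Ck_on (Suc k) S f"
  shows "\<And>x. x \<in> S \<Longrightarrow> (f has_derivative frechet_derivative f (at x)) (at x)"
    and "\<And>v. Ck_on k S (\<lambda>x. frechet_derivative f (at x) v)"
  using assms by (auto simp: frechet_derivative_works)

lemma Ck_on_pred: "Ck_on (Suc k) S f \<Longrightarrow> Ck_on k S f"
proof (induction k arbitrary: f)
  case 0
  then show ?case
    by (auto intro!: continuous_at_imp_continuous_on differentiable_imp_continuous_within)
next
  case (Suc k)
  then show ?case by simp
qed

lemma Ck_on_imp_continuous_on: "Ck_on k S f \<Longrightarrow> continuous_on S f"
  by (induction k) (auto dest: Ck_on_pred simp del: Ck_on.simps(2))

lemma Ck_on_subset: "Ck_on k S f \<Longrightarrow> T \<subseteq> S \<Longrightarrow> Ck_on k T f"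
proof (induction k arbitrary: f)
  case 0
  then show ?case by (auto intro: continuous_on_subset)
next
  case (Suc k)
  then show ?case by auto
qed

lemma Ck_on_local:
  "(\<And>x. x \<in> S \<Longrightarrow> \<exists>T. open T \<and> x \<in> T \<and> Ck_on k T f) \<Longrightarrow> Ck_on k S f"
proof (induction k arbitrary: f)
  case 0
  then show ?case
    by (metis Ck_on.simps(1) continuous_at_imp_continuous_on continuous_on_eq_continuous_at)
next
  case (Suc k)
  have "f differentiable (at x)" if "x \<in> S" for x
    using Suc.prems[OF that] by auto
  moreover have "Ck_on k S (\<lambda>x. frechet_derivative f (at x) v)" for v
  proof (rule Suc.IH)
    fix x assume "x \<in> S"
    from Suc.prems[OF this] show "\<exists>T. open T \<and> x \<in> T \<and> Ck_on k T (\<lambda>x. frechet_derivative f (at x) v)"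
      by auto
  qed
  ultimately show ?case by simp
qed

lemma Ck_on_const: "open S \<Longrightarrow> Ck_on k S (\<lambda>x. c)"
proof (induction k arbitrary: c)
  case (Suc k)
  then show ?case by (intro Ck_on_SucI[of _ _ "\<lambda>_ _. 0"]) auto
qed simp

lemma Ck_on_bounded_linear:
  assumes "bounded_linear L" "open S" "Ck_on k S f"
  shows "Ck_on k S (\<lambda>x. L (f x))"
  using assms(3)
proof (induction k arbitrary: f)
  case 0
  then show ?case by (simp add: assms(1) bounded_linear.continuous_on)
next
  case (Suc k)
  show ?case
    by (rule Ck_on_SucI[OF assms(2) bounded_linear.has_derivative[OF assms(1) Ck_on_SucD(1)[OF Suc.prems]]
        Suc.IH[OF Ck_on_SucD(2)[OF Suc.prems]]])
qed

lemma Ck_on_add: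
  assumes "open S" "Ck_on k S f" "Ck_on k S g"
  shows "Ck_on k S (\<lambda>x. f x + g x)"
  using assms(2,3)
proof (induction k arbitrary: f g)
  case 0
  then show ?case by (simp add: continuous_on_add)
next
  case (Suc k)
  show ?case
    by (rule Ck_on_SucI[OF assms(1) has_derivative_add[OF Ck_on_SucD(1)[OF Suc.prems(1)] Ck_on_SucD(1)[OF Suc.prems(2)]]
        Suc.IH[OF Ck_on_SucD(2)[OF Suc.prems(1)] Ck_on_SucD(2)[OF Suc.prems(2)]]])
qed

lemma Ck_on_bounded_bilinear:
  assumes "bounded_bilinear P" "open S" "Ck_on k S f" "Ck_on k S g"
  shows "Ck_on k S (\<lambda>x. P (f x) (g x))"
  using assms(3,4)
proof (induction k arbitrary: f g)
  case 0
  then show ?case by (simp add: bounded_bilinear.continuous_on[OF assms(1)])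
next
  case (Suc k)
  show ?case
    by (rule Ck_on_SucI[OF assms(2)
          bounded_bilinear.FDERIV[OF assms(1) Ck_on_SucD(1)[OF Suc.prems(1)] Ck_on_SucD(1)[OF Suc.prems(2)]]
          Ck_on_add[OF assms(2) Suc.IH[OF Ck_on_pred[OF Suc.prems(1)] Ck_on_SucD(2)[OF Suc.prems(2)]]
            Suc.IH[OF Ck_on_SucD(2)[OF Suc.prems(1)] Ck_on_pred[OF Suc.prems(2)]]]])
qed

lemma Ck_on_sum:
  assumes "open S" "\<And>i. i \<in> I \<Longrightarrow> Ck_on k S (f i)"
  shows "Ck_on k S (\<lambda>x. \<Sum>i\<in>I. f i x)"
  using assms(2) by (induction I rule: infinite_finite_induct) (auto intro!: Ck_on_const Ck_on_add assms(1))

lemma derivative_eq_sum_Basis: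
  fixes f :: "'a::euclidean_space \<Rightarrow> 'b::real_normed_vector"
  assumes "f differentiable (at x)"
  shows "frechet_derivative f (at x) v = (\<Sum>b\<in>Basis. (v \<bullet> b) *\<^sub>R frechet_derivative f (at x) b)"
proof -
  interpret linear "frechet_derivative f (at x)" by (rule linear_frechet_derivative[OF assms])
  have "frechet_derivative f (at x) v = frechet_derivative f (at x) (\<Sum>b\<in>Basis. (v \<bullet> b) *\<^sub>R b)"
    by (simp add: euclidean_representation)
  then show ?thesis by (simp add: sum scale)
qed

text \<open>The definition controls derivatives only in fixed directions; expanding the moving
  direction in the finite basis reduces to these.\<close>

lemma Ck_on_derivative_along:
  fixes f :: "'a::euclidean_space \<Rightarrow> 'b::real_normed_vector"
  assumes "open S" "Ck_on (Suc k) S f" "Ck_on k S h"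
  shows "Ck_on k S (\<lambda>x. frechet_derivative f (at x) (h x))"
proof -
  have "Ck_on k S (\<lambda>x. \<Sum>b\<in>Basis. (h x \<bullet> b) *\<^sub>R frechet_derivative f (at x) b)"
    by (intro Ck_on_sum assms Ck_on_bounded_bilinear[OF bounded_bilinear_scaleR]
        Ck_on_bounded_linear[OF bounded_linear_inner_left] Ck_on_SucD(2)[OF assms(2)])
  also have "?this \<longleftrightarrow> ?thesis"
    using assms(2) by (intro Ck_on_cong assms) (auto simp: derivative_eq_sum_Basis)
  finally show ?thesis .
qed

text \<open>The chain rule is used with the inner derivative expanded in the basis: each summand is
  a component of that derivative times an outer derivative in a fixed direction composed with
  \<open>h\<close>, and the induction hypothesis applies to the latter.\<close>

lemma Ck_on_compose:
  fixes f :: "'a::euclidean_space \<Rightarrow> 'b::real_normed_vector" and h :: "'c::real_normed_vector \<Rightarrow> 'a"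
  assumes "open S" "open T" "Ck_on k T f" "Ck_on k S h" "h ` S \<subseteq> T"
  shows "Ck_on k S (\<lambda>x. f (h x))"
  using assms(3-5)
proof (induction k arbitrary: f h)
  case 0
  then show ?case by (auto intro: continuous_on_compose2)
next
  case (Suc k)
  let ?D = "\<lambda>x v. \<Sum>b\<in>Basis. (frechet_derivative h (at x) v \<bullet> b) *\<^sub>R frechet_derivative f (at (h x)) b"
  have "((\<lambda>x. f (h x)) has_derivative ?D x) (at x)" if "x \<in> S" for x
  proof -
    have 1: "(f has_derivative frechet_derivative f (at (h x))) (at (h x))"
      using Suc.prems that by (intro Ck_on_SucD(1)[of k T]) auto
    have "((\<lambda>x. f (h x)) has_derivative (\<lambda>v. frechet_derivative f (at (h x)) (frechet_derivative h (at x) v))) (at x)"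
      using has_derivative_compose[OF Ck_on_SucD(1)[OF Suc.prems(2) that] 1] .
    also have "(\<lambda>v. frechet_derivative f (at (h x)) (frechet_derivative h (at x) v)) = ?D x"
      using 1 by (intro ext derivative_eq_sum_Basis) (auto simp: differentiable_def)
    finally show ?thesis .
  qed
  moreover have "Ck_on k S (\<lambda>x. ?D x v)" for v
    by (intro Ck_on_sum assms Ck_on_bounded_bilinear[OF bounded_bilinear_scaleR]
        Ck_on_bounded_linear[OF bounded_linear_inner_left] Ck_on_SucD(2)[OF Suc.prems(2)]
        Suc.IH Ck_on_SucD(2)[OF Suc.prems(1)] Ck_on_pred[OF Suc.prems(2)] Suc.prems(3))
  ultimately show ?case by (rule Ck_on_SucI[OF assms(1)])
qed

text \<open>The derivative of the reciprocal is built from the reciprocal itself and the derivative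
  of \<open>f\<close>, so a single induction on the order closes.\<close>

lemma Ck_on_inverse:
  fixes f :: "'a::real_normed_vector \<Rightarrow> real"
  assumes "open S" "Ck_on k S f" "\<And>x. x \<in> S \<Longrightarrow> f x \<noteq> 0"
  shows "Ck_on k S (\<lambda>x. inverse (f x))"
  using assms(2)
proof (induction k)
  case 0
  then show ?case using assms(3) by (auto intro: continuous_on_inverse)
next
  case (Suc k)
  have "((\<lambda>x. inverse (f x)) has_derivative
      (\<lambda>v. - 1 *\<^sub>R (inverse (f x) * frechet_derivative f (at x) v * inverse (f x)))) (at x)" if "x \<in> S" for x
    using Deriv.has_derivative_inverse[OF assms(3)[OF that] Ck_on_SucD(1)[OF Suc.prems that]] by simp
  moreover have "Ck_on k S (\<lambda>x. - 1 *\<^sub>R (inverse (f x) * frechet_derivative f (at x) v * inverse (f x)))" for v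
    by (intro Ck_on_bounded_linear[OF bounded_linear_scaleR_right] Ck_on_bounded_bilinear[OF bounded_bilinear_mult]
        Ck_on_SucD(2)[OF Suc.prems] assms Suc.IH Ck_on_pred[OF Suc.prems])
  ultimately show ?case by (rule Ck_on_SucI[OF assms(1)])
qed

section \<open>Smooth maps\<close>

named_theorems smooth_intros

lemma smooth_on_cong:
  assumes "open S" "\<And>x. x \<in> S \<Longrightarrow> f x = g x"
  shows "smooth_on S f \<longleftrightarrow> smooth_on S g"
  using Ck_on_cong[OF assms] by (simp add: smooth_on_def)

lemma smooth_on_subset: "smooth_on S f \<Longrightarrow> T \<subseteq> S \<Longrightarrow> smooth_on T f"
  unfolding smooth_on_def using Ck_on_subset by blast

lemma smooth_on_local:
  "(\<And>x. x \<in> S \<Longrightarrow> \<exists>T. open T \<and> x \<in> T \<and> smooth_on T f) \<Longrightarrow> smooth_on S f"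
  unfolding smooth_on_def using Ck_on_local by meson

lemma smooth_on_imp_continuous_on: "smooth_on S f \<Longrightarrow> continuous_on S f"
  using Ck_on_imp_continuous_on by (auto simp: smooth_on_def)

lemma smooth_on_has_derivative:
  "smooth_on S f \<Longrightarrow> x \<in> S \<Longrightarrow> (f has_derivative frechet_derivative f (at x)) (at x)"
  unfolding smooth_on_def using Ck_on_SucD(1) by blast

lemma smooth_on_differentiable: "smooth_on S f \<Longrightarrow> x \<in> S \<Longrightarrow> f differentiable (at x)"
  using smooth_on_has_derivative differentiableI by blast

lemma smooth_on_derivative: "smooth_on S f \<Longrightarrow> smooth_on S (\<lambda>x. frechet_derivative f (at x) v)"
  unfolding smooth_on_def using Ck_on_SucD(2) by blast

lemma smooth_onI_derivative:
  assumes "open S" "\<And>x. x \<in> S \<Longrightarrow> (f has_derivative f' x) (at x)" "\<And>v. smooth_on S (\<lambda>x. f' x v)"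
  shows "smooth_on S f"
  unfolding smooth_on_def
proof
  fix k
  have "Ck_on (Suc k) S f"
    using assms by (intro Ck_on_SucI[of _ _ f']) (auto simp: smooth_on_def)
  then show "Ck_on k S f" by (rule Ck_on_pred)
qed

lemma smooth_on_const [smooth_intros]: "open S \<Longrightarrow> smooth_on S (\<lambda>x. c)"
  by (simp add: smooth_on_def Ck_on_const)

lemma smooth_on_ident [smooth_intros]: "open S \<Longrightarrow> smooth_on S (\<lambda>x. x)"
  by (rule smooth_onI_derivative) (auto intro!: derivative_eq_intros smooth_intros)

lemma smooth_on_bounded_linear:
  "bounded_linear L \<Longrightarrow> open S \<Longrightarrow> smooth_on S f \<Longrightarrow> smooth_on S (\<lambda>x. L (f x))"
  by (simp add: smooth_on_def Ck_on_bounded_linear)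

lemma smooth_on_bounded_bilinear:
  "bounded_bilinear P \<Longrightarrow> open S \<Longrightarrow> smooth_on S f \<Longrightarrow> smooth_on S h \<Longrightarrow> smooth_on S (\<lambda>x. P (f x) (h x))"
  by (simp add: smooth_on_def Ck_on_bounded_bilinear)

lemma smooth_on_add [smooth_intros]:
  "open S \<Longrightarrow> smooth_on S f \<Longrightarrow> smooth_on S h \<Longrightarrow> smooth_on S (\<lambda>x. f x + h x)"
  by (simp add: smooth_on_def Ck_on_add)

lemma smooth_on_minus [smooth_intros]: "open S \<Longrightarrow> smooth_on S f \<Longrightarrow> smooth_on S (\<lambda>x. - f x)"
  by (rule smooth_on_bounded_linear[OF bounded_linear_minus[OF bounded_linear_ident]])

lemma smooth_on_diff [smooth_intros]:
  "open S \<Longrightarrow> smooth_on S f \<Longrightarrow> smooth_on S h \<Longrightarrow> smooth_on S (\<lambda>x. f x - h x)"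
  using smooth_on_add[of S f "\<lambda>x. - h x"] smooth_on_minus[of S h] by simp

lemmas smooth_on_scaleR [smooth_intros] = smooth_on_bounded_bilinear[OF bounded_bilinear_scaleR]
  and smooth_on_inner [smooth_intros] = smooth_on_bounded_bilinear[OF bounded_bilinear_inner]
  and smooth_on_vec_nth [smooth_intros] = smooth_on_bounded_linear[OF bounded_linear_vec_nth]

lemma smooth_on_mult [smooth_intros]:
  fixes f h :: "'a::real_normed_vector \<Rightarrow> real"
  shows "open S \<Longrightarrow> smooth_on S f \<Longrightarrow> smooth_on S h \<Longrightarrow> smooth_on S (\<lambda>x. f x * h x)"
  by (rule smooth_on_bounded_bilinear[OF bounded_bilinear_mult])

lemma smooth_on_divide [smooth_intros]:
  fixes f h :: "'a::real_normed_vector \<Rightarrow> real"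
  assumes "open S" "smooth_on S f" "smooth_on S h" "\<And>x. x \<in> S \<Longrightarrow> h x \<noteq> 0"
  shows "smooth_on S (\<lambda>x. f x / h x)"
proof -
  have "smooth_on S (\<lambda>x. inverse (h x))"
    using assms by (simp add: smooth_on_def Ck_on_inverse)
  then show ?thesis unfolding divide_inverse using assms by (intro smooth_intros)
qed

lemma smooth_on_sum [smooth_intros]:
  "open S \<Longrightarrow> (\<And>i. i \<in> I \<Longrightarrow> smooth_on S (f i)) \<Longrightarrow> smooth_on S (\<lambda>x. \<Sum>i\<in>I. f i x)"
  by (simp add: smooth_on_def Ck_on_sum)

lemma smooth_on_prod [smooth_intros]:
  fixes f :: "'i \<Rightarrow> 'a::real_normed_vector \<Rightarrow> real"
  assumes "open S" "\<And>i. i \<in> I \<Longrightarrow> smooth_on S (f i)"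
  shows "smooth_on S (\<lambda>x. \<Prod>i\<in>I. f i x)"
  using assms(2) by (induction I rule: infinite_finite_induct) (auto intro!: smooth_intros assms(1))

lemma smooth_on_compose:
  fixes f :: "'a::euclidean_space \<Rightarrow> 'b::real_normed_vector" and h :: "'c::real_normed_vector \<Rightarrow> 'a"
  assumes "open S" "open T" "smooth_on T f" "smooth_on S h" "h ` S \<subseteq> T"
  shows "smooth_on S (\<lambda>x. f (h x))"
  using assms Ck_on_compose unfolding smooth_on_def by blast

lemma smooth_on_derivative_along [smooth_intros]:
  fixes f :: "'a::euclidean_space \<Rightarrow> 'b::real_normed_vector"
  assumes "open S" "smooth_on S f" "smooth_on S h"
  shows "smooth_on S (\<lambda>x. frechet_derivative f (at x) (h x))"
  using assms Ck_on_derivative_along unfolding smooth_on_def by blast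

lemma smooth_on_vec [smooth_intros]:
  fixes f :: "'i::finite \<Rightarrow> 'a::real_normed_vector \<Rightarrow> 'b::euclidean_space"
  assumes "open S" "\<And>i. smooth_on S (f i)"
  shows "smooth_on S (\<lambda>x. \<chi> i. f i x)"
proof -
  have L: "bounded_linear (\<lambda>y::'b. (\<chi> j. if j = i then y else 0) :: 'b^'i)" for i
    by (intro linear_conv_bounded_linear[THEN iffD1] linearI) (auto simp: vec_eq_iff)
  have "smooth_on S (\<lambda>x. \<Sum>i\<in>UNIV. \<chi> j. if j = i then f i x else 0)"
    using assms by (intro smooth_intros smooth_on_bounded_linear[OF L])
  also have "(\<lambda>x. \<Sum>i\<in>UNIV. \<chi> j. if j = i then f i x else 0) = (\<lambda>x. \<chi> i. f i x)"
    by (auto simp: vec_eq_iff fun_eq_iff sum_component)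
  finally show ?thesis .
qed

lemma smooth_on_det [smooth_intros]:
  fixes f :: "'a::real_normed_vector \<Rightarrow> real^'n^'n"
  assumes "open S" "smooth_on S f"
  shows "smooth_on S (\<lambda>x. det (f x))"
  unfolding det_def using assms by (intro smooth_intros)

lemma bounded_bilinear_matrix_vector_mult:
  "bounded_bilinear (\<lambda>(A::real^'n^'m) x. A *v x)"
proof -
  have "bounded_linear (\<lambda>A::real^'n^'m. A *v x)" for x
    by (intro linear_conv_bounded_linear[THEN iffD1] linearI)
       (auto simp: algebra_simps scaleR_matrix_vector_assoc)
  then have "bilinear (\<lambda>(A::real^'n^'m) x. A *v x)"
    by (auto simp: bilinear_def bounded_linear.linear)
  then show ?thesis by (simp add: bilinear_conv_bounded_bilinear)
qed

lemmas smooth_on_matrix_vector_mult [smooth_intros] = smooth_on_bounded_bilinear[OF bounded_bilinear_matrix_vector_mult]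

text \<open>Product rule for a derivative evaluated on a moving vector: one term moves the base
  point with the vector frozen, the other moves the vector. It is the source of the
  second-derivative terms in brackets and curvature.\<close>

lemma has_derivative_derivative_along:
  fixes f :: "'a::euclidean_space \<Rightarrow> 'b::real_normed_vector"
  assumes "open S" "smooth_on S f" "x \<in> S" "(h has_derivative h') (at x)"
  shows "((\<lambda>y. frechet_derivative f (at y) (h y)) has_derivative
     (\<lambda>u. frechet_derivative (\<lambda>y. frechet_derivative f (at y) (h x)) (at x) u + frechet_derivative f (at x) (h' u))) (at x)"
proof -
  let ?B = "\<lambda>b y. frechet_derivative f (at y) b"
  have D: "(?B b has_derivative frechet_derivative (?B b) (at x)) (at x)" for b
    by (intro smooth_on_has_derivative[OF smooth_on_derivative[OF assms(2)] assms(3)])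
  have eq: "frechet_derivative f (at y) w = (\<Sum>b\<in>Basis. (w \<bullet> b) *\<^sub>R ?B b y)" if "y \<in> S" for y w
    by (intro derivative_eq_sum_Basis smooth_on_differentiable[OF assms(2)] that)
  have 1: "((\<lambda>y. \<Sum>b\<in>Basis. (h y \<bullet> b) *\<^sub>R ?B b y) has_derivative
     (\<lambda>u. \<Sum>b\<in>Basis. (h x \<bullet> b) *\<^sub>R frechet_derivative (?B b) (at x) u + (h' u \<bullet> b) *\<^sub>R ?B b x)) (at x)"
    by (auto intro!: derivative_eq_intros assms D)
  have 2: "((\<lambda>y. \<Sum>b\<in>Basis. (h x \<bullet> b) *\<^sub>R ?B b y) has_derivative
     (\<lambda>u. \<Sum>b\<in>Basis. (h x \<bullet> b) *\<^sub>R frechet_derivative (?B b) (at x) u)) (at x)"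
    by (auto intro!: derivative_eq_intros assms D)
  have 3: "((\<lambda>y. frechet_derivative f (at y) (h x)) has_derivative
     (\<lambda>u. \<Sum>b\<in>Basis. (h x \<bullet> b) *\<^sub>R frechet_derivative (?B b) (at x) u)) (at x)"
    by (rule has_derivative_transform_within_open[OF 2 assms(1,3)]) (rule eq[symmetric])
  have 4: "((\<lambda>y. frechet_derivative f (at y) (h y)) has_derivative
     (\<lambda>u. \<Sum>b\<in>Basis. (h x \<bullet> b) *\<^sub>R frechet_derivative (?B b) (at x) u + (h' u \<bullet> b) *\<^sub>R ?B b x)) (at x)"
    by (rule has_derivative_transform_within_open[OF 1 assms(1,3)]) (rule eq[symmetric])
  have "(\<lambda>u. frechet_derivative (\<lambda>y. frechet_derivative f (at y) (h x)) (at x) u + frechet_derivative f (at x) (h' u))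
     = (\<lambda>u. \<Sum>b\<in>Basis. (h x \<bullet> b) *\<^sub>R frechet_derivative (?B b) (at x) u + (h' u \<bullet> b) *\<^sub>R ?B b x)"
    unfolding frechet_derivative_at[OF 3, symmetric] sum.distrib
    by (intro ext arg_cong2[of _ _ _ _ "(+)"] refl eq assms(3))
  then show ?thesis using 4 by simp
qed

section \<open>Symmetry of second derivatives\<close>

lemma smooth_on_has_vector_derivative_line:
  fixes f :: "'a::real_normed_vector \<Rightarrow> 'b::real_normed_vector"
  assumes "smooth_on S f" "y + s *\<^sub>R v \<in> S"
  shows "((\<lambda>s. f (y + s *\<^sub>R v)) has_vector_derivative frechet_derivative f (at (y + s *\<^sub>R v)) v) (at s)"
proof -
  have D: "(f has_derivative frechet_derivative f (at (y + s *\<^sub>R v))) (at (y + s *\<^sub>R v))"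
    by (rule smooth_on_has_derivative[OF assms])
  then interpret linear "frechet_derivative f (at (y + s *\<^sub>R v))"
    by (rule has_derivative_linear)
  have "((\<lambda>s. y + s *\<^sub>R v) has_derivative (\<lambda>h. h *\<^sub>R v)) (at s)"
    by (auto intro!: derivative_eq_intros)
  from has_derivative_compose[OF this D] show ?thesis
    by (simp add: has_vector_derivative_def scale)
qed

text \<open>The mean value theorem is applied in the direction \<open>v\<close> and then in
  \<open>w\<close>. The second difference itself is symmetric in the two directions, which is what
  the next lemma exploits.\<close>

lemma second_difference:
  fixes f :: "'a::real_normed_vector \<Rightarrow> real"
  assumes "smooth_on S f" "h > 0" "\<And>s t. s \<in> {0..h} \<Longrightarrow> t \<in> {0..h} \<Longrightarrow> x + s *\<^sub>R v + t *\<^sub>R w \<in> S"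
  obtains s t where "s \<in> {0..h}" "t \<in> {0..h}"
    "f (x + h *\<^sub>R v + h *\<^sub>R w) - f (x + h *\<^sub>R v) - f (x + h *\<^sub>R w) + f x =
      h * h * frechet_derivative (\<lambda>y. frechet_derivative f (at y) v) (at (x + s *\<^sub>R v + t *\<^sub>R w)) w"
proof -
  let ?D = "\<lambda>y. frechet_derivative f (at y) v"
  have 1: "DERIV (\<lambda>s. f (x + t *\<^sub>R w + s *\<^sub>R v)) s :> ?D (x + t *\<^sub>R w + s *\<^sub>R v)"
    if "s \<in> {0..h}" "t \<in> {0..h}" for s t
    unfolding has_real_derivative_iff_has_vector_derivative
    using assms(3)[OF that] by (intro smooth_on_has_vector_derivative_line[OF assms(1)]) (simp add: algebra_simps)
  have "DERIV (\<lambda>s. f (x + h *\<^sub>R w + s *\<^sub>R v) - f (x + 0 *\<^sub>R w + s *\<^sub>R v)) s :>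
      ?D (x + h *\<^sub>R w + s *\<^sub>R v) - ?D (x + 0 *\<^sub>R w + s *\<^sub>R v)" if "0 \<le> s" "s \<le> h" for s
    using that assms(2) by (intro DERIV_diff 1) auto
  from MVT2[OF assms(2) this] obtain s where s: "0 < s" "s < h"
    "f (x + h *\<^sub>R w + h *\<^sub>R v) - f (x + h *\<^sub>R v) - (f (x + h *\<^sub>R w) - f x) = h * (?D (x + h *\<^sub>R w + s *\<^sub>R v) - ?D (x + s *\<^sub>R v))"
    by auto
  have "DERIV (\<lambda>t. ?D (x + s *\<^sub>R v + t *\<^sub>R w)) t :> frechet_derivative ?D (at (x + s *\<^sub>R v + t *\<^sub>R w)) w"
    if "0 \<le> t" "t \<le> h" for t
    unfolding has_real_derivative_iff_has_vector_derivative
    using s assms(3)[of s t] that by (intro smooth_on_has_vector_derivative_line[OF smooth_on_derivative[OF assms(1)]]) auto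
  from MVT2[OF assms(2) this] obtain t where t: "0 < t" "t < h"
    "?D (x + s *\<^sub>R v + h *\<^sub>R w) - ?D (x + s *\<^sub>R v) = h * frechet_derivative ?D (at (x + s *\<^sub>R v + t *\<^sub>R w)) w"
    by auto
  have "f (x + h *\<^sub>R v + h *\<^sub>R w) - f (x + h *\<^sub>R v) - f (x + h *\<^sub>R w) + f x =
      h * (?D (x + s *\<^sub>R v + h *\<^sub>R w) - ?D (x + s *\<^sub>R v))"
    using s(3) by (simp add: algebra_simps)
  then show ?thesis using that[of s t] s t by simp
qed

lemma second_derivative_symmetric_real:
  fixes f :: "'a::real_normed_vector \<Rightarrow> real"
  assumes "open S" "smooth_on S f" "x \<in> S"
  shows "frechet_derivative (\<lambda>y. frechet_derivative f (at y) v) (at x) w =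
    frechet_derivative (\<lambda>y. frechet_derivative f (at y) w) (at x) v" (is "?l x = ?r x")
proof (rule ccontr)
  assume ne: "?l x \<noteq> ?r x"
  have "continuous_on S ?l" "continuous_on S ?r"
    by (intro smooth_on_imp_continuous_on smooth_on_derivative assms)+
  then have cl: "(?l \<longlongrightarrow> ?l x) (at x)" and cr: "(?r \<longlongrightarrow> ?r x) (at x)"
    using assms(1,3) by (metis continuous_on_eq_continuous_at continuous_at)+
  \<comment> \<open>Half the gap: if the two mixed derivatives take equal values at points where
    each is within \<open>e\<close> of its value at \<open>x\<close>, the gap would be smaller than
    itself.\<close>
  define e where "e = \<bar>?l x - ?r x\<bar> / 2"
  have "e > 0" using ne by (simp add: e_def)
  obtain d1 where d1: "d1 > 0" "\<And>y. dist y x < d1 \<Longrightarrow> \<bar>?l y - ?l x\<bar> < e"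
    using cl \<open>e > 0\<close> unfolding LIM_def dist_real_def by (metis abs_zero diff_self)
  obtain d2 where d2: "d2 > 0" "\<And>y. dist y x < d2 \<Longrightarrow> \<bar>?r y - ?r x\<bar> < e"
    using cr \<open>e > 0\<close> unfolding LIM_def dist_real_def by (metis abs_zero diff_self)
  obtain d3 where d3: "d3 > 0" "ball x d3 \<subseteq> S"
    using assms open_contains_ball by blast
  define d where "d = min d1 (min d2 d3)"
  \<comment> \<open>Keeps the whole parallelogram with sides h v and h w within distance
    \<open>d\<close> of \<open>x\<close>; the summand 1 covers the case that both vectors are
    0.\<close>
  define h where "h = d / (2 * (norm v + norm w + 1))"
  have nn: "norm v + norm w + 1 > 0" by (simp add: add_nonneg_pos)
  have "d > 0" using d1 d2 d3 by (simp add: d_def)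
  have "h > 0" using \<open>d > 0\<close> nn by (simp add: h_def)
  have near: "dist (x + s *\<^sub>R v + t *\<^sub>R w) x < d" if "s \<in> {0..h}" "t \<in> {0..h}" for s t
  proof -
    have "dist (x + s *\<^sub>R v + t *\<^sub>R w) x = norm (s *\<^sub>R v + t *\<^sub>R w)" by (simp add: dist_norm)
    also have "\<dots> \<le> h * norm v + h * norm w"
      using that by (intro norm_triangle_le add_mono) (auto intro: mult_right_mono)
    also have "\<dots> \<le> h * (norm v + norm w + 1)" using \<open>h > 0\<close> by (simp add: algebra_simps)
    also have "\<dots> = d / 2" using nn by (simp add: h_def divide_simps)
    also have "\<dots> < d" using \<open>d > 0\<close> by simp
    finally show ?thesis .
  qed
  have S: "x + s *\<^sub>R v + t *\<^sub>R w \<in> S" if "s \<in> {0..h}" "t \<in> {0..h}" for s t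
    using near[OF that] d3 by (auto simp: d_def dist_commute mem_ball)
  obtain s t where st: "s \<in> {0..h}" "t \<in> {0..h}"
    "f (x + h *\<^sub>R v + h *\<^sub>R w) - f (x + h *\<^sub>R v) - f (x + h *\<^sub>R w) + f x = h * h * ?l (x + s *\<^sub>R v + t *\<^sub>R w)"
    by (rule second_difference[OF assms(2) \<open>h > 0\<close> S])
  have S': "x + s *\<^sub>R w + t *\<^sub>R v \<in> S" if "s \<in> {0..h}" "t \<in> {0..h}" for s t
    using S[OF that(2,1)] by (simp add: algebra_simps)
  obtain s' t' where st': "s' \<in> {0..h}" "t' \<in> {0..h}"
    "f (x + h *\<^sub>R w + h *\<^sub>R v) - f (x + h *\<^sub>R w) - f (x + h *\<^sub>R v) + f x = h * h * ?r (x + s' *\<^sub>R w + t' *\<^sub>R v)"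
    by (rule second_difference[OF assms(2) \<open>h > 0\<close> S'])
  have "h * h * ?l (x + s *\<^sub>R v + t *\<^sub>R w) = h * h * ?r (x + t' *\<^sub>R v + s' *\<^sub>R w)"
    using st(3) st'(3) by (simp add: algebra_simps)
  then have "?l (x + s *\<^sub>R v + t *\<^sub>R w) = ?r (x + t' *\<^sub>R v + s' *\<^sub>R w)"
    using \<open>h > 0\<close> by simp
  moreover have "\<bar>?l (x + s *\<^sub>R v + t *\<^sub>R w) - ?l x\<bar> < e" "\<bar>?r (x + t' *\<^sub>R v + s' *\<^sub>R w) - ?r x\<bar> < e"
    using near[OF st(1,2)] near[OF st'(2,1)] d1 d2 by (auto simp: d_def)
  ultimately show False unfolding e_def by (simp add: abs_if split: if_splits)
qed

theorem second_derivative_symmetric: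
  fixes f :: "'a::real_normed_vector \<Rightarrow> 'b::euclidean_space"
  assumes "open S" "smooth_on S f" "x \<in> S"
  shows "frechet_derivative (\<lambda>y. frechet_derivative f (at y) v) (at x) w =
    frechet_derivative (\<lambda>y. frechet_derivative f (at y) w) (at x) v"
proof -
  have inner: "frechet_derivative (\<lambda>y. h y \<bullet> b) (at y) u = frechet_derivative h (at y) u \<bullet> b"
    if "smooth_on S h" "y \<in> S" for b y u and h :: "'a \<Rightarrow> 'b"
    using frechet_derivative_at[OF has_derivative_inner_left[OF smooth_on_has_derivative[OF that], of b], symmetric] by simp
  have *: "frechet_derivative (\<lambda>y. frechet_derivative (\<lambda>y. f y \<bullet> b) (at y) u) (at x) z
      = frechet_derivative (\<lambda>y. frechet_derivative f (at y) u) (at x) z \<bullet> b" for u z b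
  proof -
    have "((\<lambda>y. frechet_derivative (\<lambda>y. f y \<bullet> b) (at y) u) has_derivative
        (\<lambda>z. frechet_derivative (\<lambda>y. frechet_derivative f (at y) u) (at x) z \<bullet> b)) (at x)"
      by (rule has_derivative_transform_within_open[OF
            has_derivative_inner_left[OF smooth_on_has_derivative[OF smooth_on_derivative[OF assms(2)] assms(3)]] assms(1,3)])
         (simp add: inner[OF assms(2)])
    from frechet_derivative_at[OF this, symmetric] show ?thesis by simp
  qed
  show ?thesis
    by (rule euclidean_eqI) (metis * second_derivative_symmetric_real[OF assms(1) _ assms(3)]
        smooth_on_inner[OF assms(1,2) smooth_on_const[OF assms(1)]])
qed

section \<open>Division by a coordinate\<close>

text \<open>The weight \<open>p\<close> and the family of segments make this class of integrals
  closed under differentiation: the derivative along \<open>v\<close> is a sum of two integrals of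
  the same kind, with weights \<open>p s\<close> and \<open>p s * s\<close>.\<close>

lemma Ck_on_integral_segment:
  fixes f :: "'a::euclidean_space \<Rightarrow> 'b::euclidean_space"
  assumes S: "open S" "convex S" and AL: "bounded_linear A" "bounded_linear L"
    and m: "\<And>x s. x \<in> S \<Longrightarrow> s \<in> {0..1} \<Longrightarrow> A x + s *\<^sub>R L x \<in> S"
    and "smooth_on S f" "continuous_on {0..1} p"
  shows "Ck_on k S (\<lambda>x. integral {0..1::real} (\<lambda>s. p s *\<^sub>R f (A x + s *\<^sub>R L x)))"
  using assms(6,7)
proof (induction k arbitrary: f p)
  case 0
  have c: "continuous_on (S \<times> cbox 0 1) (\<lambda>(x, s). p s *\<^sub>R f (A x + s *\<^sub>R L x))"
    unfolding split_beta
    by (intro continuous_intros continuous_on_compose2[OF 0(2)] continuous_on_compose2[OF smooth_on_imp_continuous_on[OF 0(1)]]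
        bounded_linear.continuous_on[OF AL(1)] bounded_linear.continuous_on[OF AL(2)]) (auto intro!: m)
  show ?case using integral_continuous_on_param[OF c] by simp
next
  case (Suc k)
  let ?m = "\<lambda>x s. A x + s *\<^sub>R L x"
  let ?D = "frechet_derivative f"
  \<comment> \<open>The Leibniz rule asks for the derivative as a continuous operator-valued map; in
    finite dimension continuity may be checked on single vectors.\<close>
  let ?F = "\<lambda>x s. Blinfun (\<lambda>v. p s *\<^sub>R ?D (at (?m x s)) (A v + s *\<^sub>R L v))"
  have linD: "bounded_linear (?D (at (?m x s)))" if "x \<in> S" "s \<in> {0..1}" for x s
    by (intro has_derivative_bounded_linear[OF smooth_on_has_derivative[OF Suc.prems(1)]] m that)
  have blin: "bounded_linear (\<lambda>v. p s *\<^sub>R ?D (at (?m x s)) (A v + s *\<^sub>R L v))" if "x \<in> S" "s \<in> {0..1}" for x s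
    by (intro bounded_linear_compose[OF bounded_linear_scaleR_right] bounded_linear_compose[OF linD[OF that]]
        bounded_linear_add AL)
  have F: "blinfun_apply (?F x s) v = p s *\<^sub>R ?D (at (?m x s)) (A v + s *\<^sub>R L v)" if "x \<in> S" "s \<in> {0..1}" for x s v
    using blin[OF that] by (simp add: bounded_linear_Blinfun_apply)
  have F2: "blinfun_apply (?F x s) v = p s *\<^sub>R ?D (at (?m x s)) (A v) + (p s * s) *\<^sub>R ?D (at (?m x s)) (L v)"
    if "x \<in> S" "s \<in> {0..1}" for x s v
    unfolding F[OF that] by (simp add: linear_simps[OF linD[OF that]] scaleR_add_right)
  have contD: "continuous_on (S \<times> {0..1}) (\<lambda>(x, s). ?D (at (?m x s)) v)" for v
    unfolding split_beta
    by (intro continuous_intros continuous_on_compose2[OF smooth_on_imp_continuous_on[OF smooth_on_derivative[OF Suc.prems(1)]]]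
        bounded_linear.continuous_on[OF AL(1)] bounded_linear.continuous_on[OF AL(2)]) (auto intro!: m)
  have cont: "continuous_on (S \<times> cbox 0 1) (\<lambda>(x, s). ?F x s)"
  proof (rule continuous_on_blinfun_componentwise)
    fix v :: 'a
    have "continuous_on (S \<times> {0..1}) (\<lambda>(x, s). p s *\<^sub>R ?D (at (?m x s)) (A v) + (p s * s) *\<^sub>R ?D (at (?m x s)) (L v))"
      using contD[of "A v"] contD[of "L v"] unfolding split_beta
      by (intro continuous_intros continuous_on_compose2[OF Suc.prems(2)]) auto
    also have "?this \<longleftrightarrow> continuous_on (S \<times> cbox 0 1) (\<lambda>x. blinfun_apply (case x of (x, s) \<Rightarrow> ?F x s) v)"
      by (intro continuous_on_cong) (auto simp: F2)
    finally show "continuous_on (S \<times> cbox 0 1) (\<lambda>x. blinfun_apply (case x of (x, s) \<Rightarrow> ?F x s) v)" .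
  qed
  have int1: "(\<lambda>s. p s *\<^sub>R f (?m x s)) integrable_on cbox 0 1" if "x \<in> S" for x
    by (intro integrable_continuous continuous_intros continuous_on_compose2[OF Suc.prems(2)]
        continuous_on_compose2[OF smooth_on_imp_continuous_on[OF Suc.prems(1)]]) (auto intro!: m that)
  have D: "((\<lambda>x. integral (cbox 0 1) (\<lambda>s. p s *\<^sub>R f (?m x s))) has_derivative blinfun_apply (integral (cbox 0 1) (?F x))) (at x)"
    if "x \<in> S" for x
  proof -
    have "((\<lambda>x. p s *\<^sub>R f (?m x s)) has_derivative blinfun_apply (?F y s)) (at y within S)"
      if "y \<in> S" "s \<in> cbox 0 1" for y s
    proof -
      have s: "s \<in> {0..1}" using that by simp
      have "((\<lambda>x. ?m x s) has_derivative (\<lambda>v. A v + s *\<^sub>R L v)) (at y)"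
        by (intro bounded_linear_imp_has_derivative bounded_linear_add AL
            bounded_linear_compose[OF bounded_linear_scaleR_right])
      from has_derivative_compose[OF this smooth_on_has_derivative[OF Suc.prems(1) m[OF that(1) s]]]
      have "((\<lambda>x. p s *\<^sub>R f (?m x s)) has_derivative (\<lambda>v. p s *\<^sub>R ?D (at (?m y s)) (A v + s *\<^sub>R L v))) (at y)"
        by (intro has_derivative_scaleR_right)
      then show ?thesis
        unfolding F[OF that(1) s, THEN ext[of "blinfun_apply (?F y s)"]] by (rule has_derivative_at_withinI)
    qed
    from leibniz_rule[OF this int1 cont that S(2)] show ?thesis
      using at_within_open[OF that S(1)] by simp
  qed
  have val: "blinfun_apply (integral (cbox 0 1) (?F x)) v =
     integral {0..1} (\<lambda>s. p s *\<^sub>R ?D (at (?m x s)) (A v)) + integral {0..1} (\<lambda>s. (p s * s) *\<^sub>R ?D (at (?m x s)) (L v))"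
    if "x \<in> S" for x v
  proof -
    have cF: "continuous_on (cbox 0 1) (?F x)"
      using continuous_on_compose2[OF cont continuous_on_Pair[OF continuous_on_const[of _ x] continuous_on_id[of "cbox 0 1"]]] that
      by (auto simp: image_subset_iff)
    have cD: "continuous_on {0..1} (\<lambda>s. ?D (at (?m x s)) u)" for u
      using continuous_on_compose2[OF contD continuous_on_Pair[OF continuous_on_const[of _ x] continuous_on_id[of "{0..1}"]]] that
      by (auto simp: image_subset_iff)
    have "blinfun_apply (integral (cbox 0 1) (?F x)) v = integral (cbox 0 1) (\<lambda>s. blinfun_apply (?F x s) v)"
      by (rule blinfun_apply_integral[OF integrable_continuous[OF cF]])
    also have "\<dots> = integral {0..1} (\<lambda>s. p s *\<^sub>R ?D (at (?m x s)) (A v) + (p s * s) *\<^sub>R ?D (at (?m x s)) (L v))"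
      unfolding box_real by (intro integral_cong F2 that)
    also have "\<dots> = integral {0..1} (\<lambda>s. p s *\<^sub>R ?D (at (?m x s)) (A v)) + integral {0..1} (\<lambda>s. (p s * s) *\<^sub>R ?D (at (?m x s)) (L v))"
      by (intro integral_add integrable_continuous_real continuous_intros Suc.prems cD)
    finally show ?thesis .
  qed
  have IH: "Ck_on k S (\<lambda>x. integral {0..1} (\<lambda>s. p s *\<^sub>R ?D (at (?m x s)) (A v)) + integral {0..1} (\<lambda>s. (p s * s) *\<^sub>R ?D (at (?m x s)) (L v)))" for v
    by (intro Ck_on_add S Suc.IH smooth_on_derivative continuous_intros Suc.prems)
  have "Ck_on k S (\<lambda>x. blinfun_apply (integral (cbox 0 1) (?F x)) v)" for v
    using IH[of v] by (subst Ck_on_cong[OF S(1) val])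
  from Ck_on_SucI[OF S(1) D this] show ?case by simp
qed

text \<open>Hadamard's lemma: \<open>H\<close> is the mean of the \<open>i\<close>-th partial
  derivative over the segment from the projection of \<open>x\<close> to the hyperplane up to
  \<open>x\<close>. The centre lies on the hyperplane, so the projection stays in the ball.\<close>

lemma smooth_on_divide_coordinate:
  fixes F :: "real^'n \<Rightarrow> 'b::euclidean_space"
  assumes "p $ i = 0" "smooth_on (ball p e) F" "\<And>x. x \<in> ball p e \<Longrightarrow> x $ i = 0 \<Longrightarrow> F x = 0"
  obtains H where "smooth_on (ball p e) H" "\<And>x. x \<in> ball p e \<Longrightarrow> F x = x $ i *\<^sub>R H x"
proof -
  let ?A = "\<lambda>x::real^'n. x - x $ i *\<^sub>R axis i 1" and ?L = "\<lambda>x::real^'n. x $ i *\<^sub>R axis i (1::real)"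
  let ?D = "\<lambda>x. frechet_derivative F (at x) (axis i 1)"
  define H where "H x = integral {0..1::real} (\<lambda>s. 1 *\<^sub>R ?D (?A x + s *\<^sub>R ?L x))" for x
  have L: "bounded_linear ?L" by (intro bounded_linear_scaleR_const bounded_linear_vec_nth)
  have A: "bounded_linear ?A" by (intro bounded_linear_sub bounded_linear_ident L)
  have 0: "?A x \<in> ball p e" if "x \<in> ball p e" for x
  proof -
    have "norm (p - ?A x) \<le> norm (p - x)"
      by (intro norm_le_componentwise_cart) (auto simp: axis_def assms(1))
    then show ?thesis using that by (simp add: dist_norm)
  qed
  have m: "?A x + s *\<^sub>R ?L x \<in> ball p e" if "x \<in> ball p e" "s \<in> {0..1}" for x s
  proof -
    have "(1 - s) *\<^sub>R ?A x + s *\<^sub>R x \<in> ball p e"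
      using that by (intro convexD[OF convex_ball] 0) auto
    then show ?thesis by (simp add: algebra_simps)
  qed
  have "smooth_on (ball p e) H"
    unfolding smooth_on_def H_def
    by (intro allI Ck_on_integral_segment A L m smooth_on_derivative assms) auto
  moreover have "F x = x $ i *\<^sub>R H x" if x: "x \<in> ball p e" for x
  proof -
    have "((\<lambda>s. F (?A x + s *\<^sub>R ?L x)) has_vector_derivative x $ i *\<^sub>R ?D (?A x + s *\<^sub>R ?L x)) (at s within {0..1})"
      if "0 \<le> s" "s \<le> 1" for s
    proof -
      have s: "s \<in> {0..1}" using that by simp
      interpret linear "frechet_derivative F (at (?A x + s *\<^sub>R ?L x))"
        by (intro linear_frechet_derivative smooth_on_differentiable[OF assms(2)] m x s)
      from smooth_on_has_vector_derivative_line[OF assms(2) m[OF x s]] show ?thesis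
        unfolding scale by (rule has_vector_derivative_at_within)
    qed
    then have "((\<lambda>s. x $ i *\<^sub>R ?D (?A x + s *\<^sub>R ?L x)) has_integral (F (?A x + 1 *\<^sub>R ?L x) - F (?A x + 0 *\<^sub>R ?L x))) {0..1}"
      by (intro fundamental_theorem_of_calculus) auto
    moreover have "F (?A x + 0 *\<^sub>R ?L x) = 0"
      using 0[OF x] by (simp add: assms(3))
    ultimately have "((\<lambda>s. x $ i *\<^sub>R ?D (?A x + s *\<^sub>R ?L x)) has_integral F x) {0..1}"
      by simp
    from integral_unique[OF this, symmetric]
    have "F x = integral {0..1} (\<lambda>s. x $ i *\<^sub>R ?D (?A x + s *\<^sub>R ?L x))" .
    also have "\<dots> = x $ i *\<^sub>R integral {0..1} (\<lambda>s. ?D (?A x + s *\<^sub>R ?L x))"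
      by (rule integral_cmul)
    finally show ?thesis by (simp add: H_def)
  qed
  ultimately show ?thesis by (rule that)
qed

section \<open>Straightening a regular level set\<close>

text \<open>Bootstrapping: if \<open>f\<close> is of class C^k, then so is its derivative
  \<open>h (f y)\<close>, whence \<open>f\<close> is of class C^(k+1). It is meant for inverse maps,
  whose derivative is an expression in the map itself.\<close>

lemma smooth_on_if_derivative_factors:
  fixes f :: "'a::real_normed_vector \<Rightarrow> 'b::euclidean_space"
  assumes "open V" "open W" "f ` V \<subseteq> W" "\<And>y. y \<in> V \<Longrightarrow> (f has_derivative h (f y)) (at y)"
    and "\<And>w. smooth_on W (\<lambda>x. h x w)"
  shows "smooth_on V f"
  unfolding smooth_on_def
proof
  fix k show "Ck_on k V f"
  proof (induction k)
    case 0
    then show ?case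
      using assms(4) by (auto intro!: continuous_at_imp_continuous_on has_derivative_continuous)
  next
    case (Suc k)
    have "Ck_on k V (\<lambda>y. h (f y) w)" for w
      using assms(5)[of w] by (intro Ck_on_compose[OF assms(1,2) _ Suc.IH assms(3)]) (simp add: smooth_on_def)
    with assms(1,4) show ?case by (intro Ck_on_SucI[of V f "\<lambda>y. h (f y)"]) auto
  qed
qed

text \<open>The map replaces the \<open>i\<close>-th coordinate by \<open>\<tau>\<close>, so the
  zero set of \<open>\<tau>\<close> becomes a coordinate hyperplane. The explicit inverse
  \<open>J\<close> of its derivative, smooth where the partial derivative of \<open>\<tau>\<close>
  is nonzero, makes the inverse map smooth.\<close>

lemma straightening_map:
  fixes \<tau> :: "real^'n \<Rightarrow> real" and i :: 'n
  defines "\<Phi> \<equiv> \<lambda>x. x + (\<tau> x - x $ i) *\<^sub>R axis i 1"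
  assumes O: "open O'" "smooth_on O' \<tau>" "x0 \<in> O'" "frechet_derivative \<tau> (at x0) (axis i 1) \<noteq> 0"
  obtains U V \<Psi> where "open U" "U \<subseteq> O'" "x0 \<in> U" "open V" "homeomorphism U V \<Phi> \<Psi>"
    "smooth_on U \<Phi>" "smooth_on V \<Psi>"
proof -
  let ?a = "\<lambda>x. frechet_derivative \<tau> (at x)"
  let ?W = "{x \<in> O'. ?a x (axis i 1) \<noteq> 0}"
  define J where "J x w = w + ((w $ i - ?a x w) / ?a x (axis i 1)) *\<^sub>R axis i 1" for x and w :: "real^'n"
  have "continuous_on O' (\<lambda>x. ?a x (axis i 1))"
    by (intro smooth_on_imp_continuous_on smooth_on_derivative O)
  then have W: "open ?W"
    using continuous_open_preimage[OF _ O(1), of _ "- {0}"] by (auto simp: vimage_def Int_def open_Compl)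
  have lin: "bounded_linear (?a x)" if "x \<in> O'" for x
    by (intro has_derivative_bounded_linear[OF smooth_on_has_derivative[OF O(2) that]])
  let ?f = "\<lambda>x v. v + (?a x v - v $ i) *\<^sub>R axis i 1"
  have blin: "bounded_linear (?f x)" if "x \<in> O'" for x
    by (intro bounded_linear_add bounded_linear_ident bounded_linear_scaleR_const bounded_linear_sub
        bounded_linear_vec_nth lin that)
  have ap: "blinfun_apply (Blinfun (?f x)) = ?f x" if "x \<in> O'" for x
    by (rule bounded_linear_Blinfun_apply[OF blin[OF that]])
  have blinJ: "bounded_linear (J x)" if "x \<in> ?W" for x
    unfolding J_def divide_inverse using that
    by (intro bounded_linear_add bounded_linear_ident bounded_linear_scaleR_const bounded_linear_sub
        bounded_linear_vec_nth lin bounded_linear_mult_const) auto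
  have a_simps: "?a x (v + c *\<^sub>R w) = ?a x v + c * ?a x w" if "x \<in> O'" for x c v w
    using linear_simps[OF lin[OF that]] by simp
  have Jf: "J x (?f x v) = v" and fJ: "?f x (J x v) = v" if "x \<in> ?W" for x v
    using that by (auto simp: J_def a_simps vec_eq_iff axis_def divide_simps)
  have smf: "smooth_on O' (\<lambda>x. ?f x v)" for v
    by (intro smooth_intros O smooth_on_derivative)
  have d: "(\<Phi> has_derivative blinfun_apply (Blinfun (?f x))) (at x)" if "x \<in> O'" for x
    unfolding ap[OF that] \<Phi>_def
    by (auto intro!: derivative_eq_intros smooth_on_has_derivative[OF O(2) that] bounded_linear_imp_has_derivative[OF bounded_linear_vec_nth])
  have c: "continuous_on O' (\<lambda>x. Blinfun (?f x))"
  proof (rule continuous_on_blinfun_componentwise)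
    fix v :: "real^'n"
    show "continuous_on O' (\<lambda>x. blinfun_apply (Blinfun (?f x)) v)"
      using smooth_on_imp_continuous_on[OF smf[of v]] by (simp add: ap cong: continuous_on_cong)
  qed
  have inv: "Blinfun (J x0) o\<^sub>L Blinfun (?f x0) = id_blinfun"
    using O blinJ[of x0] ap[of x0] Jf[of x0] by (intro blinfun_eqI) (simp add: bounded_linear_Blinfun_apply)
  obtain U V \<Psi> \<Psi>' where UV: "open U" "U \<subseteq> O'" "x0 \<in> U" "open V" "\<Phi> x0 \<in> V" "homeomorphism U V \<Phi> \<Psi>"
    and \<Psi>: "\<And>y. y \<in> V \<Longrightarrow> (\<Psi> has_derivative (\<Psi>' y)) (at y)"
      "\<And>y. y \<in> V \<Longrightarrow> \<Psi>' y = inv (blinfun_apply (Blinfun (?f (\<Psi> y))))"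
      "\<And>y. y \<in> V \<Longrightarrow> bij (blinfun_apply (Blinfun (?f (\<Psi> y))))"
    using inverse_function_theorem[OF O(1) d c O(3) inv] by blast
  have inO: "\<Psi> y \<in> O'" if "y \<in> V" for y
    using UV that by (auto simp: homeomorphism_def)
  have inW: "\<Psi> y \<in> ?W" if "y \<in> V" for y
  proof -
    have "bij (?f (\<Psi> y))" using \<Psi>(3)[OF that] ap[OF inO[OF that]] by simp
    \<comment> \<open>If the partial derivative of \<open>\<tau>\<close> vanished, the derivative of
      \<open>\<Phi>\<close> would send the \<open>i\<close>-th axis vector to 0.\<close>
    then have "?f (\<Psi> y) (axis i 1) \<noteq> ?f (\<Psi> y) 0"
      by (metis (no_types, lifting) axis_eq_0_iff bij_is_inj injD zero_neq_one)
    moreover have "?f (\<Psi> y) 0 = 0"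
      using bounded_linear.linear[OF blin[OF inO[OF that]]] by (rule linear_0)
    ultimately have "?a (\<Psi> y) (axis i 1) \<noteq> 0" by auto
    then show ?thesis using inO[OF that] by simp
  qed
  have "\<Psi>' y = J (\<Psi> y)" if "y \<in> V" for y
  proof -
    have "inv (?f (\<Psi> y)) = J (\<Psi> y)"
      by (intro inv_unique_comp ext) (simp_all only: o_apply id_apply Jf[OF inW[OF that]] fJ[OF inW[OF that]])
    then show ?thesis using \<Psi>(2)[OF that] ap[OF inO[OF that]] by simp
  qed
  moreover have "smooth_on ?W (\<lambda>x. J x w)" for w
    unfolding J_def
    using W smooth_on_subset[OF O(2), of ?W] by (intro smooth_intros smooth_on_derivative) auto
  ultimately have "smooth_on V \<Psi>"
    using \<Psi>(1) inW by (intro smooth_on_if_derivative_factors[OF UV(4) W, of _ J]) auto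
  moreover have "smooth_on U \<Phi>"
    unfolding \<Phi>_def using smooth_on_subset[OF O(2) UV(2)] UV(1) by (intro smooth_intros)
  ultimately show ?thesis using UV that by blast
qed

section \<open>The coordinate expressions of metric, connection and curvature\<close>

definition met :: "(real^'n \<Rightarrow> real^'n^'n) \<Rightarrow> real^'n \<Rightarrow> real^'n \<Rightarrow> real^'n \<Rightarrow> real" where
  "met G x v w = v \<bullet> (G x *v w)"

definition dmet :: "(real^'n \<Rightarrow> real^'n^'n) \<Rightarrow> real^'n \<Rightarrow> real^'n \<Rightarrow> real^'n \<Rightarrow> real^'n \<Rightarrow> real" where
  "dmet G x u v w = v \<bullet> (frechet_derivative G (at x) u *v w)"

definition ddmet :: "(real^'n \<Rightarrow> real^'n^'n) \<Rightarrow> real^'n \<Rightarrow> real^'n \<Rightarrow> real^'n \<Rightarrow> real^'n \<Rightarrow> real^'n \<Rightarrow> real" where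
  "ddmet G x s u v w = v \<bullet> (frechet_derivative (\<lambda>y. frechet_derivative G (at y) u) (at x) s *v w)"

text \<open>\<open>Gam\<close> is the Christoffel symbol of the first kind and \<open>Hess\<close> the part of the curvature that is
  linear in the second derivatives of the metric.\<close>

definition Gam :: "(real^'n \<Rightarrow> real^'n^'n) \<Rightarrow> real^'n \<Rightarrow> real^'n \<Rightarrow> real^'n \<Rightarrow> real^'n \<Rightarrow> real" where
  "Gam G x u v w = (dmet G x u v w + dmet G x v u w - dmet G x w u v) / 2"

definition dGam :: "(real^'n \<Rightarrow> real^'n^'n) \<Rightarrow> real^'n \<Rightarrow> real^'n \<Rightarrow> real^'n \<Rightarrow> real^'n \<Rightarrow> real^'n \<Rightarrow> real" where
  "dGam G x s u v w = (ddmet G x s u v w + ddmet G x s v u w - ddmet G x s w u v) / 2"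

definition Hess :: "(real^'n \<Rightarrow> real^'n^'n) \<Rightarrow> real^'n \<Rightarrow> real^'n \<Rightarrow> real^'n \<Rightarrow> real^'n \<Rightarrow> real^'n \<Rightarrow> real" where
  "Hess G x a b c d = (ddmet G x a c b d - ddmet G x a d b c - ddmet G x b c a d + ddmet G x b d a c) / 2"

definition gamma :: "(real^'n \<Rightarrow> real^'n^'n) \<Rightarrow> real^'n \<Rightarrow> real^'n \<Rightarrow> real^'n \<Rightarrow> real^'n" where
  "gamma G x u v = (\<chi> k. Gam G x u v (axis k 1))"

text \<open>Cramer's numerators, that is, the adjugate of \<open>A\<close> applied to
  \<open>y\<close>. They remain meaningful for singular \<open>A\<close>.\<close>

definition adj_vec :: "real^'n^'n \<Rightarrow> real^'n \<Rightarrow> real^'n" where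
  "adj_vec A y = (\<chi> k. det (\<chi> a b. if b = k then y $ a else A $ a $ b))"

text \<open>The Christoffel vector of the second kind. On the hypersurface the division by 0 returns
  the meaningless value 0, so statements there use \<open>met\<close> and \<open>Gam\<close>
  instead.\<close>

definition conn :: "(real^'n \<Rightarrow> real^'n^'n) \<Rightarrow> real^'n \<Rightarrow> real^'n \<Rightarrow> real^'n \<Rightarrow> real^'n" where
  "conn G x u v = (1 / det (G x)) *\<^sub>R adj_vec (G x) (gamma G x u v)"

definition nab :: "(real^'n \<Rightarrow> real^'n^'n) \<Rightarrow> (real^'n \<Rightarrow> real^'n) \<Rightarrow> (real^'n \<Rightarrow> real^'n) \<Rightarrow> real^'n \<Rightarrow> real^'n" where
  "nab G X Y x = frechet_derivative Y (at x) (X x) + conn G x (X x) (Y x)"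

definition brac :: "(real^'n \<Rightarrow> real^'n) \<Rightarrow> (real^'n \<Rightarrow> real^'n) \<Rightarrow> real^'n \<Rightarrow> real^'n" where
  "brac X Y x = frechet_derivative Y (at x) (X x) - frechet_derivative X (at x) (Y x)"

text \<open>The products of Christoffel symbols are metric pairings of two connection vectors; one
  of the two is absorbed into \<open>Gam\<close>, so that only a single factor
  \<open>1 / det\<close> remains.\<close>

definition Rm :: "(real^'n \<Rightarrow> real^'n^'n) \<Rightarrow> real^'n \<Rightarrow> real^'n \<Rightarrow> real^'n \<Rightarrow> real^'n \<Rightarrow> real^'n \<Rightarrow> real" where
  "Rm G x a b c d = Hess G x a b c d + Gam G x b d (conn G x a c) - Gam G x a d (conn G x b c)"

lemma adj_vec:
  fixes A :: "real^'n^'n"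
  assumes "det A \<noteq> 0"
  shows "A *v adj_vec A y = det A *\<^sub>R y"
proof -
  have "A *v (\<chi> k. det (\<chi> a b. if b = k then y $ a else A $ a $ b) / det A) = y"
    using cramer[OF assms] by blast
  also have "(\<chi> k. det (\<chi> a b. if b = k then y $ a else A $ a $ b) / det A) = (1 / det A) *\<^sub>R adj_vec A y"
    by (simp add: adj_vec_def vec_eq_iff)
  finally have "(1 / det A) *\<^sub>R (A *v adj_vec A y) = y"
    by (simp add: matrix_vector_mult_scaleR)
  then have "det A *\<^sub>R ((1 / det A) *\<^sub>R (A *v adj_vec A y)) = det A *\<^sub>R y" by simp
  then show ?thesis using assms by simp
qed

lemma met_linear:
  "met G x (a + b) c = met G x a c + met G x b c"
  "met G x c (a + b) = met G x c a + met G x c b"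
  "met G x (a - b) c = met G x a c - met G x b c"
  "met G x c (a - b) = met G x c a - met G x c b"
  "met G x (t *\<^sub>R a) c = t * met G x a c"
  "met G x c (t *\<^sub>R a) = t * met G x c a"
  "met G x 0 c = 0" "met G x c 0 = 0"
  "met G x (- a) c = - met G x a c" "met G x c (- a) = - met G x c a"
  by (simp_all add: met_def algebra_simps inner_diff_left inner_diff_right inner_add_left inner_add_right
      matrix_vector_mult_scaleR linear_neg[OF matrix_vector_mul_linear])

lemma dmet_linear:
  "dmet G x u (a + b) c = dmet G x u a c + dmet G x u b c"
  "dmet G x u c (a + b) = dmet G x u c a + dmet G x u c b"
  "dmet G x u (a - b) c = dmet G x u a c - dmet G x u b c"
  "dmet G x u c (a - b) = dmet G x u c a - dmet G x u c b"
  "dmet G x u (t *\<^sub>R a) c = t * dmet G x u a c"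
  "dmet G x u c (t *\<^sub>R a) = t * dmet G x u c a"
  "dmet G x u 0 c = 0" "dmet G x u c 0 = 0"
  "dmet G x u (- a) c = - dmet G x u a c" "dmet G x u c (- a) = - dmet G x u c a"
  by (simp_all add: dmet_def algebra_simps inner_diff_left inner_diff_right inner_add_left inner_add_right
      matrix_vector_mult_scaleR linear_neg[OF matrix_vector_mul_linear])

lemma smooth_on_brac:
  "open V \<Longrightarrow> smooth_on V X \<Longrightarrow> smooth_on V Y \<Longrightarrow> smooth_on V (brac X Y)"
  unfolding brac_def[abs_def] by (intro smooth_intros)

lemma smooth_on_if:
  "(b \<Longrightarrow> smooth_on V X) \<Longrightarrow> (\<not> b \<Longrightarrow> smooth_on V Y) \<Longrightarrow> smooth_on V (\<lambda>x. if b then X x else Y x)"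
  by (cases b) simp_all

locale local_metric =
  fixes S :: "(real^'n) set" and G :: "real^'n \<Rightarrow> real^'n^'n"
  assumes S: "open S" and G: "smooth_on S G"
    and sym: "\<And>x a b. x \<in> S \<Longrightarrow> G x $ a $ b = G x $ b $ a"
begin

lemma met_commute: "x \<in> S \<Longrightarrow> met G x v w = met G x w v"
proof -
  assume "x \<in> S"
  then have "transpose (G x) = G x" by (simp add: transpose_def vec_eq_iff sym)
  then show ?thesis unfolding met_def by (metis dot_lmul_matrix inner_commute transpose_matrix_vector)
qed

lemma dG_linear: "x \<in> S \<Longrightarrow> linear (frechet_derivative G (at x))"
  by (intro linear_frechet_derivative smooth_on_differentiable[OF G])

lemma dmet_linear1:
  assumes "x \<in> S"
  shows "dmet G x (a + b) v w = dmet G x a v w + dmet G x b v w"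
    "dmet G x (a - b) v w = dmet G x a v w - dmet G x b v w"
    "dmet G x (t *\<^sub>R a) v w = t * dmet G x a v w"
    "dmet G x 0 v w = 0"
    "dmet G x (- a) v w = - dmet G x a v w"
proof -
  interpret linear "frechet_derivative G (at x)" by (rule dG_linear[OF assms])
  have neg_mult: "- A *v y = - (A *v y)" for A :: "real^'n^'n" and y
    using matrix_vector_mult_diff_rdistrib[of 0 A y] by simp
  show "dmet G x (a + b) v w = dmet G x a v w + dmet G x b v w"
    "dmet G x (a - b) v w = dmet G x a v w - dmet G x b v w"
    "dmet G x (t *\<^sub>R a) v w = t * dmet G x a v w"
    "dmet G x 0 v w = 0"
    "dmet G x (- a) v w = - dmet G x a v w"
    by (simp_all add: dmet_def add diff scale zero neg algebra_simps inner_diff_left inner_diff_right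
        inner_add_left inner_add_right scaleR_matrix_vector_assoc[symmetric] neg_mult)
qed

lemma Gam_linear:
  assumes "x \<in> S"
  shows "Gam G x (a + b) v w = Gam G x a v w + Gam G x b v w"
    "Gam G x (a - b) v w = Gam G x a v w - Gam G x b v w"
    "Gam G x (t *\<^sub>R a) v w = t * Gam G x a v w"
    "Gam G x 0 v w = 0"
    "Gam G x (- a) v w = - Gam G x a v w"
    "Gam G x v (a + b) w = Gam G x v a w + Gam G x v b w"
    "Gam G x v (a - b) w = Gam G x v a w - Gam G x v b w"
    "Gam G x v (t *\<^sub>R a) w = t * Gam G x v a w"
    "Gam G x v 0 w = 0"
    "Gam G x v (- a) w = - Gam G x v a w"
    "Gam G x v w (a + b) = Gam G x v w a + Gam G x v w b"
    "Gam G x v w (a - b) = Gam G x v w a - Gam G x v w b"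
    "Gam G x v w (t *\<^sub>R a) = t * Gam G x v w a"
    "Gam G x v w 0 = 0"
    "Gam G x v w (- a) = - Gam G x v w a"
  using assms by (simp_all add: Gam_def dmet_linear dmet_linear1 field_simps)

lemma smooth_on_met:
  assumes "V \<subseteq> S" "open V" "smooth_on V X" "smooth_on V Y"
  shows "smooth_on V (\<lambda>x. met G x (X x) (Y x))"
  unfolding met_def using assms smooth_on_subset[OF G assms(1)] by (intro smooth_intros)

lemma smooth_on_dmet:
  assumes "V \<subseteq> S" "open V" "smooth_on V X" "smooth_on V Y" "smooth_on V Z"
  shows "smooth_on V (\<lambda>x. dmet G x (X x) (Y x) (Z x))"
  unfolding dmet_def using assms smooth_on_subset[OF G assms(1)] by (intro smooth_intros)

lemma smooth_on_Gam:
  assumes "V \<subseteq> S" "open V" "smooth_on V X" "smooth_on V Y" "smooth_on V Z"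
  shows "smooth_on V (\<lambda>x. Gam G x (X x) (Y x) (Z x))"
  unfolding Gam_def using assms by (intro smooth_intros smooth_on_dmet) auto

lemma smooth_on_gamma:
  assumes "V \<subseteq> S" "open V" "smooth_on V X" "smooth_on V Y"
  shows "smooth_on V (\<lambda>x. gamma G x (X x) (Y x))"
  unfolding gamma_def using assms by (intro smooth_intros smooth_on_Gam)

lemma smooth_on_adj_vec:
  assumes "V \<subseteq> S" "open V" "smooth_on V Y"
  shows "smooth_on V (\<lambda>x. adj_vec (G x) (Y x))"
  unfolding adj_vec_def using assms(2,3) smooth_on_subset[OF G assms(1)]
  by (intro smooth_on_if smooth_intros) auto

lemma smooth_on_det_G: "V \<subseteq> S \<Longrightarrow> open V \<Longrightarrow> smooth_on V (\<lambda>x. det (G x))"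
  using smooth_on_subset[OF G] by (intro smooth_intros)

lemma smooth_on_conn:
  assumes "V \<subseteq> S" "open V" "smooth_on V X" "smooth_on V Y" "\<And>x. x \<in> V \<Longrightarrow> det (G x) \<noteq> 0"
  shows "smooth_on V (\<lambda>x. conn G x (X x) (Y x))"
  unfolding conn_def using assms by (intro smooth_intros smooth_on_adj_vec smooth_on_gamma smooth_on_det_G)

lemma smooth_on_nab:
  assumes "V \<subseteq> S" "open V" "smooth_on V X" "smooth_on V Y" "\<And>x. x \<in> V \<Longrightarrow> det (G x) \<noteq> 0"
  shows "smooth_on V (nab G X Y)"
  unfolding nab_def[abs_def] using assms by (intro smooth_intros smooth_on_conn)

text \<open>\<open>ddmet\<close> freezes the inner direction before differentiating again; the basis
  expansion reduces a moving direction to fixed ones.\<close>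

lemma smooth_on_ddmet:
  assumes "V \<subseteq> S" "open V" "smooth_on V W" "smooth_on V X" "smooth_on V Y" "smooth_on V Z"
  shows "smooth_on V (\<lambda>x. ddmet G x (W x) (X x) (Y x) (Z x))"
proof -
  let ?f = "\<lambda>b y. frechet_derivative G (at y) b"
  have sG: "smooth_on V (?f b)" for b
    by (intro smooth_on_derivative smooth_on_subset[OF G assms(1)])
  have "smooth_on V (\<lambda>x. \<Sum>b\<in>Basis. (X x \<bullet> b) * (Y x \<bullet> (frechet_derivative (?f b) (at x) (W x) *v Z x)))"
    using assms sG smooth_on_subset[OF G assms(1)] by (intro smooth_intros) auto
  also have "?this \<longleftrightarrow> ?thesis"
  proof (intro smooth_on_cong assms)
    fix x assume "x \<in> V"
    then have x: "x \<in> S" using assms by auto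
    have eq: "?f b y = (\<Sum>c\<in>Basis. (b \<bullet> c) *\<^sub>R ?f c y)" if "y \<in> S" for y b
      by (intro derivative_eq_sum_Basis smooth_on_differentiable[OF G that])
    have D: "((\<lambda>y. \<Sum>c\<in>Basis. (X x \<bullet> c) *\<^sub>R ?f c y) has_derivative
        (\<lambda>u. \<Sum>c\<in>Basis. (X x \<bullet> c) *\<^sub>R frechet_derivative (?f c) (at x) u)) (at x)"
      by (intro has_derivative_sum has_derivative_scaleR_right smooth_on_has_derivative[OF smooth_on_derivative[OF G] x])
    have "(?f (X x) has_derivative (\<lambda>u. \<Sum>c\<in>Basis. (X x \<bullet> c) *\<^sub>R frechet_derivative (?f c) (at x) u)) (at x)"
      by (rule has_derivative_transform_within_open[OF D S x]) (rule eq[symmetric])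
    note d = frechet_derivative_at[OF this, symmetric]
    have m: "(\<Sum>c\<in>B. A c) *v w = (\<Sum>c\<in>B. A c *v w)" for A :: "real^'n \<Rightarrow> real^'n^'n" and B w
      by (induction B rule: infinite_finite_induct) (auto simp: matrix_vector_mult_add_rdistrib)
    show "(\<Sum>b\<in>Basis. (X x \<bullet> b) * (Y x \<bullet> (frechet_derivative (?f b) (at x) (W x) *v Z x))) = ddmet G x (W x) (X x) (Y x) (Z x)"
      unfolding ddmet_def d by (simp add: m inner_sum_right scaleR_matrix_vector_assoc[symmetric])
  qed
  finally show ?thesis .
qed

lemma smooth_on_Hess:
  assumes "V \<subseteq> S" "open V" "smooth_on V W" "smooth_on V X" "smooth_on V Y" "smooth_on V Z"
  shows "smooth_on V (\<lambda>x. Hess G x (W x) (X x) (Y x) (Z x))"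
  unfolding Hess_def using assms by (intro smooth_intros smooth_on_ddmet) auto

lemma met_has_derivative:
  assumes "x \<in> S" "(a has_derivative a') (at x)" "(b has_derivative b') (at x)"
  shows "((\<lambda>y. met G y (a y) (b y)) has_derivative
     (\<lambda>h. dmet G x h (a x) (b x) + met G x (a' h) (b x) + met G x (a x) (b' h))) (at x)"
  unfolding met_def dmet_def
  by (rule has_derivative_eq_rhs[OF has_derivative_inner[OF assms(2)
        bounded_bilinear.FDERIV[OF bounded_bilinear_matrix_vector_mult smooth_on_has_derivative[OF G assms(1)] assms(3)]]])
     (simp add: fun_eq_iff inner_add_right)

lemma dmet_has_derivative:
  assumes "x \<in> S" "(c has_derivative c') (at x)" "(a has_derivative a') (at x)" "(b has_derivative b') (at x)"
  shows "((\<lambda>y. dmet G y (c y) (a y) (b y)) has_derivative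
     (\<lambda>h. ddmet G x h (c x) (a x) (b x) + dmet G x (c' h) (a x) (b x) + dmet G x (c x) (a' h) (b x) + dmet G x (c x) (a x) (b' h))) (at x)"
  unfolding dmet_def ddmet_def
  by (rule has_derivative_eq_rhs[OF has_derivative_inner[OF assms(3)
        bounded_bilinear.FDERIV[OF bounded_bilinear_matrix_vector_mult has_derivative_derivative_along[OF S G assms(1,2)] assms(4)]]])
     (simp add: fun_eq_iff inner_add_right matrix_vector_mult_add_rdistrib)

lemma Gam_has_derivative:
  assumes "x \<in> S" "(a has_derivative a') (at x)" "(b has_derivative b') (at x)" "(c has_derivative c') (at x)"
  shows "((\<lambda>y. Gam G y (a y) (b y) (c y)) has_derivative
     (\<lambda>h. dGam G x h (a x) (b x) (c x) + Gam G x (a' h) (b x) (c x) + Gam G x (a x) (b' h) (c x) + Gam G x (a x) (b x) (c' h))) (at x)"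
proof -
  have "((\<lambda>y. (1 / 2) *\<^sub>R (dmet G y (a y) (b y) (c y) + dmet G y (b y) (a y) (c y) - dmet G y (c y) (a y) (b y))) has_derivative
    (\<lambda>h. dGam G x h (a x) (b x) (c x) + Gam G x (a' h) (b x) (c x) + Gam G x (a x) (b' h) (c x) + Gam G x (a x) (b x) (c' h))) (at x)"
    by (rule has_derivative_eq_rhs[OF has_derivative_scaleR_right[OF has_derivative_diff[OF has_derivative_add]]],
        (rule dmet_has_derivative; rule assms)+) (auto simp: fun_eq_iff Gam_def dGam_def add_divide_distrib diff_divide_distrib)
  then show ?thesis
    by (simp add: Gam_def[abs_def])
qed

lemma dmet_commute: "x \<in> S \<Longrightarrow> dmet G x u v w = dmet G x u w v"
proof -
  assume x: "x \<in> S"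
  have D: "((\<lambda>y. met G y v w) has_derivative (\<lambda>h. dmet G x h v w)) (at x)" for v w
    using met_has_derivative[OF x has_derivative_const[of v] has_derivative_const[of w]] by (simp add: met_linear)
  have "((\<lambda>y. met G y v w) has_derivative (\<lambda>h. dmet G x h w v)) (at x)"
    by (rule has_derivative_transform_within_open[OF D S x]) (simp add: met_commute)
  from has_derivative_unique[OF this D] show ?thesis by metis
qed

lemma ddmet_commute: "x \<in> S \<Longrightarrow> ddmet G x s u v w = ddmet G x s u w v"
proof -
  assume x: "x \<in> S"
  have D: "((\<lambda>y. dmet G y u v w) has_derivative (\<lambda>h. ddmet G x h u v w)) (at x)" for v w
    using dmet_has_derivative[OF x has_derivative_const[of u] has_derivative_const[of v] has_derivative_const[of w]]
    by (simp add: dmet_linear dmet_linear1 x)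
  have "((\<lambda>y. dmet G y u v w) has_derivative (\<lambda>h. ddmet G x h u w v)) (at x)"
    by (rule has_derivative_transform_within_open[OF D S x]) (simp add: dmet_commute)
  from has_derivative_unique[OF this D] show ?thesis by metis
qed

lemma ddmet_symmetric: "x \<in> S \<Longrightarrow> ddmet G x s u v w = ddmet G x u s v w"
  by (simp add: ddmet_def second_derivative_symmetric[OF S G])

lemma Gam_commute: "x \<in> S \<Longrightarrow> Gam G x u v w = Gam G x v u w"
  by (simp add: Gam_def dmet_commute)

lemma dmet_eq_Gam: "x \<in> S \<Longrightarrow> dmet G x u v w = Gam G x u v w + Gam G x u w v"
  using dmet_commute[of x u v w] dmet_commute[of x v u w] dmet_commute[of x w u v] by (simp add: Gam_def field_simps)

lemma Hess_eq_dGam: "x \<in> S \<Longrightarrow> Hess G x a b c d = dGam G x a b c d - dGam G x b a c d"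
  using ddmet_symmetric[of x a b c d] ddmet_commute[of x a d b c] ddmet_commute[of x b d a c]
    ddmet_commute[of x a b c d] by (simp add: Hess_def dGam_def field_simps)

lemma gamma_inner: "x \<in> S \<Longrightarrow> gamma G x u v \<bullet> w = Gam G x u v w"
proof -
  assume x: "x \<in> S"
  have lin: "linear (Gam G x u v)"
    by (intro linearI) (simp_all add: Gam_linear x)
  have "Gam G x u v w = Gam G x u v (\<Sum>k\<in>UNIV. w $ k *\<^sub>R axis k 1)"
    using basis_expansion[of w] by (simp add: scalar_mult_eq_scaleR)
  also have "\<dots> = (\<Sum>k\<in>UNIV. w $ k * Gam G x u v (axis k 1))"
    by (simp add: linear_sum[OF lin] linear_scale[OF lin])
  finally show ?thesis by (simp add: gamma_def inner_vec_def mult.commute)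
qed

lemma met_conn: "x \<in> S \<Longrightarrow> det (G x) \<noteq> 0 \<Longrightarrow> met G x (conn G x u v) w = Gam G x u v w"
  using met_commute[of x "conn G x u v" w] unfolding conn_def met_def
  by (simp add: matrix_vector_mult_scaleR adj_vec gamma_inner[symmetric] inner_commute)

lemma met_nab:
  "x \<in> S \<Longrightarrow> det (G x) \<noteq> 0 \<Longrightarrow>
   met G x (nab G X Y x) w = met G x (frechet_derivative Y (at x) (X x)) w + Gam G x (X x) (Y x) w"
  by (simp add: nab_def met_linear met_conn)

text \<open>The identity \<open>met_nab\<close> for \<open>Y\<close> and \<open>Z\<close> is
  differentiated along \<open>X\<close> against a constant \<open>w\<close>, and
  \<open>dmet_eq_Gam\<close> converts derivatives of the metric into connection terms. The
  derivative of \<open>conn\<close>, hence of the inverse metric, is never computed.\<close>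

lemma met_nab_nab:
  assumes V: "V \<subseteq> S" "open V" "\<And>x. x \<in> V \<Longrightarrow> det (G x) \<noteq> 0"
    and XYZ: "smooth_on V X" "smooth_on V Y" "smooth_on V Z" and x: "x \<in> V"
  shows "met G x (nab G X (nab G Y Z) x) w =
    met G x (frechet_derivative (\<lambda>y. frechet_derivative Z (at y) (Y x)) (at x) (X x)
       + frechet_derivative Z (at x) (frechet_derivative Y (at x) (X x))) w
    + dGam G x (X x) (Y x) (Z x) w + Gam G x (frechet_derivative Y (at x) (X x)) (Z x) w
    + Gam G x (Y x) (frechet_derivative Z (at x) (X x)) w + Gam G x (X x) (frechet_derivative Z (at x) (Y x)) w
    - Gam G x (X x) w (conn G x (Y x) (Z x))"
proof -
  let ?W = "nab G Y Z" and ?DZ = "frechet_derivative Z" and ?DY = "frechet_derivative Y"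
  have xS: "x \<in> S" using x V by auto
  have sW: "smooth_on V ?W" by (intro smooth_on_nab V XYZ)
  have "((\<lambda>y. met G y (?W y) w) has_derivative
      (\<lambda>h. dmet G x h (?W x) w + met G x (frechet_derivative ?W (at x) h) w)) (at x)"
    using met_has_derivative[OF xS smooth_on_has_derivative[OF sW x] has_derivative_const[of w]] by (simp add: met_linear)
  then have 1: "((\<lambda>y. met G y (?DZ (at y) (Y y)) w + Gam G y (Y y) (Z y) w) has_derivative
      (\<lambda>h. dmet G x h (?W x) w + met G x (frechet_derivative ?W (at x) h) w)) (at x)"
    by (rule has_derivative_transform_within_open[OF _ V(2) x]) (use V in \<open>auto simp: met_nab\<close>)
  have 2: "((\<lambda>y. met G y (?DZ (at y) (Y y)) w + Gam G y (Y y) (Z y) w) has_derivative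
      (\<lambda>h. (dmet G x h (?DZ (at x) (Y x)) w
          + met G x (frechet_derivative (\<lambda>y. ?DZ (at y) (Y x)) (at x) h + ?DZ (at x) (?DY (at x) h)) w + met G x (?DZ (at x) (Y x)) 0)
        + (dGam G x h (Y x) (Z x) w + Gam G x (?DY (at x) h) (Z x) w + Gam G x (Y x) (?DZ (at x) h) w + Gam G x (Y x) (Z x) 0))) (at x)"
    by (intro has_derivative_add met_has_derivative Gam_has_derivative has_derivative_const xS
        has_derivative_derivative_along[OF V(2) XYZ(3) x] smooth_on_has_derivative[OF XYZ(2) x] smooth_on_has_derivative[OF XYZ(3) x])
  have "dmet G x (X x) (?W x) w + met G x (frechet_derivative ?W (at x) (X x)) w =
      dmet G x (X x) (?DZ (at x) (Y x)) w
      + met G x (frechet_derivative (\<lambda>y. ?DZ (at y) (Y x)) (at x) (X x) + ?DZ (at x) (?DY (at x) (X x))) w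
      + dGam G x (X x) (Y x) (Z x) w + Gam G x (?DY (at x) (X x)) (Z x) w + Gam G x (Y x) (?DZ (at x) (X x)) w"
    using has_derivative_unique[OF 1 2, THEN fun_cong, of "X x"] by (simp add: met_linear Gam_linear xS)
  moreover have "met G x (nab G X ?W x) w = met G x (frechet_derivative ?W (at x) (X x)) w + Gam G x (X x) (?W x) w"
    using V x by (intro met_nab) auto
  moreover have "?W x = ?DZ (at x) (Y x) + conn G x (Y x) (Z x)" by (simp add: nab_def)
  ultimately show ?thesis
    using dmet_eq_Gam[OF xS, of "X x" "?DZ (at x) (Y x)" w] dmet_eq_Gam[OF xS, of "X x" "?W x" w]
    by (simp add: Gam_linear xS)
qed

text \<open>Antisymmetrising \<open>met_nab_nab\<close> cancels the second derivatives of
  \<open>Z\<close>, and the first derivatives of the fields cancel against the bracket term. What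
  remains depends on pointwise values only: the curvature is a tensor.\<close>

theorem met_curvature:
  assumes V: "V \<subseteq> S" "open V" "\<And>x. x \<in> V \<Longrightarrow> det (G x) \<noteq> 0"
    and XYZ: "smooth_on V X" "smooth_on V Y" "smooth_on V Z" and x: "x \<in> V"
  shows "met G x (nab G X (nab G Y Z) x - nab G Y (nab G X Z) x - nab G (brac X Y) Z x) w
     = Rm G x (X x) (Y x) (Z x) w"
proof -
  have xS: "x \<in> S" using x V by auto
  interpret Z: linear "frechet_derivative Z (at x)"
    by (intro linear_frechet_derivative smooth_on_differentiable[OF XYZ(3) x])
  have c: "met G x (nab G (brac X Y) Z x) w =
      met G x (frechet_derivative Z (at x) (brac X Y x)) w + Gam G x (brac X Y x) (Z x) w"
    using V x by (intro met_nab) auto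
  show ?thesis
    using met_nab_nab[OF V XYZ x, of w] met_nab_nab[OF V XYZ(2,1,3) x, of w] second_derivative_symmetric[OF V(2) XYZ(3) x, of "Y x" "X x"]
    unfolding met_linear c Rm_def Hess_eq_dGam[OF xS] brac_def
    by (simp add: Z.diff met_linear Gam_linear xS)
qed

end

section \<open>The metric near the hypersurface, in coordinates flattening it\<close>

text \<open>The line through \<open>x\<close> in direction \<open>t\<close> stays in the hyperplane,
  so along it \<open>f\<close> is constantly 0 near \<open>x\<close>.\<close>

lemma derivative_tangent_eq_0:
  fixes f :: "real^'n \<Rightarrow> 'b::real_normed_vector"
  assumes "open V" "x \<in> V" "x $ i = 0" "t $ i = 0" "(f has_derivative f') (at x)"
    and "\<And>y. y \<in> V \<Longrightarrow> y $ i = 0 \<Longrightarrow> f y = 0"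
  shows "f' t = 0"
proof -
  have l: "((\<lambda>s::real. x + s *\<^sub>R t) has_derivative (\<lambda>s. s *\<^sub>R t)) (at 0)"
    by (auto intro!: derivative_eq_intros)
  have "((\<lambda>s. f (x + s *\<^sub>R t)) has_derivative (\<lambda>s. f' (s *\<^sub>R t))) (at 0)"
    using has_derivative_compose[OF l, of f f'] assms(5) by simp
  moreover have "((\<lambda>s. f (x + s *\<^sub>R t)) has_derivative (\<lambda>s. 0)) (at 0)"
  proof (rule has_derivative_transform_within_open[OF has_derivative_const[of 0]])
    show "open ((\<lambda>s. x + s *\<^sub>R t) -` V)"
      by (intro continuous_open_vimage assms continuous_intros)
  qed (use assms in auto)
  ultimately show ?thesis
    using has_derivative_unique by (metis scaleR_one)
qed

text \<open>The complement of the hyperplane is dense: \<open>x\<close> is approached along the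
  \<open>i\<close>-th axis. This carries identities valid for an invertible metric over to the
  hypersurface.\<close>

lemma eq_on_hyperplane:
  fixes f h :: "real^'n \<Rightarrow> 'b::t2_space"
  assumes "open V" "x \<in> V" "continuous_on V f" "continuous_on V h"
    and "\<And>y. y \<in> V \<Longrightarrow> y $ i \<noteq> 0 \<Longrightarrow> f y = h y"
  shows "f x = h x"
proof (cases "x $ i = 0")
  case True
  let ?l = "\<lambda>t::real. x + t *\<^sub>R axis i 1"
  have "(?l \<longlongrightarrow> ?l 0) (at 0)" by (intro tendsto_intros)
  then have l: "(?l \<longlongrightarrow> x) (at 0)" by simp
  have "isCont f x" "isCont h x"
    using assms by (auto simp: continuous_on_eq_continuous_at)
  then have f: "((\<lambda>t. f (?l t)) \<longlongrightarrow> f x) (at 0)" and h: "((\<lambda>t. h (?l t)) \<longlongrightarrow> h x) (at 0)"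
    using l by (auto intro: isCont_tendsto_compose)
  have "eventually (\<lambda>t. ?l t \<in> V) (at 0)"
    using topological_tendstoD[OF l assms(1,2)] .
  moreover have "eventually (\<lambda>t::real. t \<noteq> 0) (at 0)" by (simp add: eventually_at_filter)
  ultimately have "eventually (\<lambda>t. f (?l t) = h (?l t)) (at 0)"
    by eventually_elim (use assms(5) True in auto)
  from Lim_transform_eventually[OF f this] show ?thesis
    using h tendsto_unique trivial_limit_at by blast
qed (use assms in auto)

lemma det_eq_0_iff_kernel:
  fixes A :: "real^'n^'n"
  shows "det A = 0 \<longleftrightarrow> (\<exists>v. v \<noteq> 0 \<and> A *v v = 0)"
  unfolding det_eq_0_rank matrix_nonfull_linear_equations_eq using rank_bound[of A] by auto

text \<open>The geometric hypotheses in coordinates: transversality, tangent radical and, as a limit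
  from the Riemannian side, semidefiniteness on the hyperplane.\<close>

locale flattened_metric = local_metric S G for S :: "(real^'n::finite) set" and G +
  fixes i :: 'n
  assumes det_zero: "\<And>x. x \<in> S \<Longrightarrow> det (G x) = 0 \<longleftrightarrow> x $ i = 0"
    and det_derivative: "\<And>x. x \<in> S \<Longrightarrow> x $ i = 0 \<Longrightarrow> frechet_derivative (\<lambda>x. det (G x)) (at x) \<noteq> (\<lambda>v. 0)"
    and kernel_tangent: "\<And>x r. x \<in> S \<Longrightarrow> x $ i = 0 \<Longrightarrow> G x *v r = 0 \<Longrightarrow> r $ i = 0"
    and nonneg: "\<And>x v. x \<in> S \<Longrightarrow> x $ i = 0 \<Longrightarrow> met G x v v \<ge> 0"
begin

abbreviation "\<tau>' x \<equiv> frechet_derivative (\<lambda>x. det (G x)) (at x)"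

lemma det_has_derivative: "x \<in> S \<Longrightarrow> ((\<lambda>x. det (G x)) has_derivative \<tau>' x) (at x)"
  using smooth_on_det_G[OF order_refl S] by (rule smooth_on_has_derivative)

lemma vanishing_linear:
  fixes L :: "real^'n \<Rightarrow> real"
  assumes "linear L" "\<And>t. t $ i = 0 \<Longrightarrow> L t = 0"
  shows "L w = w $ i * L (axis i 1)"
proof -
  have "L (w - w $ i *\<^sub>R axis i 1) = 0" by (rule assms(2)) simp
  then show ?thesis by (simp add: linear_diff[OF assms(1)] linear_scale[OF assms(1)])
qed

text \<open>As \<open>det\<close> vanishes along the hyperplane, its derivative there kills tangent
  vectors; being nonzero, it cannot also kill the transverse axis.\<close>

lemma det_derivative_normal:
  assumes "x \<in> S" "x $ i = 0" shows "\<tau>' x (axis i 1) \<noteq> 0"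
proof
  assume 0: "\<tau>' x (axis i 1) = 0"
  have "\<tau>' x t = 0" if "t $ i = 0" for t
    by (rule derivative_tangent_eq_0[OF S assms that det_has_derivative[OF assms(1)]]) (simp add: det_zero)
  from vanishing_linear[OF has_derivative_linear[OF det_has_derivative[OF assms(1)]] this] 0
  have "\<tau>' x w = 0" for w by simp
  then show False using det_derivative[OF assms] by auto
qed

lemma G_adj_vec:
  assumes "x \<in> S" shows "G x *v adj_vec (G x) y = det (G x) *\<^sub>R y"
proof (rule eq_on_hyperplane[OF S assms, where f = "\<lambda>x. G x *v adj_vec (G x) y" and h = "\<lambda>x. det (G x) *\<^sub>R y" and i = i])
  show "continuous_on S (\<lambda>x. G x *v adj_vec (G x) y)"
    by (intro smooth_on_imp_continuous_on smooth_intros smooth_on_adj_vec G S) auto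
  show "continuous_on S (\<lambda>x. det (G x) *\<^sub>R y)"
    by (intro smooth_on_imp_continuous_on smooth_intros G S)
qed (use det_zero adj_vec in auto)

text \<open>Off the hyperplane either side times \<open>det\<close> is the metric pairing of the two
  adjugate vectors, which is symmetric.\<close>

lemma adj_vec_commute:
  assumes "x \<in> S" shows "z \<bullet> adj_vec (G x) y = y \<bullet> adj_vec (G x) z"
proof (rule eq_on_hyperplane[OF S assms, where f = "\<lambda>x. z \<bullet> adj_vec (G x) y" and h = "\<lambda>x. y \<bullet> adj_vec (G x) z" and i = i])
  show "continuous_on S (\<lambda>x. z \<bullet> adj_vec (G x) y)" "continuous_on S (\<lambda>x. y \<bullet> adj_vec (G x) z)"
    by (intro smooth_on_imp_continuous_on smooth_intros smooth_on_adj_vec S order_refl)+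
next
  fix x assume x: "x \<in> S" "x $ i \<noteq> 0"
  have "det (G x) * (z \<bullet> adj_vec (G x) y) = met G x (adj_vec (G x) y) (adj_vec (G x) z)" for y z
    unfolding met_def G_adj_vec[OF x(1)] by (simp add: inner_commute)
  then have "det (G x) * (z \<bullet> adj_vec (G x) y) = det (G x) * (y \<bullet> adj_vec (G x) z)"
    using met_commute[OF x(1)] by metis
  then show "z \<bullet> adj_vec (G x) y = y \<bullet> adj_vec (G x) z" using x det_zero by simp
qed

text \<open>The relation g(r, adj y) = det (r \<bullet> y) is differentiated with \<open>r\<close>
  constant. The term with the derivative of the adjugate is paired with a kernel vector and drops
  out.\<close>

lemma dmet_kernel_adj_vec:
  assumes "x \<in> S" "x $ i = 0" "G x *v r = 0"
  shows "dmet G x w r (adj_vec (G x) y) = \<tau>' x w * (r \<bullet> y)"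
proof -
  let ?B = "\<lambda>z. adj_vec (G z) y"
  have B: "(?B has_derivative frechet_derivative ?B (at x)) (at x)"
    using smooth_on_adj_vec[OF order_refl S smooth_on_const[OF S]] assms(1) by (rule smooth_on_has_derivative)
  have "((\<lambda>z. det (G z) * (r \<bullet> y)) has_derivative (\<lambda>h. \<tau>' x h * (r \<bullet> y))) (at x)"
    by (intro has_derivative_mult_left det_has_derivative assms)
  then have "((\<lambda>z. met G z r (?B z)) has_derivative (\<lambda>h. \<tau>' x h * (r \<bullet> y))) (at x)"
    by (rule has_derivative_transform_within_open[OF _ S assms(1)]) (simp add: met_def G_adj_vec)
  from has_derivative_unique[OF met_has_derivative[OF assms(1) has_derivative_const B] this, THEN fun_cong, of w]
  show ?thesis using met_commute[OF assms(1), of r] assms(3) by (simp add: met_linear) (simp add: met_def)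
qed

lemma kernel_exists:
  assumes "x \<in> S" "x $ i = 0" obtains r where "r \<noteq> 0" "G x *v r = 0"
  using det_zero[OF assms(1)] assms(2) that unfolding det_eq_0_iff_kernel by blast

text \<open>Two independent kernel vectors would make every Cramer determinant, hence the adjugate,
  vanish. Then \<open>dmet_kernel_adj_vec\<close> with both \<open>r\<close> and \<open>y\<close>
  equal to \<open>u\<close> would make the transverse derivative of \<open>det\<close> zero.\<close>

lemma kernel_unique:
  assumes x: "x \<in> S" "x $ i = 0" and u: "G x *v u = 0" "u \<noteq> 0" and v: "G x *v v = 0"
  obtains c where "v = c *\<^sub>R u"
proof (rule ccontr)
  assume "\<not> thesis"
  with that have nc: "v \<noteq> c *\<^sub>R u" for c by blast
  have "adj_vec (G x) y = 0" for y
  proof -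
    have "det (\<chi> a b. if b = k then y $ a else G x $ a $ b) = 0" for k
    proof -
      \<comment> \<open>A kernel vector with vanishing \<open>k\<close>-th entry: it stays in the
        kernel when column \<open>k\<close> is replaced.\<close>
      define z where "z = (if u $ k = 0 then u else v - (v $ k / u $ k) *\<^sub>R u)"
      have z: "z \<noteq> 0" "G x *v z = 0" "z $ k = 0"
        using u v nc[of "v $ k / u $ k"] by (auto simp: z_def matrix_vector_mult_diff_distrib matrix_vector_mult_scaleR)
      have "(\<chi> a b. if b = k then y $ a else G x $ a $ b) *v z = G x *v z"
        unfolding vec_eq_iff matrix_vector_mult_def by (auto intro!: sum.cong simp: z(3))
      then show ?thesis unfolding det_eq_0_iff_kernel using z(1,2) by (intro exI[of _ z]) simp
    qed
    then show ?thesis by (simp add: adj_vec_def vec_eq_iff)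
  qed
  with dmet_kernel_adj_vec[OF x u(1), of "axis i 1" u] u(2) det_derivative_normal[OF x]
  show False by (simp add: dmet_linear)
qed

text \<open>All adjugate vectors lie in the kernel line, and symmetry of the adjugate forces the
  shape c (r \<bullet> y) r. The same \<open>c\<close> appears in Jacobi's formula for the
  derivative of \<open>det\<close>, so transversality makes it nonzero.\<close>

lemma adj_vec_on_hyperplane:
  assumes x: "x \<in> S" "x $ i = 0" and r: "G x *v r = 0" "r \<noteq> 0"
  obtains c where "c \<noteq> 0" "\<And>y. adj_vec (G x) y = (c * (r \<bullet> y)) *\<^sub>R r" "\<And>w. \<tau>' x w = c * dmet G x w r r"
proof -
  have "\<exists>b. adj_vec (G x) y = b *\<^sub>R r" for y
    using kernel_unique[OF x r, of "adj_vec (G x) y"] G_adj_vec[OF x(1)] det_zero[OF x(1)] x(2) by auto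
  then obtain b where b: "\<And>y. adj_vec (G x) y = b y *\<^sub>R r" by metis
  define c where "c = b r / (r \<bullet> r)"
  have rr: "r \<bullet> r \<noteq> 0" using r by simp
  have "b y * (r \<bullet> r) = b r * (r \<bullet> y)" for y
    using adj_vec_commute[OF x(1), of r y] unfolding b by (simp add: inner_commute)
  then have by_eq: "b y = c * (r \<bullet> y)" for y using rr by (simp add: c_def divide_simps mult.commute)
  have "\<tau>' x w = c * dmet G x w r r" for w
    using dmet_kernel_adj_vec[OF x r(1), of w r] rr unfolding b by_eq[of r] by (simp add: dmet_linear)
  moreover from this have "c \<noteq> 0" using det_derivative_normal[OF x] by auto
  ultimately show ?thesis using that[of c] b by_eq by simp
qed

text \<open>Two of the three terms of \<open>Gam\<close> cancel and leave half the derivative of the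
  metric on (r, r). This is proportional to the derivative of \<open>det\<close>, which sees only
  the transverse component of its argument.\<close>

lemma Gam_kernel_kernel:
  assumes "x \<in> S" "x $ i = 0" "G x *v r = 0" "r \<noteq> 0"
  obtains k where "k \<noteq> 0" "\<And>a. Gam G x a r r = a $ i * k"
proof -
  obtain c where c: "c \<noteq> 0" "\<And>w. \<tau>' x w = c * dmet G x w r r"
    using adj_vec_on_hyperplane[OF assms] by metis
  have "\<tau>' x t = 0" if "t $ i = 0" for t
    by (rule derivative_tangent_eq_0[OF S assms(1,2) that det_has_derivative[OF assms(1)]]) (simp add: det_zero)
  from vanishing_linear[OF has_derivative_linear[OF det_has_derivative[OF assms(1)]] this]
  have t: "\<tau>' x a = a $ i * \<tau>' x (axis i 1)" for a .
  have "dmet G x a r r = a $ i * dmet G x (axis i 1) r r" for a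
    using t[of a] c(1) unfolding c(2) by (simp add: mult.left_commute)
  then have "Gam G x a r r = a $ i * (dmet G x (axis i 1) r r / 2)" for a
    unfolding Gam_def by (metis add_diff_cancel_right' times_divide_eq_right)
  moreover have "dmet G x (axis i 1) r r \<noteq> 0"
    using c det_derivative_normal[OF assms(1,2)] by auto
  ultimately show ?thesis
    by (intro that[of "dmet G x (axis i 1) r r / 2"]) simp_all
qed

text \<open>The Cauchy-Schwarz argument for a semidefinite form: a nonzero pairing with a null
  vector would produce negative values.\<close>

lemma kernel_of_null:
  assumes "x \<in> S" "x $ i = 0" "met G x v v = 0" shows "G x *v v = 0"
proof -
  have "met G x v w = 0" for w
  proof (rule ccontr)
    assume ne: "met G x v w \<noteq> 0"
    have q: "0 \<le> 2 * t * met G x v w + t * t * met G x w w" for t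
      using nonneg[OF assms(1,2), of "v + t *\<^sub>R w"] assms(3) met_commute[OF assms(1), of w v]
      by (simp add: met_linear algebra_simps)
    let ?p = "met G x v w" and ?q = "met G x w w"
    have q0: "0 \<le> ?q" by (rule nonneg[OF assms(1,2)])
    \<comment> \<open>The minimiser of the quadratic would be t = -p / q; the shifted denominator
      avoids a separate case for q = 0.\<close>
    have "2 * (- ?p / (?q + 1)) * ?p + (- ?p / (?q + 1)) * (- ?p / (?q + 1)) * ?q = - (?p\<^sup>2 * (?q + 2)) / (?q + 1)\<^sup>2"
      using q0 by (simp add: divide_simps power2_eq_square) (simp add: algebra_simps)
    moreover have "- (?p\<^sup>2 * (?q + 2)) / (?q + 1)\<^sup>2 < 0"
      using ne q0 by (intro divide_neg_pos) auto
    ultimately show False using q[of "- ?p / (?q + 1)"] by simp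
  qed
  then have "met G x (G x *v v) v = 0" by (metis met_commute[OF assms(1)])
  then show ?thesis by (simp add: met_def)
qed

text \<open>Hadamard's lemma is applied both to \<open>F\<close> and to \<open>det\<close>. The
  quotient of \<open>det\<close> by the coordinate equals at \<open>x\<close> the transverse
  derivative of \<open>det\<close>, so it has no zeros nearby and can be divided out.\<close>

lemma quotient_by_det:
  fixes F :: "real^'n \<Rightarrow> 'b::euclidean_space"
  assumes V: "open V" "V \<subseteq> S" and x: "x \<in> V" "x $ i = 0" and F: "smooth_on V F"
    and 0: "\<And>y. y \<in> V \<Longrightarrow> y $ i = 0 \<Longrightarrow> F y = 0"
  obtains e H where "e > 0" "ball x e \<subseteq> V" "smooth_on (ball x e) H"
    "\<And>y. y \<in> ball x e \<Longrightarrow> F y = det (G y) *\<^sub>R H y"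
proof -
  have xS: "x \<in> S" using x V by auto
  obtain e where e: "e > 0" "ball x e \<subseteq> V" using V x open_contains_ball by blast
  obtain H where H: "smooth_on (ball x e) H" "\<And>y. y \<in> ball x e \<Longrightarrow> F y = y $ i *\<^sub>R H y"
    using smooth_on_divide_coordinate[OF x(2) smooth_on_subset[OF F e(2)]] 0 e(2) by blast
  obtain u where u: "smooth_on (ball x e) u" "\<And>y. y \<in> ball x e \<Longrightarrow> det (G y) = y $ i *\<^sub>R u y"
    using smooth_on_divide_coordinate[OF x(2) smooth_on_subset[OF smooth_on_det_G[OF order_refl S]], of e] e(2) V(2) det_zero
    by (metis (no_types, lifting) subset_iff)
  have xb: "x \<in> ball x e" using e by simp
  have "((\<lambda>y. y $ i *\<^sub>R u y) has_derivative (\<lambda>h. x $ i *\<^sub>R frechet_derivative u (at x) h + h $ i *\<^sub>R u x)) (at x)"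
    by (intro has_derivative_scaleR bounded_linear_imp_has_derivative bounded_linear_vec_nth smooth_on_has_derivative[OF u(1) xb])
  then have "((\<lambda>y. det (G y)) has_derivative (\<lambda>h. x $ i *\<^sub>R frechet_derivative u (at x) h + h $ i *\<^sub>R u x)) (at x)"
    by (rule has_derivative_transform_within_open[OF _ open_ball xb]) (simp add: u(2))
  from has_derivative_unique[OF det_has_derivative[OF xS] this]
  have "\<tau>' x (axis i 1) = u x" using x(2) by simp
  then have "u x \<noteq> 0" using det_derivative_normal[OF xS x(2)] by simp
  have "isCont u x"
    using smooth_on_imp_continuous_on[OF u(1)] xb continuous_on_eq_continuous_at[OF open_ball] by blast
  then obtain d where d: "d > 0" "\<And>y. dist x y < d \<Longrightarrow> u y \<noteq> 0"
    using continuous_at_avoid[of x u 0] \<open>u x \<noteq> 0\<close> by blast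
  let ?e = "min d e"
  have sub: "ball x ?e \<subseteq> ball x e" by auto
  have nz: "u y \<noteq> 0" if "y \<in> ball x ?e" for y using d(2) that by simp
  have "smooth_on (ball x ?e) (\<lambda>y. (1 / u y) *\<^sub>R H y)"
    using smooth_on_subset[OF H(1) sub] smooth_on_subset[OF u(1) sub] nz by (intro smooth_intros) auto
  moreover have "F y = det (G y) *\<^sub>R ((1 / u y) *\<^sub>R H y)" if "y \<in> ball x ?e" for y
    using H(2)[of y] u(2)[of y] nz[OF that] sub that by auto
  ultimately show ?thesis using that[of ?e "\<lambda>y. (1 / u y) *\<^sub>R H y"] d e sub by auto
qed

subsection \<open>Behaviour of the curvature at the hypersurface\<close>

text \<open>Times \<open>det\<close>, the curvature is the expression \<open>?P\<close>, smooth up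
  to the hyperplane. If the curvature extends, \<open>?P\<close> vanishes at \<open>x\<close>; there
  its \<open>Hess\<close> term is 0, and the adjugate terms are \<open>c\<close> times the two
  products.\<close>

lemma Rm_extends_imp:
  assumes V: "open V" "V \<subseteq> S" and x: "x \<in> V" "x $ i = 0" and r: "G x *v r = 0"
    and XYZW: "smooth_on V X" "smooth_on V Y" "smooth_on V Z" "smooth_on V W"
    and F: "smooth_on V F" "\<And>y. y \<in> V \<Longrightarrow> y $ i \<noteq> 0 \<Longrightarrow> F y = Rm G y (X y) (Y y) (Z y) (W y)"
  shows "Gam G x (Y x) (W x) r * Gam G x (X x) (Z x) r = Gam G x (X x) (W x) r * Gam G x (Y x) (Z x) r"
proof (cases "r = 0")
  case True
  then show ?thesis using V x by (auto simp: Gam_linear)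
next
  case False
  have xS: "x \<in> S" using x V by auto
  obtain c where c: "c \<noteq> 0" "\<And>y. adj_vec (G x) y = (c * (r \<bullet> y)) *\<^sub>R r"
    using adj_vec_on_hyperplane[OF xS x(2) r False] by metis
  let ?P = "\<lambda>y. det (G y) * Hess G y (X y) (Y y) (Z y) (W y)
      + Gam G y (Y y) (W y) (adj_vec (G y) (gamma G y (X y) (Z y)))
      - Gam G y (X y) (W y) (adj_vec (G y) (gamma G y (Y y) (Z y)))"
  have "det (G x) * F x = ?P x"
  proof (rule eq_on_hyperplane[OF V(1) x(1), of _ _ i])
    show "continuous_on V (\<lambda>y. det (G y) * F y)"
      using V F by (intro smooth_on_imp_continuous_on smooth_intros smooth_on_det_G)
    show "continuous_on V ?P"
      using V XYZW by (intro smooth_on_imp_continuous_on smooth_intros smooth_on_Hess smooth_on_Gam smooth_on_adj_vec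
          smooth_on_gamma smooth_on_det_G)
    fix y assume y: "y \<in> V" "y $ i \<noteq> 0"
    then have yS: "y \<in> S" and "det (G y) \<noteq> 0" using V det_zero by auto
    then show "det (G y) * F y = ?P y"
      by (simp add: F(2)[OF y] Rm_def conn_def Gam_linear algebra_simps)
  qed
  then have "Gam G x (Y x) (W x) (adj_vec (G x) (gamma G x (X x) (Z x))) = Gam G x (X x) (W x) (adj_vec (G x) (gamma G x (Y x) (Z x)))"
    using det_zero[OF xS] x(2) by simp
  then have "c * (Gam G x (Y x) (W x) r * Gam G x (X x) (Z x) r) = c * (Gam G x (X x) (W x) r * Gam G x (Y x) (Z x) r)"
    unfolding c(2) by (simp add: Gam_linear xS inner_commute[of r] gamma_inner algebra_simps)
  then show ?thesis using c(1) by simp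
qed

text \<open>II-flatness stated for all tangent and all radical vectors, so that no frame enters the
  coordinate computations.\<close>

definition flat_on :: "(real^'n) set \<Rightarrow> bool" where
  "flat_on V \<longleftrightarrow> (\<forall>x\<in>V. x $ i = 0 \<longrightarrow> (\<forall>a b r. a $ i = 0 \<longrightarrow> b $ i = 0 \<longrightarrow> G x *v r = 0 \<longrightarrow> Gam G x a b r = 0))"

text \<open>On the hyperplane the adjugate applied to \<open>gamma\<close> is a multiple of
  \<open>Gam\<close>(X, Y, r) r and so vanishes by \<open>flat\<close>; its quotient by
  \<open>det\<close> is the extension.\<close>

lemma conn_extends:
  assumes V: "open V" "V \<subseteq> S" and x: "x \<in> V" "x $ i = 0"
    and XY: "smooth_on V X" "smooth_on V Y"
    and flat: "\<And>y r. y \<in> V \<Longrightarrow> y $ i = 0 \<Longrightarrow> G y *v r = 0 \<Longrightarrow> Gam G y (X y) (Y y) r = 0"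
  obtains e D where "e > 0" "ball x e \<subseteq> V" "smooth_on (ball x e) D"
    "\<And>y. y \<in> ball x e \<Longrightarrow> y $ i \<noteq> 0 \<Longrightarrow> D y = conn G y (X y) (Y y)"
    "\<And>y w. y \<in> ball x e \<Longrightarrow> met G y (D y) w = Gam G y (X y) (Y y) w"
proof -
  let ?F = "\<lambda>y. adj_vec (G y) (gamma G y (X y) (Y y))"
  have sF: "smooth_on V ?F" using V XY by (intro smooth_on_adj_vec smooth_on_gamma)
  have "?F y = 0" if y: "y \<in> V" "y $ i = 0" for y
  proof -
    have yS: "y \<in> S" using y V by auto
    obtain r where r: "r \<noteq> 0" "G y *v r = 0" using kernel_exists[OF yS y(2)] .
    obtain c where "\<And>z. adj_vec (G y) z = (c * (r \<bullet> z)) *\<^sub>R r"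
      using adj_vec_on_hyperplane[OF yS y(2) r(2,1)] by metis
    then show ?thesis using flat[OF y r(2)] by (simp add: inner_commute[of r] gamma_inner yS)
  qed
  then obtain e D where D: "e > 0" "ball x e \<subseteq> V" "smooth_on (ball x e) D"
    "\<And>y. y \<in> ball x e \<Longrightarrow> ?F y = det (G y) *\<^sub>R D y"
    using quotient_by_det[OF V x sF] by blast
  have c: "D y = conn G y (X y) (Y y)" if "y \<in> ball x e" "y $ i \<noteq> 0" for y
  proof -
    have "y \<in> S" using that D(2) V(2) by blast
    then have "det (G y) \<noteq> 0" using that det_zero by simp
    then show ?thesis by (simp add: conn_def D(4)[OF that(1)])
  qed
  moreover have "met G y (D y) w = Gam G y (X y) (Y y) w" if y: "y \<in> ball x e" for y w
  proof (rule eq_on_hyperplane[OF open_ball y, where i = i])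
    have sub: "ball x e \<subseteq> S" using D V by auto
    show "continuous_on (ball x e) (\<lambda>y. met G y (D y) w)" "continuous_on (ball x e) (\<lambda>y. Gam G y (X y) (Y y) w)"
      using D(3) sub smooth_on_subset[OF XY(1) D(2)] smooth_on_subset[OF XY(2) D(2)]
      by (auto intro!: smooth_on_imp_continuous_on smooth_on_met smooth_on_Gam smooth_intros)
    fix y assume "y \<in> ball x e" "y $ i \<noteq> 0"
    with sub det_zero[of y] show "met G y (D y) w = Gam G y (X y) (Y y) w"
      by (auto simp: c met_conn)
  qed
  ultimately show ?thesis using that D by blast
qed

text \<open>On the hypersurface the connection vector of \<open>a\<close> and \<open>b\<close> is defined only up to the radical.\<close>

definition is_conn :: "real^'n \<Rightarrow> real^'n \<Rightarrow> real^'n \<Rightarrow> real^'n \<Rightarrow> bool" where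
  "is_conn x a b D \<longleftrightarrow> (\<forall>w. met G x D w = Gam G x a b w)"

lemma is_conn_kernel:
  assumes "x \<in> S" "is_conn x a b D" "is_conn x a b D'" shows "G x *v (D - D') = 0"
proof -
  have "met G x (D - D') (G x *v (D - D')) = 0" using assms by (simp add: is_conn_def met_linear)
  then have "met G x (G x *v (D - D')) (D - D') = 0" by (metis met_commute[OF assms(1)])
  then show ?thesis by (simp add: met_def)
qed

text \<open>Each connection vector is replaced by its extension. The value at \<open>x\<close> does
  not depend on the representatives \<open>D\<close> and \<open>E\<close>: they are fixed up to the
  kernel, which \<open>Gam\<close> with two tangent arguments annihilates.\<close>

lemma Rm_extends:
  assumes V: "open V" "V \<subseteq> S" "flat_on V" and x: "x \<in> V" "x $ i = 0"
    and XYZW: "smooth_on V X" "smooth_on V Y" "smooth_on V Z" "smooth_on V W"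
    and tan: "\<And>y. y \<in> V \<Longrightarrow> y $ i = 0 \<Longrightarrow> X y $ i = 0 \<and> Y y $ i = 0 \<and> Z y $ i = 0 \<and> W y $ i = 0"
  obtains e F where "e > 0" "ball x e \<subseteq> V" "smooth_on (ball x e) F"
    "\<And>y. y \<in> ball x e \<Longrightarrow> y $ i \<noteq> 0 \<Longrightarrow> F y = Rm G y (X y) (Y y) (Z y) (W y)"
    "\<exists>D. is_conn x (X x) (Z x) D" "\<exists>D. is_conn x (Y x) (Z x) D"
    "\<And>D E. is_conn x (X x) (Z x) D \<Longrightarrow> is_conn x (Y x) (Z x) E \<Longrightarrow>
      F x = Hess G x (X x) (Y x) (Z x) (W x) + Gam G x (Y x) (W x) D - Gam G x (X x) (W x) E"
proof -
  have flat: "Gam G y a b r = 0" if "y \<in> V" "y $ i = 0" "a $ i = 0" "b $ i = 0" "G y *v r = 0" for y a b r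
    using V(3) that by (auto simp: flat_on_def)
  obtain e1 D1 where 1: "e1 > 0" "ball x e1 \<subseteq> V" "smooth_on (ball x e1) D1"
    "\<And>y. y \<in> ball x e1 \<Longrightarrow> y $ i \<noteq> 0 \<Longrightarrow> D1 y = conn G y (X y) (Z y)"
    "\<And>y w. y \<in> ball x e1 \<Longrightarrow> met G y (D1 y) w = Gam G y (X y) (Z y) w"
    by (rule conn_extends[OF V(1,2) x XYZW(1,3)]) (use flat tan in blast)+
  obtain e2 D2 where 2: "e2 > 0" "ball x e2 \<subseteq> V" "smooth_on (ball x e2) D2"
    "\<And>y. y \<in> ball x e2 \<Longrightarrow> y $ i \<noteq> 0 \<Longrightarrow> D2 y = conn G y (Y y) (Z y)"
    "\<And>y w. y \<in> ball x e2 \<Longrightarrow> met G y (D2 y) w = Gam G y (Y y) (Z y) w"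
    by (rule conn_extends[OF V(1,2) x XYZW(2,3)]) (use flat tan in blast)+
  define e where "e = min e1 e2"
  let ?F = "\<lambda>y. Hess G y (X y) (Y y) (Z y) (W y) + Gam G y (Y y) (W y) (D1 y) - Gam G y (X y) (W y) (D2 y)"
  have e: "e > 0" "ball x e \<subseteq> ball x e1" "ball x e \<subseteq> ball x e2" using 1 2 by (auto simp: e_def)
  have eV: "ball x e \<subseteq> V" using e 1 by auto
  have xS: "x \<in> S" using x V by auto
  have xe: "x \<in> ball x e1" "x \<in> ball x e2" using 1 2 by auto
  have "smooth_on (ball x e) ?F"
    using V(2) eV 1(3) 2(3) e XYZW smooth_on_subset
    by (intro smooth_intros smooth_on_Hess smooth_on_Gam) (auto intro: smooth_on_subset)
  moreover have "?F y = Rm G y (X y) (Y y) (Z y) (W y)" if "y \<in> ball x e" "y $ i \<noteq> 0" for y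
    using that 1(4)[of y] 2(4)[of y] subsetD[OF e(2), of y] subsetD[OF e(3), of y] by (simp add: Rm_def)
  moreover have c: "is_conn x (X x) (Z x) (D1 x)" "is_conn x (Y x) (Z x) (D2 x)"
    using 1(5) 2(5) xe by (auto simp: is_conn_def)
  moreover have "?F x = Hess G x (X x) (Y x) (Z x) (W x) + Gam G x (Y x) (W x) D - Gam G x (X x) (W x) E"
    if "is_conn x (X x) (Z x) D" "is_conn x (Y x) (Z x) E" for D E
    using flat[OF x, of "Y x" "W x" "D1 x - D"] flat[OF x, of "X x" "W x" "D2 x - E"] tan[OF x]
      is_conn_kernel[OF xS c(1) that(1)] is_conn_kernel[OF xS c(2) that(2)]
    by (simp add: Gam_linear xS)
  ultimately show ?thesis using that[of e ?F] e(1) eV by blast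
qed

text \<open>The hyperplane and \<open>n\<close> together span the space, and the corrected vector is
  orthogonal to both.\<close>

lemma orthogonal_kernel:
  assumes x: "x \<in> S" and n: "\<And>w. w $ i = 0 \<Longrightarrow> met G x n w = 0" "met G x n n = 1"
    and e: "\<And>w. w $ i = 0 \<Longrightarrow> met G x e w = 0"
  shows "G x *v (e - met G x e n *\<^sub>R n) = 0"
proof -
  let ?d = "e - met G x e n *\<^sub>R n"
  have n0: "n $ i \<noteq> 0" using n by auto
  have "met G x ?d w = 0" for w
  proof -
    have "w = (w - (w $ i / n $ i) *\<^sub>R n) + (w $ i / n $ i) *\<^sub>R n" by simp
    moreover have "met G x ?d (w - (w $ i / n $ i) *\<^sub>R n) = 0"
      using n(1)[of "w - (w $ i / n $ i) *\<^sub>R n"] e[of "w - (w $ i / n $ i) *\<^sub>R n"] n0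
      by (simp add: met_linear(3,5))
    moreover have "met G x ?d n = 0" using n(2) by (simp add: met_linear)
    ultimately show ?thesis by (metis met_linear(2,6) add.right_neutral mult_zero_right)
  qed
  then have "met G x (G x *v ?d) ?d = 0" by (metis met_commute[OF x])
  then show ?thesis by (simp add: met_def)
qed

text \<open>Keeping \<open>w\<close> constant while the point varies yields a smooth field that is
  radical along the hyperplane and has a prescribed value at \<open>x\<close>.\<close>

lemma kernel_field:
  assumes x: "x \<in> S" "x $ i = 0" "G x *v r = 0" "r \<noteq> 0"
  obtains w where "adj_vec (G x) w = r"
proof -
  obtain c where c: "c \<noteq> 0" "\<And>y. adj_vec (G x) y = (c * (r \<bullet> y)) *\<^sub>R r"
    using adj_vec_on_hyperplane[OF x] by metis
  have "adj_vec (G x) ((1 / (c * (r \<bullet> r))) *\<^sub>R r) = r" using c x(4) by simp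
  then show ?thesis by (rule that)
qed

text \<open>The second derivatives of the metric are eliminated by differentiating flatness, applied to a
  field of radical vectors, along \<open>r\<close> and \<open>v\<close>.\<close>

theorem flat_curvature_radical:
  assumes V: "open V" "V \<subseteq> S" "flat_on V" and x: "x \<in> V" "x $ i = 0"
    and r: "G x *v r = 0" "r \<noteq> 0" and v: "v $ i = 0"
    and n: "\<And>w. w $ i = 0 \<Longrightarrow> met G x n w = 0" "met G x n n = 1"
    and D: "is_conn x r r D" "is_conn x v r E"
  shows "Hess G x r v r v + Gam G x v v D - Gam G x r v E = Gam G x r r n * Gam G x v v n - (Gam G x r v n)\<^sup>2"
proof -
  have xS: "x \<in> S" using x V by auto
  have ri: "r $ i = 0" by (rule kernel_tangent[OF xS x(2) r(1)])
  have flat: "Gam G y a b s = 0" if "y \<in> V" "y $ i = 0" "a $ i = 0" "b $ i = 0" "G y *v s = 0" for y a b s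
    using V(3) that by (auto simp: flat_on_def)
  obtain w0 where w0: "adj_vec (G x) w0 = r" using kernel_field[OF xS x(2) r] .
  define R where "R y = adj_vec (G y) w0" for y
  have "smooth_on S R" unfolding R_def by (intro smooth_on_adj_vec smooth_intros S) auto
  then obtain R' where R': "(R has_derivative R') (at x)" using smooth_on_has_derivative xS by blast
  have Rx: "R x = r" by (simp add: R_def w0)
  have Rker: "G y *v R y = 0" if "y \<in> V" "y $ i = 0" for y
    using that V det_zero[of y] G_adj_vec[of y] by (auto simp: R_def)
  have Rmet: "met G y (R y) w = 0" if "y \<in> V" "y $ i = 0" for y w
    using met_commute[of y "R y" w] Rker[OF that] that V by (auto simp: met_def)
  have tanR': "R' t $ i = 0" if "t $ i = 0" for t
    by (rule derivative_tangent_eq_0[OF V(1) x that bounded_linear.has_derivative[OF bounded_linear_vec_nth R']])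
       (use kernel_tangent Rker V in blast)
  have dG: "dGam G x t a b r + Gam G x a b (R' t) = 0" if "t $ i = 0" "a $ i = 0" "b $ i = 0" for t a b
  proof -
    have "((\<lambda>y. Gam G y a b (R y)) has_derivative
        (\<lambda>h. dGam G x h a b (R x) + Gam G x 0 b (R x) + Gam G x a 0 (R x) + Gam G x a b (R' h))) (at x)"
      by (intro Gam_has_derivative xS has_derivative_const R')
    from derivative_tangent_eq_0[OF V(1) x that(1) this] flat[OF _ _ that(2,3) Rker]
    show ?thesis by (simp add: Gam_linear xS Rx)
  qed
  have dm: "dmet G x t r w + met G x (R' t) w = 0" if "t $ i = 0" for t w
  proof -
    have "((\<lambda>y. met G y (R y) w) has_derivative
        (\<lambda>h. dmet G x h (R x) w + met G x (R' h) w + met G x (R x) 0)) (at x)"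
      by (intro met_has_derivative xS has_derivative_const R')
    from derivative_tangent_eq_0[OF V(1) x that this] Rmet show ?thesis by (simp add: met_linear Rx)
  qed
  \<comment> \<open>\<open>R' t + F\<close> represents the covariant derivative of the radical field
    along \<open>t\<close>. By flatness it is orthogonal to the hyperplane, hence modulo the kernel
    a multiple of \<open>n\<close>, with coefficient \<H>(t, r).\<close>
  have E: "Gam G x a b (R' t + F) = Gam G x t r n * Gam G x a b n"
    if t: "t $ i = 0" and ab: "a $ i = 0" "b $ i = 0" and F: "is_conn x t r F" for t a b F
  proof -
    have m: "met G x (R' t + F) w = - Gam G x t w r" for w
      using dm[OF t, of w] F dmet_eq_Gam[OF xS, of t r w] by (simp add: is_conn_def met_linear)
    then have o: "met G x (R' t + F) w = 0" if "w $ i = 0" for w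
      using flat[OF x t that r(1)] by simp
    have "met G x (R' t + F) n = met G x F n"
      using n(1)[OF tanR'[OF t]] met_commute[OF xS] by (simp add: met_linear)
    also have "\<dots> = Gam G x t r n" using F by (simp add: is_conn_def)
    finally have mn: "met G x (R' t + F) n = Gam G x t r n" .
    have "Gam G x a b (R' t + F - met G x (R' t + F) n *\<^sub>R n) = 0"
      by (intro flat x ab orthogonal_kernel[OF xS n(1) n(2) o])
    then show ?thesis unfolding mn by (simp add: Gam_linear xS)
  qed
  \<comment> \<open>The symmetries of the second derivatives move \<open>r\<close> into the last
    slot of \<open>dGam\<close>, where the differentiated flatness \<open>dG\<close>
    applies.\<close>
  have "Hess G x r v r v = dGam G x v r v r - dGam G x r v v r"
    using ddmet_commute[OF xS, of r r v v] ddmet_commute[OF xS, of v r r v] ddmet_commute[OF xS, of r v r v]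
      ddmet_symmetric[OF xS, of r v v r] by (simp add: Hess_def dGam_def field_simps)
  also have "\<dots> = Gam G x v v (R' r) - Gam G x r v (R' v)"
    using dG[OF v ri v] dG[OF ri v v] by simp
  finally show ?thesis
    using E[OF ri v v D(1)] E[OF v ri v D(2)] Gam_commute[OF xS, of v r n]
    by (simp add: Gam_linear xS power2_eq_square)
qed

text \<open>The curvature value at the hypersurface is so far only an expression in representatives
  of connection vectors. Its behaviour under a change of basis of the plane is therefore checked
  directly, with representatives combined from \<open>D\<close>, \<open>E\<close> and
  \<open>F\<close>.\<close>

lemma flat_curvature_change_basis:
  fixes \<alpha> \<beta> :: real
  assumes x: "x \<in> S" and D: "is_conn x a a D" "is_conn x b a E" "is_conn x b b F"
  defines "r \<equiv> \<alpha> *\<^sub>R a + \<beta> *\<^sub>R b"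
  obtains D' E' where "is_conn x r r D'" "is_conn x b r E'"
    "Hess G x r b r b + Gam G x b b D' - Gam G x r b E' =
       \<alpha>\<^sup>2 * (Hess G x a b a b + Gam G x b b D - Gam G x a b E)"
proof -
  let ?D = "\<alpha>\<^sup>2 *\<^sub>R D + (2 * \<alpha> * \<beta>) *\<^sub>R E + \<beta>\<^sup>2 *\<^sub>R F" and ?E = "\<alpha> *\<^sub>R E + \<beta> *\<^sub>R F"
  have c: "Gam G x a b w = Gam G x b a w" for w by (rule Gam_commute[OF x])
  have D': "is_conn x r r ?D" "is_conn x b r ?E"
    using D by (simp_all add: is_conn_def r_def met_linear Gam_linear x c power2_eq_square algebra_simps)
  have lin: "linear (\<lambda>t. ddmet G x s t v w)" "linear (\<lambda>t. ddmet G x t s v w)" for s v w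
  proof -
    have "linear (frechet_derivative (\<lambda>y. frechet_derivative G (at y) s) (at x))" for s
      by (intro linear_frechet_derivative smooth_on_differentiable[OF smooth_on_derivative[OF G] x])
    then show 1: "linear (\<lambda>t. ddmet G x t s v w)" for s
      by (intro linearI) (simp_all add: ddmet_def linear_add linear_scale matrix_vector_mult_add_rdistrib
          inner_add_right scaleR_matrix_vector_assoc[symmetric])
    show "linear (\<lambda>t. ddmet G x s t v w)"
      using 1[of s] by (simp add: ddmet_symmetric[OF x, of s])
  qed
  have l2: "ddmet G x s t (p *\<^sub>R v + q *\<^sub>R w) z = p * ddmet G x s t v z + q * ddmet G x s t w z"
    "ddmet G x s t z (p *\<^sub>R v + q *\<^sub>R w) = p * ddmet G x s t z v + q * ddmet G x s t z w" for s t v w z p q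
    by (simp_all add: ddmet_def matrix_vector_right_distrib inner_add_left inner_add_right matrix_vector_mult_scaleR)
  have l1: "ddmet G x s (p *\<^sub>R t + q *\<^sub>R u) v w = p * ddmet G x s t v w + q * ddmet G x s u v w"
    "ddmet G x (p *\<^sub>R t + q *\<^sub>R u) s v w = p * ddmet G x t s v w + q * ddmet G x u s v w" for s t u v w p q
    using linear_add[OF lin(1)[of s v w]] linear_scale[OF lin(1)[of s v w]]
      linear_add[OF lin(2)[of s v w]] linear_scale[OF lin(2)[of s v w]] by simp_all
  have H: "Hess G x r b r b = \<alpha>\<^sup>2 * Hess G x a b a b"
    using ddmet_commute[OF x, of _ _ b a] ddmet_symmetric[OF x, of b a]
    by (simp add: Hess_def r_def l1 l2 power2_eq_square algebra_simps)
  \<comment> \<open>Both sides are the metric pairing of \<open>E\<close> and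
    \<open>F\<close>.\<close>
  have FE: "Gam G x b b E = Gam G x b a F"
    using D met_commute[OF x, of F E] by (simp add: is_conn_def)
  have "Gam G x b b ?D - Gam G x r b ?E = \<alpha>\<^sup>2 * (Gam G x b b D - Gam G x a b E)"
    using FE by (simp add: r_def Gam_linear x c power2_eq_square algebra_simps)
  with H have "Hess G x r b r b + Gam G x b b ?D - Gam G x r b ?E =
      \<alpha>\<^sup>2 * (Hess G x a b a b + Gam G x b b D - Gam G x a b E)"
    by (simp add: algebra_simps)
  with D' show ?thesis by (rule that)
qed

section \<open>The Gram determinant of a plane containing the radical\<close>

definition gram_det :: "(real^'n \<Rightarrow> real^'n) \<Rightarrow> (real^'n \<Rightarrow> real^'n) \<Rightarrow> real^'n \<Rightarrow> real" where
  "gram_det X Y y = met G y (X y) (X y) * met G y (Y y) (Y y) - (met G y (X y) (Y y))\<^sup>2"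

text \<open>Replacing \<open>X\<close> by Z = \<alpha> X + \<beta> Y multiplies the Gram determinant
  by \<alpha>^2, and Z is radical at \<open>x\<close>. To first order only the derivative of g(Z, Z)
  times g(Y, Y) survives: the first factor is nonzero by transversality, the second because
  \<open>Y x\<close> is not radical.\<close>

lemma gram_det_simple_zero:
  assumes V: "open V" "V \<subseteq> S" and x: "x \<in> V" "x $ i = 0" and XY: "smooth_on V X" "smooth_on V Y"
    and r: "G x *v r = 0" "r = \<alpha> *\<^sub>R X x + \<beta> *\<^sub>R Y x" "\<alpha> \<noteq> 0" "r \<noteq> 0" and Y: "G x *v Y x \<noteq> 0"
    and 0: "\<And>y. y \<in> V \<Longrightarrow> y $ i = 0 \<Longrightarrow> gram_det X Y y = 0"
  obtains e H where "e > 0" "ball x e \<subseteq> V" "smooth_on (ball x e) H"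
    "\<And>y. y \<in> ball x e \<Longrightarrow> gram_det X Y y = det (G y) * H y" "\<And>y. y \<in> ball x e \<Longrightarrow> H y \<noteq> 0"
proof -
  have xS: "x \<in> S" using x V by auto
  have "smooth_on V (gram_det X Y)"
    unfolding gram_det_def[abs_def] power2_eq_square using V XY by (intro smooth_intros smooth_on_met)
  from quotient_by_det[OF V x this 0] obtain e H where H: "e > 0" "ball x e \<subseteq> V" "smooth_on (ball x e) H"
    "\<And>y. y \<in> ball x e \<Longrightarrow> gram_det X Y y = det (G y) * H y" by auto
  have xe: "x \<in> ball x e" using H by simp
  let ?Z = "\<lambda>y. \<alpha> *\<^sub>R X y + \<beta> *\<^sub>R Y y"
  have gZ: "gram_det ?Z Y y = \<alpha>\<^sup>2 * gram_det X Y y" if "y \<in> S" for y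
    using met_commute[OF that, of "Y y" "X y"] by (simp add: gram_det_def met_linear power2_eq_square algebra_simps)
  have kr: "met G x r w = 0" "met G x w r = 0" for w
    using r(1) met_commute[OF xS, of r w] by (simp_all add: met_def)
  obtain X' Y' where X': "(X has_derivative X') (at x)" and Y': "(Y has_derivative Y') (at x)"
    using smooth_on_has_derivative XY x by blast
  have Z': "(?Z has_derivative (\<lambda>h. \<alpha> *\<^sub>R X' h + \<beta> *\<^sub>R Y' h)) (at x)"
    by (intro derivative_intros X' Y')
  note m = met_has_derivative[OF xS]
  have "((\<lambda>y. met G y (?Z y) (?Z y) * met G y (Y y) (Y y) - met G y (?Z y) (Y y) * met G y (?Z y) (Y y)) has_derivative
     (\<lambda>h. dmet G x h r r * met G x (Y x) (Y x))) (at x)"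
    by (rule has_derivative_eq_rhs[OF has_derivative_diff[OF has_derivative_mult[OF m[OF Z' Z'] m[OF Y' Y']]
          has_derivative_mult[OF m[OF Z' Y'] m[OF Z' Y']]]])
       (simp add: fun_eq_iff r(2)[symmetric] kr)
  then have "((\<lambda>y. \<alpha>\<^sup>2 * (det (G y) * H y)) has_derivative (\<lambda>h. dmet G x h r r * met G x (Y x) (Y x))) (at x)"
    by (rule has_derivative_transform_within_open[OF _ open_ball xe])
       (use H V gZ in \<open>auto simp: gram_det_def power2_eq_square subset_iff\<close>)
  moreover have "((\<lambda>y. \<alpha>\<^sup>2 * (det (G y) * H y)) has_derivative
      (\<lambda>h. \<alpha>\<^sup>2 * (det (G x) * frechet_derivative H (at x) h + \<tau>' x h * H x))) (at x)"
    by (intro has_derivative_mult_right has_derivative_mult det_has_derivative xS smooth_on_has_derivative[OF H(3) xe])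
  ultimately have "(\<lambda>h. dmet G x h r r * met G x (Y x) (Y x)) =
      (\<lambda>h. \<alpha>\<^sup>2 * (det (G x) * frechet_derivative H (at x) h + \<tau>' x h * H x))"
    by (rule has_derivative_unique)
  from fun_cong[OF this, of "axis i 1"]
  have "dmet G x (axis i 1) r r * met G x (Y x) (Y x) = \<alpha>\<^sup>2 * (\<tau>' x (axis i 1) * H x)"
    using det_zero[OF xS] x(2) by simp
  moreover have "dmet G x (axis i 1) r r \<noteq> 0"
  proof -
    obtain c where "\<And>w. \<tau>' x w = c * dmet G x w r r"
      using adj_vec_on_hyperplane[OF xS x(2) r(1,4)] by blast
    then show ?thesis using det_derivative_normal[OF xS x(2)] by auto
  qed
  moreover have "met G x (Y x) (Y x) \<noteq> 0"
    using kernel_of_null[OF xS x(2)] Y by blast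
  ultimately have "H x \<noteq> 0" by auto
  have "isCont H x"
    using smooth_on_imp_continuous_on[OF H(3)] xe continuous_on_eq_continuous_at[OF open_ball] by blast
  then obtain d where d: "d > 0" "\<And>y. dist x y < d \<Longrightarrow> H y \<noteq> 0"
    using continuous_at_avoid[of x H 0] \<open>H x \<noteq> 0\<close> by blast
  let ?e = "min d e"
  have "ball x ?e \<subseteq> ball x e" by auto
  then show ?thesis using that[of ?e H] d H smooth_on_subset[OF H(3)] by auto
qed

end

section \<open>Change of charts\<close>

definition chart_deriv :: "('a, 'n::finite) chart \<Rightarrow> ('a, 'n) chart \<Rightarrow> 'a \<Rightarrow> real^'n \<Rightarrow> real^'n" where
  "chart_deriv c d p = frechet_derivative (snd d \<circ> cinv c) (at (snd c p))"

definition lift_field :: "('a, 'n::finite) chart set \<Rightarrow> ('a, 'n) chart \<Rightarrow> (real^'n \<Rightarrow> real^'n) \<Rightarrow> 'a \<Rightarrow> real^'n" where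
  "lift_field \<A> c X q = chart_deriv c (chart_at \<A> q) q (X (snd c q))"

locale smooth_manifold =
  fixes \<A> :: "('a::{t2_space,second_countable_topology}, 'n::finite) chart set"
  assumes \<A>: "smooth_structure \<A>"
begin

lemma
  assumes "c \<in> \<A>"
  shows open_domain: "open (fst c)" and open_range: "open (snd c ` fst c)"
    and chart_homeomorphism: "homeomorphism (fst c) (snd c ` fst c) (snd c) (cinv c)"
  using \<A> assms by (auto simp: smooth_structure_def is_chart_def)

lemma cinv_chart [simp]: "c \<in> \<A> \<Longrightarrow> p \<in> fst c \<Longrightarrow> cinv c (snd c p) = p"
  using chart_homeomorphism by (simp add: homeomorphism_def)

lemma image_eq_preimage:
  assumes "c \<in> \<A>"
  shows "snd c ` (fst c \<inter> U) = {x \<in> snd c ` fst c. cinv c x \<in> U}"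
  using assms by (auto simp: image_iff)

lemma open_image:
  assumes "c \<in> \<A>" "open U" shows "open (snd c ` (fst c \<inter> U))"
proof -
  have "continuous_on (snd c ` fst c) (cinv c)"
    using chart_homeomorphism[OF assms(1)] by (simp add: homeomorphism_def)
  from continuous_open_preimage[OF this open_range[OF assms(1)] assms(2)]
  show ?thesis unfolding image_eq_preimage[OF assms(1)] by (simp add: vimage_def Int_def)
qed

lemma open_image': "c \<in> \<A> \<Longrightarrow> open U \<Longrightarrow> U \<subseteq> fst c \<Longrightarrow> open (snd c ` U)"
  using open_image[of c U] by (simp add: Int_absorb1)

lemma open_chart_preimage:
  assumes "c \<in> \<A>" "open V" shows "open {p \<in> fst c. snd c p \<in> V}"
proof -
  have "continuous_on (fst c) (snd c)"
    using chart_homeomorphism[OF assms(1)] by (simp add: homeomorphism_def)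
  from continuous_open_preimage[OF this open_domain[OF assms(1)] assms(2)]
  show ?thesis by (simp add: vimage_def Int_def)
qed

lemma chart_at [simp]: "chart_at \<A> p \<in> \<A>" "p \<in> fst (chart_at \<A> p)"
proof -
  have "(\<Union>c\<in>\<A>. fst c) = UNIV"
    using \<A> unfolding smooth_structure_def by (elim conjE)
  then have "\<exists>c. c \<in> \<A> \<and> p \<in> fst c" by blast
  from someI_ex[OF this] show "chart_at \<A> p \<in> \<A>" "p \<in> fst (chart_at \<A> p)"
    unfolding chart_at_def by (rule conjunct1, rule conjunct2)
qed

lemma transition_smooth:
  "c \<in> \<A> \<Longrightarrow> d \<in> \<A> \<Longrightarrow> smooth_on (snd c ` (fst c \<inter> fst d)) (snd d \<circ> cinv c)"
  using \<A> by (auto simp: smooth_structure_def compatible_def)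

lemma chart_deriv:
  assumes "c \<in> \<A>" "d \<in> \<A>" "p \<in> fst c" "p \<in> fst d"
  shows "((snd d \<circ> cinv c) has_derivative chart_deriv c d p) (at (snd c p))"
  unfolding chart_deriv_def using assms by (intro smooth_on_has_derivative[OF transition_smooth]) auto

lemma chart_deriv_linear:
  "c \<in> \<A> \<Longrightarrow> d \<in> \<A> \<Longrightarrow> p \<in> fst c \<Longrightarrow> p \<in> fst d \<Longrightarrow> linear (chart_deriv c d p)"
  using chart_deriv has_derivative_linear by blast

lemma chart_deriv_compose:
  assumes "c \<in> \<A>" "d \<in> \<A>" "e \<in> \<A>" "p \<in> fst c" "p \<in> fst d" "p \<in> fst e"
  shows "chart_deriv d e p (chart_deriv c d p v) = chart_deriv c e p v"
proof -
  have "((\<lambda>x. (snd e \<circ> cinv d) ((snd d \<circ> cinv c) x)) has_derivative (\<lambda>v. chart_deriv d e p (chart_deriv c d p v))) (at (snd c p))"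
    using chart_deriv[of d e p] assms by (intro has_derivative_compose[OF chart_deriv]) (auto simp: o_def)
  then have "((snd e \<circ> cinv c) has_derivative (\<lambda>v. chart_deriv d e p (chart_deriv c d p v))) (at (snd c p))"
    by (rule has_derivative_transform_within_open[OF _ open_image[OF assms(1) open_domain[OF assms(2)]]])
       (use assms in auto)
  from has_derivative_unique[OF this chart_deriv[OF assms(1,3,4,6)]] show ?thesis by metis
qed

lemma chart_deriv_self [simp]:
  assumes "c \<in> \<A>" "p \<in> fst c" shows "chart_deriv c c p v = v"
proof -
  have "((snd c \<circ> cinv c) has_derivative (\<lambda>v. v)) (at (snd c p))"
    by (rule has_derivative_transform_within_open[OF has_derivative_ident open_range[OF assms(1)]])
       (use assms in auto)
  from has_derivative_unique[OF this chart_deriv[OF assms(1,1,2,2)]] show ?thesis by metis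
qed

lemma vec_coords_eq: "vec_coords \<A> c p = chart_deriv (chart_at \<A> p) c p"
  by (simp add: vec_coords_def chart_deriv_def)

lemma coord_vec_eq: "coord_vec \<A> c p a = chart_deriv c (chart_at \<A> p) p (axis a 1)"
  by (simp add: coord_vec_def chart_deriv_def)

lemma vec_coords_linear: "c \<in> \<A> \<Longrightarrow> p \<in> fst c \<Longrightarrow> linear (vec_coords \<A> c p)"
  unfolding vec_coords_eq by (intro chart_deriv_linear) auto

lemma vec_coords_chart_deriv [simp]:
  "c \<in> \<A> \<Longrightarrow> p \<in> fst c \<Longrightarrow> vec_coords \<A> c p (chart_deriv c (chart_at \<A> p) p v) = v"
  unfolding vec_coords_eq by (subst chart_deriv_compose) auto

lemma chart_deriv_vec_coords [simp]:
  "c \<in> \<A> \<Longrightarrow> p \<in> fst c \<Longrightarrow> chart_deriv c (chart_at \<A> p) p (vec_coords \<A> c p v) = v"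
  unfolding vec_coords_eq by (subst chart_deriv_compose) auto

lemma vec_coords_inject [simp]:
  "c \<in> \<A> \<Longrightarrow> p \<in> fst c \<Longrightarrow> vec_coords \<A> c p v = vec_coords \<A> c p w \<longleftrightarrow> v = w"
  by (metis chart_deriv_vec_coords)

lemma vec_coords_change:
  "c \<in> \<A> \<Longrightarrow> d \<in> \<A> \<Longrightarrow> p \<in> fst c \<Longrightarrow> p \<in> fst d \<Longrightarrow> vec_coords \<A> d p v = chart_deriv c d p (vec_coords \<A> c p v)"
  unfolding vec_coords_eq by (subst chart_deriv_compose) auto

lemma field_coords [simp]:
  "c \<in> \<A> \<Longrightarrow> q \<in> fst c \<Longrightarrow> field_coords \<A> c X (snd c q) = vec_coords \<A> c q (X q)"
  by (simp add: field_coords_def)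

lemma field_coords_change:
  assumes "c \<in> \<A>" "d \<in> \<A>" "y \<in> snd d ` (fst d \<inter> fst c)"
  shows "field_coords \<A> d X y = frechet_derivative (snd d \<circ> cinv c) (at ((snd c \<circ> cinv d) y)) (field_coords \<A> c X ((snd c \<circ> cinv d) y))"
  using assms by (auto simp: vec_coords_change[of c d] chart_deriv_def)

lemma smooth_on_transition:
  assumes "c \<in> \<A>" "d \<in> \<A>" "open U" "U \<subseteq> fst c" "smooth_on (snd c ` U) f"
  shows "smooth_on (snd d ` (fst d \<inter> U)) (\<lambda>y. f ((snd c \<circ> cinv d) y))"
proof (rule smooth_on_compose)
  show "open (snd d ` (fst d \<inter> U))" "open (snd c ` U)"
    using assms by (auto intro: open_image open_image')
  show "smooth_on (snd d ` (fst d \<inter> U)) (\<lambda>y. (snd c \<circ> cinv d) y)"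
    using assms by (intro smooth_on_subset[OF transition_smooth]) auto
qed (use assms in auto)

lemma smooth_fun_chart:
  assumes "c \<in> \<A>" "open U" "U \<subseteq> fst c" "smooth_on (snd c ` U) (f \<circ> cinv c)"
  shows "smooth_fun \<A> U f"
  unfolding smooth_fun_def
proof
  fix d assume d: "d \<in> \<A>"
  have "smooth_on (snd d ` (fst d \<inter> U)) (\<lambda>y. (f \<circ> cinv c) ((snd c \<circ> cinv d) y))"
    by (rule smooth_on_transition[OF assms(1) d assms(2-4)])
  also have "?this \<longleftrightarrow> smooth_on (snd d ` (fst d \<inter> U)) (f \<circ> cinv d)"
    using assms d by (intro smooth_on_cong open_image) auto
  finally show "smooth_on (snd d ` (fst d \<inter> U)) (f \<circ> cinv d)" .
qed

text \<open>One chart covering \<open>U\<close> suffices: in any other chart the components arise by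
  applying the derivative of the transition map, which is smooth.\<close>

lemma smooth_field_chart:
  assumes "c \<in> \<A>" "open U" "U \<subseteq> fst c" "smooth_on (snd c ` U) (field_coords \<A> c X)"
  shows "smooth_field \<A> U X"
  unfolding smooth_field_def
proof
  fix d assume d: "d \<in> \<A>"
  let ?U = "fst d \<inter> U"
  have U: "open ?U" "?U \<subseteq> fst c" using assms d by (auto intro: open_Int open_domain)
  let ?f = "\<lambda>x. frechet_derivative (snd d \<circ> cinv c) (at x) (field_coords \<A> c X x)"
  have "smooth_on (snd c ` ?U) ?f"
    using assms d U by (intro smooth_intros open_image' smooth_on_subset[OF transition_smooth] smooth_on_subset[OF assms(4)]) auto
  from smooth_on_transition[OF assms(1) d U this]
  have "smooth_on (snd d ` ?U) (\<lambda>y. ?f ((snd c \<circ> cinv d) y))" by simp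
  also have "?this \<longleftrightarrow> smooth_on (snd d ` ?U) (field_coords \<A> d X)"
    using assms d by (intro smooth_on_cong open_image field_coords_change[symmetric]) auto
  finally show "smooth_on (snd d ` ?U) (field_coords \<A> d X)" .
qed

lemma smooth_field_coords: "smooth_field \<A> U X \<Longrightarrow> c \<in> \<A> \<Longrightarrow> smooth_on (snd c ` (fst c \<inter> U)) (field_coords \<A> c X)"
  by (simp add: smooth_field_def)

lemma smooth_fun_coords: "smooth_fun \<A> U f \<Longrightarrow> c \<in> \<A> \<Longrightarrow> smooth_on (snd c ` (fst c \<inter> U)) (f \<circ> cinv c)"
  by (simp add: smooth_fun_def)

lemma smooth_field_subset: "smooth_field \<A> U X \<Longrightarrow> V \<subseteq> U \<Longrightarrow> smooth_field \<A> V X"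
  unfolding smooth_field_def by (meson Int_mono image_mono order_refl smooth_on_subset)

lemma smooth_fun_subset: "smooth_fun \<A> U X \<Longrightarrow> V \<subseteq> U \<Longrightarrow> smooth_fun \<A> V X"
  unfolding smooth_fun_def by (meson Int_mono image_mono order_refl smooth_on_subset)

lemma smooth_fun_local:
  assumes "\<And>p. p \<in> U \<Longrightarrow> \<exists>V. open V \<and> p \<in> V \<and> smooth_fun \<A> V f"
  shows "smooth_fun \<A> U f"
  unfolding smooth_fun_def
proof (intro ballI smooth_on_local)
  fix c x assume c: "c \<in> \<A>" and "x \<in> snd c ` (fst c \<inter> U)"
  then obtain p where p: "p \<in> fst c" "p \<in> U" "x = snd c p" by auto
  obtain V where "open V" "p \<in> V" "smooth_fun \<A> V f" using assms[OF p(2)] by auto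
  with c p show "\<exists>T. open T \<and> x \<in> T \<and> smooth_on T (f \<circ> cinv c)"
    by (intro exI[of _ "snd c ` (fst c \<inter> V)"]) (auto intro: open_image smooth_fun_coords)
qed

lemma smooth_fun_cong:
  assumes "open U" "\<And>p. p \<in> U \<Longrightarrow> f p = h p" shows "smooth_fun \<A> U f \<longleftrightarrow> smooth_fun \<A> U h"
proof -
  have "smooth_on (snd c ` (fst c \<inter> U)) (f \<circ> cinv c) \<longleftrightarrow> smooth_on (snd c ` (fst c \<inter> U)) (h \<circ> cinv c)" if "c \<in> \<A>" for c
    using assms that by (intro smooth_on_cong open_image) auto
  then show ?thesis by (simp add: smooth_fun_def)
qed

lemma field_coords_lift_field:
  "c \<in> \<A> \<Longrightarrow> q \<in> fst c \<Longrightarrow> vec_coords \<A> c q (lift_field \<A> c X q) = X (snd c q)"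
  by (simp add: lift_field_def)

lemma smooth_lift_field:
  assumes "c \<in> \<A>" "open U" "U \<subseteq> fst c" "smooth_on (snd c ` U) X"
  shows "smooth_field \<A> U (lift_field \<A> c X)"
proof (rule smooth_field_chart[OF assms(1-3)])
  have "smooth_on (snd c ` U) (field_coords \<A> c (lift_field \<A> c X)) \<longleftrightarrow> smooth_on (snd c ` U) X"
    using assms by (intro smooth_on_cong open_image') (auto simp: field_coords_lift_field subset_iff)
  then show "smooth_on (snd c ` U) (field_coords \<A> c (lift_field \<A> c X))" using assms by simp
qed

lemma deriv_along_chart:
  assumes c: "c \<in> \<A>" "p \<in> fst c" and D: "((f \<circ> cinv c) has_derivative D) (at (snd c p))"
  shows "deriv_along \<A> X f p = D (vec_coords \<A> c p (X p))"
proof -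
  let ?c = "chart_at \<A> p"
  have 1: "((\<lambda>y. (f \<circ> cinv c) ((snd c \<circ> cinv ?c) y)) has_derivative (\<lambda>v. D (chart_deriv ?c c p v))) (at (snd ?c p))"
    using D c by (intro has_derivative_compose[OF chart_deriv]) (auto simp: o_def)
  have "((f \<circ> cinv ?c) has_derivative (\<lambda>v. D (chart_deriv ?c c p v))) (at (snd ?c p))"
    by (rule has_derivative_transform_within_open[OF 1 open_image[OF chart_at(1) open_domain[OF c(1)]]])
       (use c in auto)
  from frechet_derivative_at[OF this, symmetric] show ?thesis
    by (simp add: deriv_along_def vec_coords_eq)
qed

text \<open>Differentiating components transformed by the derivative of the transition map produces
  a second-derivative term; it is symmetric in the two fields and cancels in the commutator.\<close>

lemma bracket_chart:
  assumes c: "c \<in> \<A>" "p \<in> fst c" and U: "open U" "p \<in> U" and XY: "smooth_field \<A> U X" "smooth_field \<A> U Y"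
  shows "vec_coords \<A> c p (bracket \<A> X Y p) = brac (field_coords \<A> c X) (field_coords \<A> c Y) (snd c p)"
proof -
  let ?b = "chart_at \<A> p"
  let ?T = "snd c \<circ> cinv ?b" and ?x = "snd ?b p"
  let ?V = "snd ?b ` (fst ?b \<inter> (fst c \<inter> U))"
  have V: "open ?V" using U c by (intro open_image open_Int open_domain) auto
  have x: "?x \<in> ?V" using c U by auto
  have T: "smooth_on ?V ?T"
    by (rule smooth_on_subset[OF transition_smooth[OF chart_at(1) c(1)]]) auto
  have lin: "linear (chart_deriv ?b c p)" using c by (intro chart_deriv_linear) auto
  have *: "frechet_derivative (field_coords \<A> c Z) (at (snd c p)) (vec_coords \<A> c p v)
      = frechet_derivative (\<lambda>y. frechet_derivative ?T (at y) (Z p)) (at ?x) v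
        + chart_deriv ?b c p (frechet_derivative (field_coords \<A> ?b Z) (at ?x) v)"
    if Z: "smooth_field \<A> U Z" for Z v
  proof -
    have dZ: "(field_coords \<A> c Z has_derivative frechet_derivative (field_coords \<A> c Z) (at (snd c p))) (at (snd c p))"
      using c U by (intro smooth_on_has_derivative[OF smooth_field_coords[OF Z c(1)]]) auto
    have dZ': "(field_coords \<A> ?b Z has_derivative frechet_derivative (field_coords \<A> ?b Z) (at ?x)) (at ?x)"
      using c U by (intro smooth_on_has_derivative[OF smooth_field_coords[OF Z chart_at(1)]]) auto
    have Zx: "field_coords \<A> ?b Z ?x = Z p" by (simp add: vec_coords_eq)
    have 1: "((\<lambda>y. field_coords \<A> c Z (?T y)) has_derivative
        (\<lambda>v. frechet_derivative (field_coords \<A> c Z) (at (snd c p)) (chart_deriv ?b c p v))) (at ?x)"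
      using dZ c by (intro has_derivative_compose[OF chart_deriv]) (auto simp: o_def)
    have 2: "((\<lambda>y. frechet_derivative ?T (at y) (field_coords \<A> ?b Z y)) has_derivative
        (\<lambda>u. frechet_derivative (\<lambda>y. frechet_derivative ?T (at y) (field_coords \<A> ?b Z ?x)) (at ?x) u
          + frechet_derivative ?T (at ?x) (frechet_derivative (field_coords \<A> ?b Z) (at ?x) u))) (at ?x)"
      by (rule has_derivative_derivative_along[OF V T x dZ'])
    have "((\<lambda>y. frechet_derivative ?T (at y) (field_coords \<A> ?b Z y)) has_derivative
        (\<lambda>v. frechet_derivative (field_coords \<A> c Z) (at (snd c p)) (chart_deriv ?b c p v))) (at ?x)"
      by (rule has_derivative_transform_within_open[OF 1 V x])
         (use c in \<open>auto simp: vec_coords_change[of "chart_at \<A> p" c] chart_deriv_def\<close>)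
    from has_derivative_unique[OF this 2, THEN fun_cong, of v] show ?thesis
      unfolding Zx by (simp add: vec_coords_eq chart_deriv_def)
  qed
  have "vec_coords \<A> c p (bracket \<A> X Y p) =
     chart_deriv ?b c p (frechet_derivative (field_coords \<A> ?b Y) (at ?x) (X p)) -
     chart_deriv ?b c p (frechet_derivative (field_coords \<A> ?b X) (at ?x) (Y p))"
    by (simp add: bracket_def Let_def vec_coords_eq linear_diff[OF lin])
  also have "\<dots> = brac (field_coords \<A> c X) (field_coords \<A> c Y) (snd c p)"
    using *[OF XY(1), of "Y p"] *[OF XY(2), of "X p"] second_derivative_symmetric[OF V T x, of "X p" "Y p"] c
    by (simp add: brac_def)
  finally show ?thesis .
qed

lemma smooth_field_bracket:
  assumes "open U" "smooth_field \<A> U X" "smooth_field \<A> U Y"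
  shows "smooth_field \<A> U (bracket \<A> X Y)"
  unfolding smooth_field_def
proof
  fix c assume c: "c \<in> \<A>"
  have "smooth_on (snd c ` (fst c \<inter> U)) (brac (field_coords \<A> c X) (field_coords \<A> c Y))"
    using assms c by (intro smooth_on_brac open_image smooth_field_coords)
  also have "?this \<longleftrightarrow> smooth_on (snd c ` (fst c \<inter> U)) (field_coords \<A> c (bracket \<A> X Y))"
    using assms c by (intro smooth_on_cong open_image) (auto simp: bracket_chart)
  finally show "smooth_on (snd c ` (fst c \<inter> U)) (field_coords \<A> c (bracket \<A> X Y))" .
qed

end

section \<open>The metric in charts\<close>

lemma frechet_derivative_cong_open:
  assumes "open V" "x \<in> V" "\<And>y. y \<in> V \<Longrightarrow> f y = h y"
  shows "frechet_derivative f (at x) = frechet_derivative h (at x)"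
proof -
  have "(f has_derivative D) (at x) \<longleftrightarrow> (h has_derivative D) (at x)" for D
    using has_derivative_transform_within_open[of f D x UNIV V h] has_derivative_transform_within_open[of h D x UNIV V f] assms
    by auto
  then show ?thesis by (simp add: frechet_derivative_def)
qed

lemma bilinear_eq_met:
  fixes B :: "real^'n \<Rightarrow> real^'n \<Rightarrow> real"
  assumes "bilinear B" "\<And>a b. M $ a $ b = B (axis a 1) (axis b 1)"
  shows "B v w = v \<bullet> (M *v w)"
proof -
  have r: "linear (B v)" for v using assms(1) by (simp add: bilinear_def)
  have l: "linear (\<lambda>v. B v w)" for w using assms(1) by (simp add: bilinear_def)
  have ex: "(\<Sum>a\<in>UNIV. u $ a *\<^sub>R axis a 1) = u" for u :: "real^'n"
    using basis_expansion[of u] by (simp add: scalar_mult_eq_scaleR)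
  have "B v w = B (\<Sum>a\<in>UNIV. v $ a *\<^sub>R axis a 1) w" by (simp only: ex)
  also have "\<dots> = (\<Sum>a\<in>UNIV. v $ a * B (axis a 1) w)"
    by (simp add: linear_sum[OF l] linear_scale[OF l])
  also have "\<dots> = (\<Sum>a\<in>UNIV. v $ a * B (axis a 1) (\<Sum>b\<in>UNIV. w $ b *\<^sub>R axis b 1))" by (simp only: ex)
  also have "\<dots> = v \<bullet> (M *v w)"
    by (simp add: linear_sum[OF r] linear_scale[OF r] inner_vec_def matrix_vector_mult_def assms(2) mult.commute)
  finally show ?thesis .
qed

locale manifold_metric = smooth_manifold \<A> for \<A> :: "('a::{t2_space,second_countable_topology}, 'n::finite) chart set" +
  fixes g :: "('a, 'n) metric"
  assumes g: "smooth_symmetric_tensor \<A> g"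
begin

abbreviation GG :: "('a, 'n) chart \<Rightarrow> real^'n \<Rightarrow> real^'n^'n" where
  "GG c \<equiv> coord_matrix \<A> g c"

lemma met_chart:
  assumes "c \<in> \<A>" "p \<in> fst c"
  shows "g p v w = met (GG c) (snd c p) (vec_coords \<A> c p v) (vec_coords \<A> c p w)"
proof -
  let ?J = "chart_deriv c (chart_at \<A> p) p"
  have lin: "linear ?J" using assms by (intro chart_deriv_linear) auto
  have "bilinear (g p)" using g by (simp add: smooth_symmetric_tensor_def)
  then have "bilinear (\<lambda>v w. g p (?J v) (?J w))"
    unfolding bilinear_def using linear_compose[OF lin, unfolded o_def] by blast
  from bilinear_eq_met[OF this, of "GG c (snd c p)" "vec_coords \<A> c p v" "vec_coords \<A> c p w"]
  show ?thesis using assms by (simp add: met_def coord_matrix_def coord_vec_eq)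
qed

lemma local_metric_chart: "c \<in> \<A> \<Longrightarrow> local_metric (snd c ` fst c) (GG c)"
  using g by unfold_locales (auto intro: open_range simp: smooth_symmetric_tensor_def coord_matrix_def)

lemma kernel_chart:
  assumes "c \<in> \<A>" "p \<in> fst c"
  shows "v \<in> Rad g p \<longleftrightarrow> GG c (snd c p) *v vec_coords \<A> c p v = 0"
proof -
  interpret local_metric "snd c ` fst c" "GG c" by (rule local_metric_chart[OF assms(1)])
  let ?M = "GG c (snd c p)" and ?v = "vec_coords \<A> c p v"
  have xS: "snd c p \<in> snd c ` fst c" using assms by simp
  have e: "g p v w = vec_coords \<A> c p w \<bullet> (?M *v ?v)" for w
    unfolding met_chart[OF assms] met_commute[OF xS, of ?v] by (simp only: met_def)
  show ?thesis
  proof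
    assume "v \<in> Rad g p"
    then have "g p v (chart_deriv c (chart_at \<A> p) p (?M *v ?v)) = 0" by (simp add: Rad_def)
    then show "?M *v ?v = 0" unfolding e vec_coords_chart_deriv[OF assms] by simp
  qed (simp add: Rad_def e)
qed

lemma sing_iff_Rad: "p \<in> sing g \<longleftrightarrow> (\<exists>v\<in>Rad g p. v \<noteq> 0)"
proof -
  define M where "M = (\<chi> i j. g p (axis i 1) (axis j 1) :: real^'n^'n)"
  have b: "bilinear (g p)" "\<And>v w. g p v w = g p w v" using g by (auto simp: smooth_symmetric_tensor_def)
  have e: "g p v w = w \<bullet> (M *v v)" for v w
    using bilinear_eq_met[OF b(1), of M w v] b(2)[of w v] by (simp add: M_def)
  have "v \<in> Rad g p \<longleftrightarrow> M *v v = 0" for v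
    unfolding Rad_def e mem_Collect_eq by (metis inner_eq_zero_iff inner_zero_right)
  moreover have "p \<in> sing g \<longleftrightarrow> det M = 0"
    unfolding det_eq_0_rank sing_def M_def by simp
  ultimately show ?thesis unfolding det_eq_0_iff_kernel by blast
qed

lemma sing_chart:
  assumes "c \<in> \<A>" "p \<in> fst c"
  shows "p \<in> sing g \<longleftrightarrow> det (GG c (snd c p)) = 0"
proof -
  have z: "vec_coords \<A> c p v = 0 \<longleftrightarrow> v = 0" for v
    using vec_coords_inject[OF assms, of v 0] linear_0[OF vec_coords_linear[OF assms]] by simp
  show ?thesis
    unfolding sing_iff_Rad det_eq_0_iff_kernel Bex_def kernel_chart[OF assms]
    using z vec_coords_chart_deriv[OF assms] by metis
qed

lemma open_compl_sing: "open (- sing g)"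
proof (subst open_subopen, rule ballI)
  fix p assume p: "p \<in> - sing g"
  let ?c = "chart_at \<A> p"
  interpret local_metric "snd ?c ` fst ?c" "GG ?c" by (rule local_metric_chart) simp
  have "continuous_on (snd ?c ` fst ?c) (\<lambda>x. det (GG ?c x))"
    by (intro smooth_on_imp_continuous_on smooth_on_det_G S order_refl)
  from continuous_open_preimage[OF this S, of "- {0}"]
  have "open {x \<in> snd ?c ` fst ?c. det (GG ?c x) \<noteq> 0}" by (auto simp: vimage_def Int_def open_Compl)
  from open_chart_preimage[OF _ this, of ?c]
  have "open {q \<in> fst ?c. det (GG ?c (snd ?c q)) \<noteq> 0}" by (rule back_subst[where P = "open"]) auto
  moreover have "p \<in> {q \<in> fst ?c. det (GG ?c (snd ?c q)) \<noteq> 0}" using p sing_chart[of ?c p] by auto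
  moreover have "{q \<in> fst ?c. det (GG ?c (snd ?c q)) \<noteq> 0} \<subseteq> - sing g" using sing_chart[of ?c] by auto
  ultimately show "\<exists>T. open T \<and> p \<in> T \<and> T \<subseteq> - sing g" by blast
qed

text \<open>In the Koszul formula the derivatives of \<open>X\<close> and \<open>Z\<close> cancel
  and only that of \<open>Y\<close> along \<open>X\<close> survives. This is what makes II and \<H>
  independent of extensions.\<close>

lemma dual_conn_chart:
  assumes c: "c \<in> \<A>" "p \<in> fst c" and U: "open U" "p \<in> U"
    and XYZ: "smooth_field \<A> U X" "smooth_field \<A> U Y" "smooth_field \<A> U Z"
  shows "dual_conn \<A> g X Y Z p =
    met (GG c) (snd c p) (frechet_derivative (field_coords \<A> c Y) (at (snd c p)) (vec_coords \<A> c p (X p))) (vec_coords \<A> c p (Z p))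
    + Gam (GG c) (snd c p) (vec_coords \<A> c p (X p)) (vec_coords \<A> c p (Y p)) (vec_coords \<A> c p (Z p))"
proof -
  interpret local_metric "snd c ` fst c" "GG c" by (rule local_metric_chart[OF c(1)])
  let ?x = "snd c p"
  have xS: "?x \<in> snd c ` fst c" using c by auto
  have V: "open (snd c ` (fst c \<inter> U))" and xV: "?x \<in> snd c ` (fst c \<inter> U)" using c U by (auto intro: open_image)
  have fd: "(field_coords \<A> c A has_derivative frechet_derivative (field_coords \<A> c A) (at ?x)) (at ?x)"
    if "smooth_field \<A> U A" for A
    using smooth_on_has_derivative[OF smooth_field_coords[OF that c(1)] xV] .
  have d: "deriv_along \<A> A (\<lambda>q. g q (B q) (C q)) p =
     dmet (GG c) ?x (vec_coords \<A> c p (A p)) (vec_coords \<A> c p (B p)) (vec_coords \<A> c p (C p))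
     + met (GG c) ?x (frechet_derivative (field_coords \<A> c B) (at ?x) (vec_coords \<A> c p (A p))) (vec_coords \<A> c p (C p))
     + met (GG c) ?x (vec_coords \<A> c p (B p)) (frechet_derivative (field_coords \<A> c C) (at ?x) (vec_coords \<A> c p (A p)))"
    if "smooth_field \<A> U B" "smooth_field \<A> U C" for A B C
  proof -
    have "((\<lambda>q. g q (B q) (C q)) \<circ> cinv c has_derivative
        (\<lambda>h. dmet (GG c) ?x h (field_coords \<A> c B ?x) (field_coords \<A> c C ?x)
          + met (GG c) ?x (frechet_derivative (field_coords \<A> c B) (at ?x) h) (field_coords \<A> c C ?x)
          + met (GG c) ?x (field_coords \<A> c B ?x) (frechet_derivative (field_coords \<A> c C) (at ?x) h))) (at ?x)"
      by (rule has_derivative_transform_within_open[OF met_has_derivative[OF xS fd[OF that(1)] fd[OF that(2)]] V xV])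
         (use c in \<open>auto simp: met_chart\<close>)
    from deriv_along_chart[OF c this] show ?thesis using c by simp
  qed
  have b: "g p (bracket \<A> A B p) v = met (GG c) ?x
      (frechet_derivative (field_coords \<A> c B) (at ?x) (vec_coords \<A> c p (A p)) -
       frechet_derivative (field_coords \<A> c A) (at ?x) (vec_coords \<A> c p (B p))) (vec_coords \<A> c p v)"
    if "smooth_field \<A> U A" "smooth_field \<A> U B" for A B v
    using bracket_chart[OF c U that] c by (simp add: met_chart[OF c] brac_def)
  have mc: "met (GG c) ?x v w = met (GG c) ?x w v" for v w by (rule met_commute[OF xS])
  have dc: "dmet (GG c) ?x u v w = dmet (GG c) ?x u w v" for u v w by (rule dmet_commute[OF xS])
  show ?thesis
    unfolding dual_conn_def d[OF XYZ(2,3)] d[OF XYZ(3,1)] d[OF XYZ(1,2)] b[OF XYZ(1,2)] b[OF XYZ(2,3)] b[OF XYZ(3,1)]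
      Gam_def met_linear
    using mc[of "vec_coords \<A> c p (Y p)"] mc[of "vec_coords \<A> c p (X p)"] mc[of "vec_coords \<A> c p (Z p)"]
      dc[of "vec_coords \<A> c p (Y p)" "vec_coords \<A> c p (Z p)" "vec_coords \<A> c p (X p)"]
    by (simp add: field_simps)
qed

lemma smooth_constant_field:
  assumes "c \<in> \<A>" shows "smooth_field \<A> (fst c) (lift_field \<A> c (\<lambda>x. v))"
  by (intro smooth_lift_field smooth_on_const open_range open_domain assms order_refl)

lemma field_with_value:
  assumes "c \<in> \<A>" "p \<in> fst c"
  obtains Z where "smooth_field \<A> (fst c) Z" "Z p = v"
  using that[OF smooth_constant_field[OF assms(1), of "vec_coords \<A> c p v"]] assms by (simp add: lift_field_def)

text \<open>Off the hypersurface nondegeneracy makes the vector in the definite description unique,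
  since test fields take arbitrary values at \<open>p\<close>.\<close>

lemma nabla_chart:
  assumes c: "c \<in> \<A>" "p \<in> fst c" and U: "open U" "p \<in> U" and p: "p \<notin> sing g"
    and XY: "smooth_field \<A> U X" "smooth_field \<A> U Y"
  shows "vec_coords \<A> c p (nabla \<A> g X Y p) = nab (GG c) (field_coords \<A> c X) (field_coords \<A> c Y) (snd c p)"
proof -
  interpret local_metric "snd c ` fst c" "GG c" by (rule local_metric_chart[OF c(1)])
  let ?x = "snd c p"
  have xS: "?x \<in> snd c ` fst c" using c by auto
  let ?n = "nab (GG c) (field_coords \<A> c X) (field_coords \<A> c Y) ?x"
  define v where "v = chart_deriv c (chart_at \<A> p) p ?n"
  have vc: "vec_coords \<A> c p v = ?n" using c by (simp add: v_def)
  have dual: "dual_conn \<A> g X Y Z p = g p v (Z p)" if "open W" "p \<in> W" "smooth_field \<A> W Z" for W Z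
  proof -
    have s: "smooth_field \<A> (U \<inter> W) X" "smooth_field \<A> (U \<inter> W) Y" "smooth_field \<A> (U \<inter> W) Z"
      using XY that smooth_field_subset by blast+
    have "dual_conn \<A> g X Y Z p = met (GG c) ?x ?n (vec_coords \<A> c p (Z p))"
      using p c U that sing_chart[OF c] xS by (subst dual_conn_chart[OF c _ _ s]) (auto simp: met_nab)
    then show ?thesis by (simp add: met_chart[OF c] vc)
  qed
  have "nabla \<A> g X Y p = v"
    unfolding nabla_def
  proof (rule the_equality)
    show "\<forall>W Z. open W \<and> p \<in> W \<and> smooth_field \<A> W Z \<longrightarrow> g p v (Z p) = dual_conn \<A> g X Y Z p"
      using dual[symmetric] by blast
  next
    fix u assume u: "\<forall>W Z. open W \<and> p \<in> W \<and> smooth_field \<A> W Z \<longrightarrow> g p u (Z p) = dual_conn \<A> g X Y Z p"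
    have "g p u w = g p v w" for w
    proof -
      obtain Z where "smooth_field \<A> (fst c) Z" "Z p = w" using field_with_value[OF c] .
      with u dual c open_domain[OF c(1)] show ?thesis by metis
    qed
    then have "g p (u - v) w = 0" for w
      unfolding met_chart[OF c] linear_diff[OF vec_coords_linear[OF c]] by (simp add: met_linear)
    then have "u - v \<in> Rad g p" by (simp add: Rad_def)
    with p show "u = v" unfolding sing_iff_Rad by auto
  qed
  then show ?thesis using vc by simp
qed

lemma smooth_field_nabla:
  assumes "open U" "smooth_field \<A> U X" "smooth_field \<A> U Y"
  shows "smooth_field \<A> (U - sing g) (nabla \<A> g X Y)"
  unfolding smooth_field_def
proof
  fix c assume c: "c \<in> \<A>"
  interpret local_metric "snd c ` fst c" "GG c" by (rule local_metric_chart[OF c])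
  let ?V = "snd c ` (fst c \<inter> (U - sing g))"
  have U: "open (U - sing g)" using assms(1) open_compl_sing by (simp add: Diff_eq open_Int)
  have V: "open ?V" by (intro open_image c U)
  have "smooth_on ?V (nab (GG c) (field_coords \<A> c X) (field_coords \<A> c Y))"
    using assms c V smooth_field_subset[of U _ "U - sing g"] sing_chart[OF c]
    by (intro smooth_on_nab smooth_field_coords) auto
  also have "?this \<longleftrightarrow> smooth_on ?V (field_coords \<A> c (nabla \<A> g X Y))"
    using assms c V by (intro smooth_on_cong) (auto simp: nabla_chart)
  finally show "smooth_on ?V (field_coords \<A> c (nabla \<A> g X Y))" .
qed

lemma riem_chart:
  assumes c: "c \<in> \<A>" "p \<in> fst c" and U: "open U" "p \<in> U" and p: "p \<notin> sing g"
    and XYZ: "smooth_field \<A> U X" "smooth_field \<A> U Y" "smooth_field \<A> U Z"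
  shows "g p (riem \<A> g X Y Z p) w = Rm (GG c) (snd c p) (vec_coords \<A> c p (X p)) (vec_coords \<A> c p (Y p))
     (vec_coords \<A> c p (Z p)) (vec_coords \<A> c p w)"
proof -
  interpret local_metric "snd c ` fst c" "GG c" by (rule local_metric_chart[OF c(1)])
  let ?U = "U - sing g"
  have U': "open ?U" "p \<in> ?U" using U open_compl_sing p by (simp_all add: Diff_eq open_Int)
  have s: "smooth_field \<A> ?U X" "smooth_field \<A> ?U Y" "smooth_field \<A> ?U Z"
    using XYZ smooth_field_subset by blast+
  let ?V = "snd c ` (fst c \<inter> ?U)" and ?x = "snd c p"
  let ?X = "field_coords \<A> c X" and ?Y = "field_coords \<A> c Y" and ?Z = "field_coords \<A> c Z"
  have V: "open ?V" "?x \<in> ?V" "?V \<subseteq> snd c ` fst c" using U' c by (auto intro: open_image)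
  have n2: "vec_coords \<A> c p (nabla \<A> g A (nabla \<A> g B C) p) = nab (GG c) (field_coords \<A> c A) (nab (GG c) (field_coords \<A> c B) (field_coords \<A> c C)) ?x"
    if "smooth_field \<A> U A" "smooth_field \<A> U B" "smooth_field \<A> U C" for A B C
  proof -
    \<comment> \<open>The chart formula for the inner derivative holds on an open set off
      \<open>sing g\<close>, so it may be differentiated once more.\<close>
    have eq: "field_coords \<A> c (nabla \<A> g B C) y = nab (GG c) (field_coords \<A> c B) (field_coords \<A> c C) y" if "y \<in> ?V" for y
      using that c U(1) \<open>smooth_field \<A> U B\<close> \<open>smooth_field \<A> U C\<close> by (auto simp: nabla_chart)
    have "vec_coords \<A> c p (nabla \<A> g A (nabla \<A> g B C) p) = nab (GG c) (field_coords \<A> c A) (field_coords \<A> c (nabla \<A> g B C)) ?x"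
      by (intro nabla_chart[OF c U' p] smooth_field_nabla U(1) that smooth_field_subset[OF that(1)] Diff_subset)
    also have "\<dots> = nab (GG c) (field_coords \<A> c A) (nab (GG c) (field_coords \<A> c B) (field_coords \<A> c C)) ?x"
      unfolding nab_def[of _ _ "field_coords \<A> c (nabla \<A> g B C)"] nab_def[of _ _ "nab (GG c) (field_coords \<A> c B) (field_coords \<A> c C)"]
      by (simp only: frechet_derivative_cong_open[OF V(1,2) eq] eq[OF V(2)])
    finally show ?thesis .
  qed
  have nb: "vec_coords \<A> c p (nabla \<A> g (bracket \<A> X Y) Z p) = nab (GG c) (brac ?X ?Y) ?Z ?x"
    using nabla_chart[OF c U p smooth_field_bracket[OF U(1) XYZ(1,2)] XYZ(3)] bracket_chart[OF c U XYZ(1,2)] c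
    by (simp add: nab_def)
  have "g p (riem \<A> g X Y Z p) w = met (GG c) ?x
      (nab (GG c) ?X (nab (GG c) ?Y ?Z) ?x - nab (GG c) ?Y (nab (GG c) ?X ?Z) ?x - nab (GG c) (brac ?X ?Y) ?Z ?x)
      (vec_coords \<A> c p w)"
    unfolding met_chart[OF c] riem_def linear_diff[OF vec_coords_linear[OF c]] n2[OF XYZ] n2[OF XYZ(2,1,3)] nb ..
  also have "\<dots> = Rm (GG c) ?x (?X ?x) (?Y ?x) (?Z ?x) (vec_coords \<A> c p w)"
    using c s sing_chart[OF c(1)] by (intro met_curvature[OF V(3,1) _ _ _ _ V(2)] smooth_field_coords) auto
  finally show ?thesis using c by simp
qed

end

section \<open>Charts flattening the singular hypersurface\<close>

context smooth_manifold
begin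

text \<open>A chart followed by a diffeomorphism is compatible with every member of the atlas, so
  maximality of the atlas admits it.\<close>

lemma chart_compose:
  assumes c: "c \<in> \<A>" and U: "open U" "U \<subseteq> snd c ` fst c" and V: "open V"
    and h: "homeomorphism U V \<Phi> \<Psi>" and s: "smooth_on U \<Phi>" "smooth_on V \<Psi>"
  defines "D \<equiv> {q \<in> fst c. snd c q \<in> U}"
  shows "(D, \<Phi> \<circ> snd c) \<in> \<A>"
proof -
  let ?c = "(D, \<Phi> \<circ> snd c)"
  have D: "open D" unfolding D_def by (rule open_chart_preimage[OF c U(1)])
  have imD: "snd c ` D = U" using U(2) by (auto simp: D_def)
  have DU: "homeomorphism D U (snd c) (cinv c)"
    by (rule homeomorphism_of_subsets[OF chart_homeomorphism[OF c]]) (use imD U in \<open>auto simp: D_def\<close>)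
  have comp: "homeomorphism D V (\<Phi> \<circ> snd c) (cinv c \<circ> \<Psi>)"
    by (rule homeomorphism_compose[OF DU h])
  then have im: "(\<Phi> \<circ> snd c) ` D = V" by (simp add: homeomorphism_def)
  have inj: "inj_on (\<Phi> \<circ> snd c) D"
    by (rule inj_on_inverseI) (rule homeomorphism_apply1[OF comp])
  have bk: "cinv c (\<Psi> y) \<in> D" "(\<Phi> \<circ> snd c) (cinv c (\<Psi> y)) = y" if "y \<in> V" for y
    using homeomorphism_image2[OF comp] homeomorphism_apply2[OF comp that] that by auto
  have inv: "cinv ?c y = cinv c (\<Psi> y)" if "y \<in> V" for y
    using inv_into_f_f[OF inj bk(1)[OF that]] unfolding bk(2)[OF that] cinv_def[of ?c] by simp
  have "homeomorphism D V (\<Phi> \<circ> snd c) (cinv ?c)"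
    by (rule homeomorphism_cong[OF comp]) (auto simp: inv)
  then have chart: "is_chart ?c" using D V im by (simp add: is_chart_def)
  have "compatible ?c d" if d: "d \<in> \<A>" for d
    unfolding compatible_def
  proof
    let ?W = "snd ?c ` (fst ?c \<inter> fst d)"
    have \<Psi>\<Phi>: "\<Psi> (\<Phi> (snd c q)) = snd c q" if "q \<in> D" for q
      using h that by (simp add: homeomorphism_def D_def)
    have WV: "?W \<subseteq> V" using im by auto
    have "continuous_on V (cinv ?c)"
      using chart im by (simp add: is_chart_def homeomorphism_def)
    from continuous_open_preimage[OF this V open_domain[OF d]]
    have "open (V \<inter> cinv ?c -` fst d)" .
    also have "V \<inter> cinv ?c -` fst d = ?W"
    proof (intro equalityI subsetI)
      fix y assume "y \<in> V \<inter> cinv ?c -` fst d"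
      then have y: "y \<in> V" "cinv ?c y \<in> fst d" by auto
      have "cinv c (\<Psi> y) \<in> fst ?c \<inter> fst d" "y = snd ?c (cinv c (\<Psi> y))"
        using bk[OF y(1)] y inv by simp_all
      then show "y \<in> ?W" by (rule rev_image_eqI)
    next
      fix y assume "y \<in> ?W"
      then obtain q where q: "q \<in> D" "q \<in> fst d" "y = \<Phi> (snd c q)" by auto
      then have "y \<in> V" "q \<in> fst c" using WV by (auto simp: D_def)
      then show "y \<in> V \<inter> cinv ?c -` fst d" using q \<Psi>\<Phi>[OF q(1)] c inv by simp
    qed
    finally have W: "open ?W" .
    have "smooth_on ?W (\<lambda>y. (snd d \<circ> cinv c) (\<Psi> y))"
      using c d W smooth_on_subset[OF s(2) WV] \<Psi>\<Phi>
      by (intro smooth_on_compose[OF W open_image[OF c open_domain[OF d]] transition_smooth]) (auto simp: D_def)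
    also have "?this \<longleftrightarrow> smooth_on ?W (snd d \<circ> cinv ?c)"
      using WV inv by (intro smooth_on_cong W) auto
    finally show "smooth_on ?W (snd d \<circ> cinv ?c)" .
    let ?X = "snd d ` (fst ?c \<inter> fst d)"
    have X: "open ?X" using open_image[OF d D] by (simp add: Int_commute)
    have "?X \<subseteq> snd d ` (fst d \<inter> fst c)" by (auto simp: D_def)
    from smooth_on_subset[OF transition_smooth[OF d c] this]
    have "smooth_on ?X (snd c \<circ> cinv d)" .
    moreover have "(snd c \<circ> cinv d) ` ?X \<subseteq> U" using d by (auto simp: D_def)
    ultimately have "smooth_on ?X (\<lambda>y. \<Phi> ((snd c \<circ> cinv d) y))"
      by (rule smooth_on_compose[OF X U(1) s(1)])
    also have "?this \<longleftrightarrow> smooth_on ?X (snd ?c \<circ> cinv d)"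
      by (intro smooth_on_cong X) auto
    finally show "smooth_on ?X (snd ?c \<circ> cinv d)" .
  qed
  moreover have "\<forall>c. is_chart c \<and> (\<forall>d\<in>\<A>. compatible c d) \<longrightarrow> c \<in> \<A>"
    using \<A> unfolding smooth_structure_def by (elim conjE)
  ultimately show ?thesis using chart by blast
qed

end

locale singular_metric = manifold_metric \<A> g
  for \<A> :: "('a::{t2_space,second_countable_topology}, 'n::finite) chart set" and g +
  assumes transverse: "transverse_singular \<A> g" and riemann_lorentz: "riemann_lorentz g"
    and tangent_radical: "tangent_radical \<A> g"
begin

definition adapted :: "('a, 'n) chart \<Rightarrow> 'n \<Rightarrow> bool" where
  "adapted c i \<longleftrightarrow> c \<in> \<A> \<and> (\<forall>q\<in>fst c. q \<in> sing g \<longleftrightarrow> snd c q $ i = 0)"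

text \<open>Transversality gives an axis along which the determinant of the metric in the chart at
  \<open>p\<close> has nonzero derivative; this determinant becomes the \<open>i\<close>-th
  coordinate of the new chart.\<close>

lemma adapted_chart_exists:
  assumes "p \<in> sing g"
  obtains c i where "adapted c i" "p \<in> fst c"
proof -
  let ?c = "chart_at \<A> p"
  interpret local_metric "snd ?c ` fst ?c" "GG ?c" by (rule local_metric_chart) simp
  let ?\<tau> = "\<lambda>x. det (GG ?c x)" and ?x = "snd ?c p"
  have sm: "smooth_on (snd ?c ` fst ?c) ?\<tau>" by (rule smooth_on_det_G[OF order_refl S])
  have xS: "?x \<in> snd ?c ` fst ?c" by simp
  have "p \<in> fst ?c \<inter> sing g" using assms by simp
  then have "frechet_derivative ?\<tau> (at ?x) \<noteq> (\<lambda>v. 0)"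
    using transverse chart_at(1) unfolding transverse_singular_def by blast
  moreover have "frechet_derivative ?\<tau> (at ?x) v = (\<Sum>b\<in>Basis. (v \<bullet> b) *\<^sub>R frechet_derivative ?\<tau> (at ?x) b)" for v
    by (rule derivative_eq_sum_Basis[OF smooth_on_differentiable[OF sm xS]])
  ultimately obtain b where "b \<in> Basis" "frechet_derivative ?\<tau> (at ?x) b \<noteq> 0"
    by (metis (no_types, lifting) ext scaleR_zero_right sum.neutral)
  then obtain i where i: "frechet_derivative ?\<tau> (at ?x) (axis i 1) \<noteq> 0"
    by (auto simp: Basis_vec_def)
  obtain U V \<Psi> where UV: "open U" "U \<subseteq> snd ?c ` fst ?c" "?x \<in> U" "open V"
    "homeomorphism U V (\<lambda>x. x + (?\<tau> x - x $ i) *\<^sub>R axis i 1) \<Psi>"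
    "smooth_on U (\<lambda>x. x + (?\<tau> x - x $ i) *\<^sub>R axis i 1)" "smooth_on V \<Psi>"
    using straightening_map[OF S sm xS i] by blast
  let ?d = "({q \<in> fst ?c. snd ?c q \<in> U}, (\<lambda>x. x + (?\<tau> x - x $ i) *\<^sub>R axis i 1) \<circ> snd ?c)"
  have "?d \<in> \<A>" by (rule chart_compose[OF chart_at(1) UV(1,2,4-7)])
  moreover have "q \<in> sing g \<longleftrightarrow> snd ?d q $ i = 0" if "q \<in> fst ?d" for q
    using that sing_chart[of ?c q] by auto
  moreover have "p \<in> fst ?d" using UV(3) by simp
  ultimately show ?thesis using that[of ?d i] unfolding adapted_def by blast
qed

text \<open>A curve in the hypersurface has vanishing \<open>i\<close>-th coordinate; conversely, a
  vector with vanishing \<open>i\<close>-th component is the velocity of a straight line of the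
  chart. Velocities are taken in the preferred chart at \<open>p\<close>, whence the transition
  maps.\<close>

lemma sing_tangent_adapted:
  assumes ad: "adapted c i" and p: "p \<in> fst c" "p \<in> sing g"
  shows "v \<in> sing_tangent \<A> g p \<longleftrightarrow> vec_coords \<A> c p v $ i = 0"
proof -
  let ?b = "chart_at \<A> p"
  have c: "c \<in> \<A>" using ad by (simp add: adapted_def)
  show ?thesis
  proof
    assume "v \<in> sing_tangent \<A> g p"
    then obtain \<gamma> e where e: "e > 0" "\<gamma> 0 = p" "\<And>t. t \<in> {-e<..<e} \<Longrightarrow> \<gamma> t \<in> sing g \<inter> fst ?b"
      and \<gamma>: "smooth_on {-e<..<e} (snd ?b \<circ> \<gamma>)" and v: "vector_derivative (snd ?b \<circ> \<gamma>) (at 0) = v"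
      by (auto simp: sing_tangent_def)
    have e0: "0 \<in> {-e<..<e}" using e by simp
    have "(snd ?b \<circ> \<gamma>) differentiable (at 0)" by (rule smooth_on_differentiable[OF \<gamma> e0])
    then have d: "((snd ?b \<circ> \<gamma>) has_derivative (\<lambda>s. s *\<^sub>R v)) (at 0)"
      using v by (metis vector_derivative_works has_vector_derivative_def)
    let ?h = "\<lambda>t. (snd c \<circ> cinv ?b) ((snd ?b \<circ> \<gamma>) t) $ i"
    have h1: "(?h has_derivative (\<lambda>s. chart_deriv ?b c p (s *\<^sub>R v) $ i)) (at 0)"
      using chart_deriv[of ?b c p] c p e(2)
      by (intro bounded_linear.has_derivative[OF bounded_linear_vec_nth] has_derivative_compose[OF d]) (auto simp: o_def)
    let ?W = "{-e<..<e} \<inter> (snd ?b \<circ> \<gamma>) -` (snd ?b ` (fst ?b \<inter> fst c))"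
    have W: "open ?W"
      using c by (intro continuous_open_preimage smooth_on_imp_continuous_on[OF \<gamma>] open_image open_domain) auto
    have W0: "0 \<in> ?W" using e p by auto
    have "?h t = 0" if "t \<in> ?W" for t
    proof -
      from that obtain q where q: "q \<in> fst ?b" "q \<in> fst c" "snd ?b (\<gamma> t) = snd ?b q" by auto
      moreover have "\<gamma> t \<in> fst ?b" "\<gamma> t \<in> sing g" using e(3) that by auto
      ultimately have "\<gamma> t = q" by (metis chart_at(1) cinv_chart)
      then show ?thesis using q ad \<open>\<gamma> t \<in> sing g\<close> by (simp add: adapted_def)
    qed
    then have h2: "(?h has_derivative (\<lambda>s. 0)) (at 0)"
      by (intro has_derivative_transform_within_open[OF has_derivative_const[of 0] W W0]) auto
    from has_derivative_unique[OF h1 h2, THEN fun_cong, of 1]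
    show "vec_coords \<A> c p v $ i = 0" by (simp add: vec_coords_eq)
  next
    assume v: "vec_coords \<A> c p v $ i = 0"
    let ?v = "vec_coords \<A> c p v" and ?x = "snd c p"
    let ?V = "snd c ` (fst c \<inter> fst ?b)"
    have V: "open ?V" "?x \<in> ?V" using open_image[OF c open_domain[OF chart_at(1)[of p]]] p by auto
    let ?l = "\<lambda>t::real. ?x + t *\<^sub>R ?v"
    define \<gamma> where "\<gamma> t = cinv c (?l t)" for t
    have "open (?l -` ?V)" by (intro continuous_open_vimage V continuous_intros)
    moreover have "0 \<in> ?l -` ?V" using V by simp
    ultimately obtain e where e: "e > 0" "ball 0 e \<subseteq> ?l -` ?V" using open_contains_ball by blast
    have l: "?l t \<in> ?V" if "t \<in> {-e<..<e}" for t
      using e(2) that by (auto simp: subset_iff dist_real_def abs_less_iff)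
    have "\<gamma> t \<in> sing g \<inter> fst ?b" if "t \<in> {-e<..<e}" for t
    proof -
      from l[OF that] obtain q where q: "q \<in> fst c" "q \<in> fst ?b" "?l t = snd c q" by auto
      have "snd c q $ i = 0" using q(3)[symmetric] v p ad by (simp add: adapted_def)
      then show ?thesis using q ad c by (simp add: \<gamma>_def adapted_def)
    qed
    moreover have "smooth_on {-e<..<e} (snd ?b \<circ> \<gamma>)"
    proof -
      have "smooth_on {-e<..<e} (\<lambda>t. (snd ?b \<circ> cinv c) (?l t))"
        by (rule smooth_on_compose[OF _ V(1) transition_smooth]) (use c l in \<open>auto intro!: smooth_intros\<close>)
      then show ?thesis by (simp add: \<gamma>_def o_def)
    qed
    moreover have "vector_derivative (snd ?b \<circ> \<gamma>) (at 0) = v"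
    proof -
      have "(?l has_derivative (\<lambda>s. s *\<^sub>R ?v)) (at 0)" by (auto intro!: derivative_eq_intros)
      from has_derivative_compose[OF this, of "snd ?b \<circ> cinv c" "chart_deriv c ?b p"] c p chart_deriv[of c ?b p]
      have "((\<lambda>t. (snd ?b \<circ> cinv c) (?l t)) has_derivative (\<lambda>s. chart_deriv c ?b p (s *\<^sub>R ?v))) (at 0)" by simp
      also have "(\<lambda>s. chart_deriv c ?b p (s *\<^sub>R ?v)) = (\<lambda>s. s *\<^sub>R v)"
        using c p chart_deriv_linear[of c ?b p] by (simp add: linear_scale)
      finally have "((snd ?b \<circ> \<gamma>) has_vector_derivative v) (at 0)"
        by (simp add: has_vector_derivative_def \<gamma>_def o_def)
      then show ?thesis by (rule vector_derivative_at)
    qed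
    moreover have "\<gamma> 0 = p" using c p by (simp add: \<gamma>_def)
    ultimately show "v \<in> sing_tangent \<A> g p"
      unfolding sing_tangent_def using e(1) by blast
  qed
qed

text \<open>A negative vector spans a line that would contribute 1 to the maximum defining the
  index.\<close>

lemma riemannian_nonneg:
  assumes "riemannian_at g q" shows "g q v v \<ge> 0"
proof (rule ccontr)
  assume neg: "\<not> g q v v \<ge> 0"
  have "bilinear (g q)" using g by (simp add: smooth_symmetric_tensor_def)
  then have sc: "g q (k *\<^sub>R v) (k *\<^sub>R v) = k * k * g q v v" for k
    by (simp add: bilinear_lmul bilinear_rmul)
  let ?D = "{dim W |W. subspace W \<and> (\<forall>v\<in>W. v \<noteq> 0 \<longrightarrow> g q v v < 0)}"
  have "?D \<subseteq> {..CARD('n)}" using dim_subset_UNIV_cart by auto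
  then have fin: "finite ?D" by (rule finite_subset) simp
  have "v \<noteq> 0" using neg sc[of 0] by auto
  have "\<forall>u\<in>span {v}. u \<noteq> 0 \<longrightarrow> g q u u < 0"
    using neg sc by (auto simp: span_singleton mult_less_0_iff zero_less_mult_iff)
  then have "dim (span {v}) \<in> ?D" using subspace_span by blast
  from Max_ge[OF fin this] have "dim (span {v}) \<le> Max ?D" .
  moreover have "dim (span {v}) = 1" using \<open>v \<noteq> 0\<close> by (simp add: dim_span)
  moreover have "Max ?D = 0" using assms unfolding riemannian_at_def metric_index_def by (rule conjunct2)
  ultimately show False by linarith
qed

text \<open>A negative value persists, for the vector with the same components, on a neighbourhood
  of \<open>p\<close>; this neighbourhood meets the Riemannian points, in whose closure
  \<open>p\<close> lies.\<close>

lemma sing_nonneg: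
  assumes p: "p \<in> sing g" shows "g p v v \<ge> 0"
proof (rule ccontr)
  assume neg: "\<not> g p v v \<ge> 0"
  let ?c = "chart_at \<A> p"
  interpret local_metric "snd ?c ` fst ?c" "GG ?c" by (rule local_metric_chart) simp
  let ?f = "\<lambda>x. met (GG ?c) x v v"
  have "continuous_on (snd ?c ` fst ?c) ?f"
    by (intro smooth_on_imp_continuous_on smooth_on_met smooth_intros S order_refl)
  from continuous_open_preimage[OF this S, of "{..<0}"]
  have "open {x \<in> snd ?c ` fst ?c. ?f x < 0}" by (auto simp: vimage_def Int_def)
  from open_chart_preimage[OF chart_at(1) this]
  have W: "open {q \<in> fst ?c. snd ?c q \<in> {x \<in> snd ?c ` fst ?c. ?f x < 0}}" (is "open ?W") .
  have "p \<in> ?W"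
    using neg met_chart[of ?c p v v] by (simp add: vec_coords_eq)
  moreover have "p \<in> closure {p. riemannian_at g p}"
    using riemann_lorentz p unfolding riemann_lorentz_def by blast
  ultimately have "?W \<inter> closure {p. riemannian_at g p} \<noteq> {}" by blast
  then have "?W \<inter> {p. riemannian_at g p} \<noteq> {}"
    using open_Int_closure_eq_empty[OF W] by blast
  then obtain q where q: "riemannian_at g q" "q \<in> fst ?c" "?f (snd ?c q) < 0" by blast
  have "g q (chart_deriv ?c (chart_at \<A> q) q v) (chart_deriv ?c (chart_at \<A> q) q v) < 0"
    using q by (simp add: met_chart[of ?c q])
  then show False using riemannian_nonneg[OF q(1)] by (meson leD)
qed

lemma flattened_metric_chart:
  assumes "adapted c i" shows "flattened_metric (snd c ` fst c) (GG c) i"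
proof -
  have c: "c \<in> \<A>" and s: "\<And>q. q \<in> fst c \<Longrightarrow> q \<in> sing g \<longleftrightarrow> snd c q $ i = 0" using assms by (auto simp: adapted_def)
  interpret local_metric "snd c ` fst c" "GG c" by (rule local_metric_chart[OF c])
  show ?thesis
  proof
    fix x assume "x \<in> snd c ` fst c"
    then obtain p where p: "p \<in> fst c" "x = snd c p" by auto
    show "det (GG c x) = 0 \<longleftrightarrow> x $ i = 0" using s p sing_chart[OF c p(1)] by simp
    assume "x $ i = 0"
    then have ps: "p \<in> sing g" using s p by simp
    show "frechet_derivative (\<lambda>x. det (GG c x)) (at x) \<noteq> (\<lambda>v. 0)"
      using transverse c p ps by (auto simp: transverse_singular_def)
    show "r $ i = 0" if "GG c x *v r = 0" for r
    proof -
      have "chart_deriv c (chart_at \<A> p) p r \<in> Rad g p"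
        using that p c by (simp add: kernel_chart)
      then have "chart_deriv c (chart_at \<A> p) p r \<in> sing_tangent \<A> g p"
        using tangent_radical ps by (auto simp: tangent_radical_def)
      then show ?thesis using sing_tangent_adapted[OF assms p(1) ps] c p by simp
    qed
    show "met (GG c) x v v \<ge> 0" for v
      using sing_nonneg[OF ps, of "chart_deriv c (chart_at \<A> p) p v"] c p by (simp add: met_chart)
  qed
qed

end

section \<open>The fundamental tensors in flattening charts\<close>

context flattened_metric
begin

text \<open>Against a unit normal, the pairing of \<open>u\<close> with \<open>n\<close> is the
  ratio of their \<open>i\<close>-th components.\<close>

lemma normal_decomposition:
  assumes x: "x \<in> S" and n: "\<And>w. w $ i = 0 \<Longrightarrow> met G x n w = 0" "met G x n n = 1"
  shows "(u - met G x u n *\<^sub>R n) $ i = 0" and "met G x u n = 0 \<longleftrightarrow> u $ i = 0" and "n $ i \<noteq> 0"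
proof -
  show n0: "n $ i \<noteq> 0" using n by auto
  define t where "t = u - (u $ i / n $ i) *\<^sub>R n"
  have ti: "t $ i = 0" using n0 by (simp add: t_def)
  have "met G x t n = 0" using n(1)[OF ti] met_commute[OF x, of t n] by simp
  then have s: "met G x u n = u $ i / n $ i" by (simp add: t_def met_linear n(2))
  show "(u - met G x u n *\<^sub>R n) $ i = 0" using ti by (simp add: s t_def)
  show "met G x u n = 0 \<longleftrightarrow> u $ i = 0" using n0 by (simp add: s)
qed

lemma is_conn_exists:
  assumes x: "x \<in> S" "x $ i = 0" and a: "\<And>y r. y \<in> S \<Longrightarrow> y $ i = 0 \<Longrightarrow> G y *v r = 0 \<Longrightarrow> Gam G y a b r = 0"
  shows "\<exists>D. is_conn x a b D"
proof -
  obtain e D where "e > 0" "\<And>y w. y \<in> ball x e \<Longrightarrow> met G y (D y) w = Gam G y a b w"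
    using conn_extends[OF S order_refl x smooth_on_const[OF S] smooth_on_const[OF S]] a by metis
  then show ?thesis unfolding is_conn_def by (metis centre_in_ball)
qed

end

context singular_metric
begin

lemma adaptedD: "adapted c i \<Longrightarrow> c \<in> \<A>" "adapted c i \<Longrightarrow> q \<in> fst c \<Longrightarrow> q \<in> sing g \<longleftrightarrow> snd c q $ i = 0"
  by (auto simp: adapted_def)

text \<open>The derivative term of \<open>dual_conn_chart\<close> is paired with a radical vector
  and vanishes, so all extensions give the same number. Fields with constant components show that
  extensions exist, which settles the definite description.\<close>

lemma II_chart:
  assumes c: "c \<in> \<A>" "p \<in> fst c" and r: "r \<in> Rad g p"
  shows "II \<A> g p r a b = Gam (GG c) (snd c p) (vec_coords \<A> c p a) (vec_coords \<A> c p b) (vec_coords \<A> c p r)"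
  unfolding II_def
proof (rule the_equality)
  interpret local_metric "snd c ` fst c" "GG c" by (rule local_metric_chart[OF c(1)])
  have xS: "snd c p \<in> snd c ` fst c" using c by simp
  have k: "met (GG c) (snd c p) u (vec_coords \<A> c p r) = 0" for u
    using r kernel_chart[OF c] by (simp add: met_def)
  show *: "\<forall>U X Y Z. open U \<and> p \<in> U \<and> smooth_field \<A> U X \<and> smooth_field \<A> U Y \<and> smooth_field \<A> U Z \<and>
      X p = a \<and> Y p = b \<and> Z p = r \<longrightarrow>
      dual_conn \<A> g X Y Z p = Gam (GG c) (snd c p) (vec_coords \<A> c p a) (vec_coords \<A> c p b) (vec_coords \<A> c p r)"
  proof (intro allI impI, elim conjE)
    fix U X Y Z
    assume "open U" "p \<in> U" "smooth_field \<A> U X" "smooth_field \<A> U Y" "smooth_field \<A> U Z"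
      and v: "X p = a" "Y p = b" "Z p = r"
    from dual_conn_chart[OF c this(1-5)]
    show "dual_conn \<A> g X Y Z p = Gam (GG c) (snd c p) (vec_coords \<A> c p a) (vec_coords \<A> c p b) (vec_coords \<A> c p r)"
      unfolding v k by simp
  qed
  fix s assume s: "\<forall>U X Y Z. open U \<and> p \<in> U \<and> smooth_field \<A> U X \<and> smooth_field \<A> U Y \<and> smooth_field \<A> U Z \<and>
      X p = a \<and> Y p = b \<and> Z p = r \<longrightarrow> dual_conn \<A> g X Y Z p = s"
  obtain X where X: "smooth_field \<A> (fst c) X" "X p = a" using field_with_value[OF c] .
  obtain Y where Y: "smooth_field \<A> (fst c) Y" "Y p = b" using field_with_value[OF c] .
  obtain Z where Z: "smooth_field \<A> (fst c) Z" "Z p = r" using field_with_value[OF c] .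
  have "dual_conn \<A> g X Y Z p = s"
    by (rule s[rule_format, of "fst c"]) (use X Y Z c open_domain in auto)
  moreover have "dual_conn \<A> g X Y Z p = Gam (GG c) (snd c p) (vec_coords \<A> c p a) (vec_coords \<A> c p b) (vec_coords \<A> c p r)"
    by (rule *[rule_format, of "fst c"]) (use X Y Z c open_domain in auto)
  ultimately show "s = Gam (GG c) (snd c p) (vec_coords \<A> c p a) (vec_coords \<A> c p b) (vec_coords \<A> c p r)" by simp
qed

lemma tangent_field_coords:
  assumes "adapted c i" "tangent_field \<A> g U X" "q \<in> U" "q \<in> fst c" "q \<in> sing g"
  shows "vec_coords \<A> c q (X q) $ i = 0"
  using assms sing_tangent_adapted[OF assms(1,4,5)] by (auto simp: tangent_field_def)

lemma tangent_field_derivative: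
  assumes ad: "adapted c i" and Y: "tangent_field \<A> g U Y" and U: "open U" "p \<in> U" and p: "p \<in> fst c" "p \<in> sing g"
    and u: "u $ i = 0"
  shows "frechet_derivative (field_coords \<A> c Y) (at (snd c p)) u $ i = 0"
proof -
  have c: "c \<in> \<A>" using ad by (rule adaptedD)
  have V: "open (snd c ` (fst c \<inter> U))" "snd c p \<in> snd c ` (fst c \<inter> U)" using c p U by (auto intro: open_image)
  have "smooth_field \<A> U Y" using Y by (simp add: tangent_field_def)
  from smooth_on_has_derivative[OF smooth_field_coords[OF this c] V(2)]
  have D: "((\<lambda>y. field_coords \<A> c Y y $ i) has_derivative
      (\<lambda>h. frechet_derivative (field_coords \<A> c Y) (at (snd c p)) h $ i)) (at (snd c p))"
    by (rule bounded_linear.has_derivative[OF bounded_linear_vec_nth])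
  show ?thesis
    by (rule derivative_tangent_eq_0[OF V _ u D])
       (use c p adaptedD(2)[OF ad] tangent_field_coords[OF ad Y] in auto)
qed

lemma tangent_constant_field:
  assumes ad: "adapted c i" and "v $ i = 0"
  shows "tangent_field \<A> g (fst c) (lift_field \<A> c (\<lambda>x. v))"
  using assms adaptedD[OF ad] sing_tangent_adapted[OF ad]
  by (auto simp: tangent_field_def smooth_constant_field field_coords_lift_field)

lemma lift_vec_coords: "c \<in> \<A> \<Longrightarrow> p \<in> fst c \<Longrightarrow> lift_field \<A> c (\<lambda>x. vec_coords \<A> c p v) p = v"
  by (simp add: lift_field_def)

lemma normal_chart:
  assumes ad: "adapted c i" and p: "p \<in> fst c" "p \<in> sing g"
    and n: "\<And>v. v \<in> sing_tangent \<A> g p \<Longrightarrow> g p n v = 0" and w: "w $ i = 0"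
  shows "met (GG c) (snd c p) (vec_coords \<A> c p n) w = 0"
  using n[of "chart_deriv c (chart_at \<A> p) p w"] w sing_tangent_adapted[OF ad p] adaptedD(1)[OF ad] p
  by (simp add: met_chart)

text \<open>Here the derivative term vanishes because a tangent field differentiated along the
  hypersurface stays tangent, hence orthogonal to \<open>n\<close>.\<close>

lemma \<H>_chart:
  assumes ad: "adapted c i" and p: "p \<in> fst c" "p \<in> sing g"
    and n: "\<And>v. v \<in> sing_tangent \<A> g p \<Longrightarrow> g p n v = 0"
    and xy: "x \<in> sing_tangent \<A> g p" "y \<in> sing_tangent \<A> g p"
  shows "\<H> \<A> g p n x y = Gam (GG c) (snd c p) (vec_coords \<A> c p x) (vec_coords \<A> c p y) (vec_coords \<A> c p n)"
  unfolding \<H>_def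
proof (rule the_equality)
  have c: "c \<in> \<A>" using ad by (rule adaptedD)
  interpret local_metric "snd c ` fst c" "GG c" by (rule local_metric_chart[OF c])
  have xS: "snd c p \<in> snd c ` fst c" using p by simp
  have tx: "vec_coords \<A> c p x $ i = 0" "vec_coords \<A> c p y $ i = 0" using xy sing_tangent_adapted[OF ad p] by auto
  have *: "dual_conn \<A> g X Y Z p = Gam (GG c) (snd c p) (vec_coords \<A> c p x) (vec_coords \<A> c p y) (vec_coords \<A> c p n)"
    if h: "open U" "p \<in> U" "tangent_field \<A> g U X" "tangent_field \<A> g U Y" "smooth_field \<A> U Z" "X p = x" "Y p = y" "Z p = n"
    for U X Y Z
  proof -
    have s: "smooth_field \<A> U X" "smooth_field \<A> U Y" using h by (auto simp: tangent_field_def)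
    have "met (GG c) (snd c p) (frechet_derivative (field_coords \<A> c Y) (at (snd c p)) (vec_coords \<A> c p x)) (vec_coords \<A> c p n) = 0"
      using normal_chart[OF ad p n tangent_field_derivative[OF ad h(4,1,2) p tx(1)]] met_commute[OF xS] by metis
    then show ?thesis using dual_conn_chart[OF c p(1) h(1,2) s h(5)] h by simp
  qed
  then show "\<forall>U X Y Z. open U \<and> p \<in> U \<and> tangent_field \<A> g U X \<and> tangent_field \<A> g U Y \<and> smooth_field \<A> U Z \<and>
      X p = x \<and> Y p = y \<and> Z p = n \<longrightarrow>
      dual_conn \<A> g X Y Z p = Gam (GG c) (snd c p) (vec_coords \<A> c p x) (vec_coords \<A> c p y) (vec_coords \<A> c p n)"
    by blast
  fix s assume s: "\<forall>U X Y Z. open U \<and> p \<in> U \<and> tangent_field \<A> g U X \<and> tangent_field \<A> g U Y \<and> smooth_field \<A> U Z \<and>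
      X p = x \<and> Y p = y \<and> Z p = n \<longrightarrow> dual_conn \<A> g X Y Z p = s"
  let ?X = "lift_field \<A> c (\<lambda>_. vec_coords \<A> c p x)" and ?Y = "lift_field \<A> c (\<lambda>_. vec_coords \<A> c p y)"
    and ?Z = "lift_field \<A> c (\<lambda>_. vec_coords \<A> c p n)"
  have f: "open (fst c)" "p \<in> fst c" "tangent_field \<A> g (fst c) ?X" "tangent_field \<A> g (fst c) ?Y" "smooth_field \<A> (fst c) ?Z"
    "?X p = x" "?Y p = y" "?Z p = n"
    using tangent_constant_field[OF ad] tx smooth_constant_field[OF c] open_domain[OF c] p lift_vec_coords[OF c p(1)] by auto
  have "dual_conn \<A> g ?X ?Y ?Z p = s" using s f by blast
  with *[OF f] show "s = Gam (GG c) (snd c p) (vec_coords \<A> c p x) (vec_coords \<A> c p y) (vec_coords \<A> c p n)" by simp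
qed

text \<open>Only the \<open>n\<close>-component of the extended covariant derivative matters, as
  \<open>Gam\<close>(t, r, r) = 0 for tangent t. By continuity from off the hypersurface this
  component is \<H>(x, y).\<close>

lemma III_chart:
  assumes ad: "adapted c i" and p: "p \<in> fst c" "p \<in> sing g" and flat: "flattened_metric.flat_on (GG c) i (snd c ` fst c)"
    and n: "\<And>v. v \<in> sing_tangent \<A> g p \<Longrightarrow> g p n v = 0" "g p n n = 1" and r: "R p \<in> Rad g p"
    and xy: "x \<in> sing_tangent \<A> g p" "y \<in> sing_tangent \<A> g p"
  shows "III \<A> g R p x y (R p) =
    Gam (GG c) (snd c p) (vec_coords \<A> c p x) (vec_coords \<A> c p y) (vec_coords \<A> c p n) *
    Gam (GG c) (snd c p) (vec_coords \<A> c p n) (vec_coords \<A> c p (R p)) (vec_coords \<A> c p (R p))" (is "_ = ?s")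
  unfolding III_def
proof (rule the_equality)
  have c: "c \<in> \<A>" using ad by (rule adaptedD)
  interpret flattened_metric "snd c ` fst c" "GG c" i by (rule flattened_metric_chart[OF ad])
  let ?S = "snd c ` fst c" and ?q = "snd c p"
  let ?x = "vec_coords \<A> c p x" and ?y = "vec_coords \<A> c p y" and ?n = "vec_coords \<A> c p n" and ?r = "vec_coords \<A> c p (R p)"
  have xS: "?q \<in> ?S" using p by simp
  have xi: "?q $ i = 0" using adaptedD(2)[OF ad] p by simp
  have tx: "?x $ i = 0" "?y $ i = 0" using xy sing_tangent_adapted[OF ad p] by auto
  have n1: "\<And>w. w $ i = 0 \<Longrightarrow> met (GG c) ?q ?n w = 0" using normal_chart[OF ad p n(1)] .
  have n2: "met (GG c) ?q ?n ?n = 1" using n(2) met_chart[OF c p(1)] by simp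
  have rk: "GG c ?q *v ?r = 0" using r kernel_chart[OF c p(1)] by simp
  have *: "II \<A> g p (R p) (D p) (R p) = ?s"
    if U: "open U" "p \<in> U" and X: "tangent_field \<A> g U X" and Y: "tangent_field \<A> g U Y" and v: "X p = x" "Y p = y"
      and D: "smooth_field \<A> U D" "\<And>q. q \<in> U - sing g \<Longrightarrow> D q = nabla \<A> g X Y q" for U X Y D
  proof -
    have s: "smooth_field \<A> U X" "smooth_field \<A> U Y" using X Y by (auto simp: tangent_field_def)
    let ?V = "snd c ` (fst c \<inter> U)" and ?X = "field_coords \<A> c X" and ?Y = "field_coords \<A> c Y" and ?D = "field_coords \<A> c D"
    have V: "open ?V" "?q \<in> ?V" "?V \<subseteq> ?S" using U p c by (auto intro: open_image)
    have sm: "smooth_on ?V ?X" "smooth_on ?V ?Y" "smooth_on ?V ?D" using s D(1) c by (auto intro: smooth_field_coords)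
    have "met (GG c) ?q (?D ?q) ?n =
        met (GG c) ?q (frechet_derivative ?Y (at ?q) (?X ?q)) ?n + Gam (GG c) ?q (?X ?q) (?Y ?q) ?n"
    proof (rule eq_on_hyperplane[OF V(1,2), where i = i and
          f = "\<lambda>y. met (GG c) y (?D y) ?n" and h = "\<lambda>y. met (GG c) y (frechet_derivative ?Y (at y) (?X y)) ?n + Gam (GG c) y (?X y) (?Y y) ?n"])
      show "continuous_on ?V (\<lambda>y. met (GG c) y (?D y) ?n)"
        by (intro smooth_on_imp_continuous_on smooth_on_met V sm smooth_on_const)
      show "continuous_on ?V (\<lambda>y. met (GG c) y (frechet_derivative ?Y (at y) (?X y)) ?n + Gam (GG c) y (?X y) (?Y y) ?n)"
        by (intro smooth_on_imp_continuous_on smooth_on_add smooth_on_met smooth_on_Gam smooth_on_derivative_along V sm smooth_on_const)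
      fix y assume y: "y \<in> ?V" "y $ i \<noteq> 0"
      then obtain q where q: "q \<in> fst c" "q \<in> U" "y = snd c q" by auto
      then have qs: "q \<notin> sing g" using y adaptedD(2)[OF ad] by simp
      have "?D y = nab (GG c) ?X ?Y y"
        using D(2)[of q] q qs nabla_chart[OF c q(1) U(1) q(2) qs s] c by simp
      moreover have "det (GG c y) \<noteq> 0" using qs sing_chart[OF c q(1)] q by simp
      ultimately show "met (GG c) y (?D y) ?n = met (GG c) y (frechet_derivative ?Y (at y) (?X y)) ?n + Gam (GG c) y (?X y) (?Y y) ?n"
        using y V(3) by (auto simp: met_nab)
    qed
    moreover have "met (GG c) ?q (frechet_derivative ?Y (at ?q) (?X ?q)) ?n = 0"
      using n1[OF tangent_field_derivative[OF ad Y U p tx(1)]] met_commute[OF xS] v(1) p c by simp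
    ultimately have m: "met (GG c) ?q (vec_coords \<A> c p (D p)) ?n = Gam (GG c) ?q ?x ?y ?n"
      using v p c by simp
    have "Gam (GG c) ?q (vec_coords \<A> c p (D p) - met (GG c) ?q (vec_coords \<A> c p (D p)) ?n *\<^sub>R ?n) ?r ?r = 0"
    proof (cases "?r = 0")
      case False
      then obtain k where "\<And>a. Gam (GG c) ?q a ?r ?r = a $ i * k" using Gam_kernel_kernel[OF xS xi rk False] by blast
      then show ?thesis by (simp only: normal_decomposition(1)[OF xS n1 n2] mult_zero_left)
    qed (simp add: Gam_linear xS)
    then show ?thesis
      unfolding II_chart[OF c p(1) r] m by (simp add: Gam_linear xS)
  qed
  then show "\<forall>U X Y D. open U \<and> p \<in> U \<and> tangent_field \<A> g U X \<and> tangent_field \<A> g U Y \<and> X p = x \<and> Y p = y \<and>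
     smooth_field \<A> U D \<and> (\<forall>q \<in> U - sing g. D q = nabla \<A> g X Y q) \<longrightarrow> II \<A> g p (R p) (D p) (R p) = ?s"
    by blast
  fix s assume s: "\<forall>U X Y D. open U \<and> p \<in> U \<and> tangent_field \<A> g U X \<and> tangent_field \<A> g U Y \<and> X p = x \<and> Y p = y \<and>
     smooth_field \<A> U D \<and> (\<forall>q \<in> U - sing g. D q = nabla \<A> g X Y q) \<longrightarrow> II \<A> g p (R p) (D p) (R p) = s"
  have fl: "Gam (GG c) y ?x ?y t = 0" if "y \<in> ?S" "y $ i = 0" "GG c y *v t = 0" for y t
    using flat that tx unfolding flat_on_def by blast
  \<comment> \<open>Flatness provides an actual extension of the covariant derivative; without one,
    every number would satisfy the description of III.\<close>
  obtain e D where D: "e > 0" "ball ?q e \<subseteq> ?S" "smooth_on (ball ?q e) D"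
    "\<And>y. y \<in> ball ?q e \<Longrightarrow> y $ i \<noteq> 0 \<Longrightarrow> D y = conn (GG c) y ?x ?y"
    "\<And>y w. y \<in> ball ?q e \<Longrightarrow> met (GG c) y (D y) w = Gam (GG c) y ?x ?y w"
    by (rule conn_extends[OF S order_refl xS xi smooth_on_const[OF S, of ?x] smooth_on_const[OF S, of ?y] fl]) blast+
  define U where "U = {q \<in> fst c. snd c q \<in> ball ?q e}"
  let ?X = "lift_field \<A> c (\<lambda>_. ?x)" and ?Y = "lift_field \<A> c (\<lambda>_. ?y)"
  have U: "open U" "p \<in> U" "U \<subseteq> fst c"
    unfolding U_def using open_chart_preimage[OF c open_ball] D(1) p by auto
  have sX: "smooth_field \<A> U ?X" "smooth_field \<A> U ?Y"
    using smooth_constant_field[OF c] smooth_field_subset[OF _ U(3)] by auto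
  have tX: "tangent_field \<A> g U ?X" "tangent_field \<A> g U ?Y"
    using tangent_constant_field[OF ad tx(1)] tangent_constant_field[OF ad tx(2)] smooth_field_subset[OF _ U(3)] U(3)
    by (auto simp: tangent_field_def)
  have sD: "smooth_field \<A> U (lift_field \<A> c D)"
    by (rule smooth_lift_field[OF c U(1,3) smooth_on_subset[OF D(3)]]) (auto simp: U_def)
  have "lift_field \<A> c D q = nabla \<A> g ?X ?Y q" if q: "q \<in> U - sing g" for q
  proof -
    have qc: "q \<in> fst c" "q \<in> U" "q \<notin> sing g" using q U by auto
    have fY: "field_coords \<A> c ?Y y = ?y" if "y \<in> ?S" for y
      using that c by (auto simp: field_coords_lift_field)
    have qS: "snd c q \<in> ?S" using qc by simp
    have "vec_coords \<A> c q (nabla \<A> g ?X ?Y q) = nab (GG c) (field_coords \<A> c ?X) (field_coords \<A> c ?Y) (snd c q)"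
      by (rule nabla_chart[OF c qc(1) U(1) qc(2,3) sX])
    also have "\<dots> = conn (GG c) (snd c q) ?x ?y"
    proof -
      have "frechet_derivative (field_coords \<A> c ?Y) (at (snd c q)) = frechet_derivative (\<lambda>_. ?y) (at (snd c q))"
        by (rule frechet_derivative_cong_open[OF S qS]) (rule fY)
      then have "frechet_derivative (field_coords \<A> c ?Y) (at (snd c q)) = (\<lambda>_. 0)" by simp
      then show ?thesis unfolding nab_def using c qc by (simp add: field_coords_lift_field)
    qed
    also have "\<dots> = D (snd c q)"
      using D(4)[of "snd c q"] qc adaptedD(2)[OF ad, of q] by (auto simp: U_def)
    also have "\<dots> = vec_coords \<A> c q (lift_field \<A> c D q)" using c qc by (simp add: field_coords_lift_field)
    finally show ?thesis using c qc by simp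
  qed
  with U sD tX lift_vec_coords[OF c p(1)] have f: "open U" "p \<in> U" "tangent_field \<A> g U ?X" "tangent_field \<A> g U ?Y" "?X p = x" "?Y p = y"
     "smooth_field \<A> U (lift_field \<A> c D)" "\<And>q. q \<in> U - sing g \<Longrightarrow> lift_field \<A> c D q = nabla \<A> g ?X ?Y q" by auto
  have "II \<A> g p (R p) (lift_field \<A> c D p) (R p) = s" using s f by blast
  with *[OF f] show "s = ?s" by simp
qed

section \<open>Smooth extensions\<close>

lemma smooth_extension_coords:
  assumes "smooth_extension \<A> g U F F'" "adapted c i"
  shows "smooth_on (snd c ` (fst c \<inter> U)) (F' \<circ> cinv c)"
    "\<And>y. y \<in> snd c ` (fst c \<inter> U) \<Longrightarrow> y $ i \<noteq> 0 \<Longrightarrow> (F' \<circ> cinv c) y = F (cinv c y)"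
  using assms adaptedD[OF assms(2)] by (auto simp: smooth_extension_def intro: smooth_fun_coords)

lemma smooth_extension_subset: "smooth_extension \<A> g U F F' \<Longrightarrow> V \<subseteq> U \<Longrightarrow> smooth_extension \<A> g V F F'"
  using smooth_fun_subset by (auto simp: smooth_extension_def)

text \<open>The complement of the hypersurface is dense near each of its points.\<close>

lemma smooth_extension_unique:
  assumes F: "smooth_extension \<A> g V F F1" "smooth_extension \<A> g W F F2" and V: "open V" "open W" and q: "q \<in> V" "q \<in> W"
  shows "F1 q = F2 q"
proof (cases "q \<in> sing g")
  case True
  obtain c i where ad: "adapted c i" and qc: "q \<in> fst c" using adapted_chart_exists[OF True] .
  have c: "c \<in> \<A>" using ad by (rule adaptedD)
  let ?V = "snd c ` (fst c \<inter> (V \<inter> W))"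
  have o: "open ?V" "snd c q \<in> ?V" using V q qc c by (auto intro: open_image)
  have e: "smooth_extension \<A> g (V \<inter> W) F F1" "smooth_extension \<A> g (V \<inter> W) F F2"
    using F smooth_extension_subset by blast+
  note x1 = smooth_extension_coords[OF e(1) ad] and x2 = smooth_extension_coords[OF e(2) ad]
  have "(F1 \<circ> cinv c) (snd c q) = (F2 \<circ> cinv c) (snd c q)"
    by (rule eq_on_hyperplane[OF o smooth_on_imp_continuous_on[OF x1(1)] smooth_on_imp_continuous_on[OF x2(1)], where i = i])
       (rule trans[OF x1(2) x2(2)[symmetric]])
  then show ?thesis using c qc by simp
next
  case False
  then show ?thesis using F q by (auto simp: smooth_extension_def)
qed

text \<open>Uniqueness glues local extensions: at a singular point the value comes from the
  extension chosen for that very point. \<open>P\<close> transports what is known about this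
  value.\<close>

lemma smooth_extension_local:
  assumes "\<And>p. p \<in> U \<Longrightarrow> \<exists>V F'. open V \<and> p \<in> V \<and> V \<subseteq> U \<and> smooth_extension \<A> g V F F' \<and> (p \<in> sing g \<longrightarrow> P p (F' p))"
  shows "\<exists>F'. smooth_extension \<A> g U F F' \<and> (\<forall>p\<in>U \<inter> sing g. P p (F' p))"
proof -
  obtain V E where VE: "\<And>p. p \<in> U \<Longrightarrow> open (V p) \<and> p \<in> V p \<and> V p \<subseteq> U \<and> smooth_extension \<A> g (V p) F (E p) \<and> (p \<in> sing g \<longrightarrow> P p (E p p))"
    using assms by metis
  define F' where "F' p = (if p \<in> sing g then E p p else F p)" for p
  have "smooth_fun \<A> U F'"
  proof (rule smooth_fun_local)
    fix p assume p: "p \<in> U"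
    have "F' q = E p q" if "q \<in> V p" for q
    proof (cases "q \<in> sing g")
      case True
      then show ?thesis
        using VE[OF p] VE[of q] that smooth_extension_unique[of "V q" F "E q" "V p" "E p" q] by (auto simp: F'_def)
    next
      case False
      then show ?thesis using VE[OF p] that by (auto simp: F'_def smooth_extension_def)
    qed
    then have "smooth_fun \<A> (V p) F'"
      using VE[OF p] smooth_fun_cong[of "V p" F' "E p"] by (auto simp: smooth_extension_def)
    then show "\<exists>V. open V \<and> p \<in> V \<and> smooth_fun \<A> V F'" using VE[OF p] by blast
  qed
  then have "smooth_extension \<A> g U F F'" by (simp add: smooth_extension_def F'_def)
  moreover have "\<forall>p\<in>U \<inter> sing g. P p (F' p)" using VE by (auto simp: F'_def)
  ultimately show ?thesis by blast
qed

lemma smooth_extension_ball: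
  assumes ad: "adapted c i" and p: "p \<in> fst c" and e: "e > 0" "ball (snd c p) e \<subseteq> snd c ` (fst c \<inter> U)"
    and H: "smooth_on (ball (snd c p) e) H"
      "\<And>q. q \<in> U \<Longrightarrow> q \<in> fst c \<Longrightarrow> q \<notin> sing g \<Longrightarrow> snd c q \<in> ball (snd c p) e \<Longrightarrow> H (snd c q) = F q"
  shows "\<exists>V F'. open V \<and> p \<in> V \<and> V \<subseteq> U \<and> smooth_extension \<A> g V F F' \<and> F' p = H (snd c p)"
proof -
  have c: "c \<in> \<A>" using ad by (rule adaptedD)
  define V where "V = {q \<in> fst c. snd c q \<in> ball (snd c p) e}"
  have V: "open V" "p \<in> V" "V \<subseteq> fst c"
    unfolding V_def using open_chart_preimage[OF c open_ball] e p by auto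
  have VU: "V \<subseteq> U"
  proof
    fix q assume "q \<in> V"
    then obtain q' where "q \<in> fst c" "snd c q = snd c q'" "q' \<in> fst c" "q' \<in> U" using e(2) by (auto simp: V_def)
    then show "q \<in> U" using c by (metis cinv_chart)
  qed
  have sV: "snd c ` V \<subseteq> ball (snd c p) e" by (auto simp: V_def)
  have "smooth_fun \<A> V (H \<circ> snd c)"
  proof (rule smooth_fun_chart[OF c V(1,3)])
    have "smooth_on (snd c ` V) ((H \<circ> snd c) \<circ> cinv c) \<longleftrightarrow> smooth_on (snd c ` V) H"
      using c V by (intro smooth_on_cong open_image') (auto simp: subset_iff)
    then show "smooth_on (snd c ` V) ((H \<circ> snd c) \<circ> cinv c)" using smooth_on_subset[OF H(1) sV] by simp
  qed
  moreover have "\<forall>q\<in>V - sing g. (H \<circ> snd c) q = F q"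
    using H(2) VU by (auto simp: V_def)
  ultimately have "smooth_extension \<A> g V F (H \<circ> snd c)" by (simp add: smooth_extension_def)
  with V VU show ?thesis by (intro exI[of _ V] exI[of _ "H \<circ> snd c"]) simp
qed

lemma smooth_riem:
  assumes U: "open U" and s: "smooth_field \<A> U X" "smooth_field \<A> U Y" "smooth_field \<A> U Z" "smooth_field \<A> U W"
  shows "smooth_fun \<A> (U - sing g) (\<lambda>p. g p (riem \<A> g X Y Z p) (W p))"
  unfolding smooth_fun_def
proof
  fix c assume c: "c \<in> \<A>"
  interpret local_metric "snd c ` fst c" "GG c" by (rule local_metric_chart[OF c])
  let ?V = "snd c ` (fst c \<inter> (U - sing g))"
  have V: "open ?V" "?V \<subseteq> snd c ` fst c" using U open_compl_sing c by (auto simp: Diff_eq intro!: open_image open_Int)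
  have d: "det (GG c y) \<noteq> 0" if "y \<in> ?V" for y using that sing_chart[OF c] by auto
  have f: "smooth_on ?V (field_coords \<A> c A)" if "smooth_field \<A> U A" for A
    using smooth_field_coords[OF smooth_field_subset[OF that] c] by blast
  have "smooth_on ?V (\<lambda>y. Rm (GG c) y (field_coords \<A> c X y) (field_coords \<A> c Y y) (field_coords \<A> c Z y) (field_coords \<A> c W y))"
    unfolding Rm_def
    by (intro smooth_on_add smooth_on_diff smooth_on_Hess smooth_on_Gam smooth_on_conn V f s d)
  also have "?this \<longleftrightarrow> smooth_on ?V ((\<lambda>p. g p (riem \<A> g X Y Z p) (W p)) \<circ> cinv c)"
    using c by (intro smooth_on_cong V) (auto simp: riem_chart[OF c _ U _ _ s(1-3)])
  finally show "smooth_on ?V ((\<lambda>p. g p (riem \<A> g X Y Z p) (W p)) \<circ> cinv c)" .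
qed

lemma smooth_g:
  assumes U: "open U" and s: "smooth_field \<A> U X" "smooth_field \<A> U Y"
  shows "smooth_fun \<A> U (\<lambda>p. g p (X p) (Y p))"
  unfolding smooth_fun_def
proof
  fix c assume c: "c \<in> \<A>"
  interpret local_metric "snd c ` fst c" "GG c" by (rule local_metric_chart[OF c])
  let ?V = "snd c ` (fst c \<inter> U)"
  have V: "open ?V" "?V \<subseteq> snd c ` fst c" using U c by (auto intro!: open_image)
  have "smooth_on ?V (\<lambda>y. met (GG c) y (field_coords \<A> c X y) (field_coords \<A> c Y y))"
    by (intro smooth_on_met V smooth_field_coords s c)
  also have "?this \<longleftrightarrow> smooth_on ?V ((\<lambda>p. g p (X p) (Y p)) \<circ> cinv c)"
    using c by (intro smooth_on_cong V) (auto simp: met_chart)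
  finally show "smooth_on ?V ((\<lambda>p. g p (X p) (Y p)) \<circ> cinv c)" .
qed

end

lemma det_gram: "det (gram g p v w) = g p v v * g p w w - g p v w * g p w v"
  by (simp add: gram_def det_2)

lemma rank_gram:
  "rank (gram g p v w) = 2 \<longleftrightarrow> det (gram g p v w) \<noteq> 0"
  "rank (gram g p v w) = 1 \<Longrightarrow> det (gram g p v w) = 0"
  "det (gram g p v w) = 0 \<Longrightarrow> g p w w \<noteq> 0 \<Longrightarrow> rank (gram g p v w) = 1"
proof -
  let ?A = "gram g p v w"
  have le: "rank ?A \<le> 2" using rank_bound[of ?A] by simp
  have d: "det ?A = 0 \<longleftrightarrow> rank ?A < 2" using det_eq_0_rank[of ?A] by simp
  show "rank ?A = 2 \<longleftrightarrow> det ?A \<noteq> 0" "rank ?A = 1 \<Longrightarrow> det ?A = 0" using le d by auto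
  assume "det ?A = 0" "g p w w \<noteq> 0"
  moreover from this have "?A $ 2 $ 2 \<noteq> 0" by (simp add: gram_def)
  then have "?A \<noteq> 0" by auto
  ultimately show "rank ?A = 1" using d rank_eq_0[of ?A] by linarith
qed

section \<open>Planes containing the radical\<close>

lemma in_span_pair: "v \<in> span {a, b} \<longleftrightarrow> (\<exists>\<alpha> \<beta>. v = \<alpha> *\<^sub>R a + \<beta> *\<^sub>R b)"
  unfolding span_breakdown_eq[of v a "{b}"] span_singleton by (simp add: image_iff diff_eq_eq add.commute)

lemma solve_linear_relation:
  fixes a b :: "'a::real_vector"
  assumes "s *\<^sub>R a + t *\<^sub>R b = 0" "s \<noteq> 0" shows "a = (- t / s) *\<^sub>R b"
proof -
  have "a = (1 / s) *\<^sub>R (s *\<^sub>R a)" using assms(2) by simp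
  also have "s *\<^sub>R a = - (t *\<^sub>R b)" using assms(1) by (simp only: eq_neg_iff_add_eq_0)
  finally show ?thesis by simp
qed

lemma independent_pair_iff:
  "a \<noteq> b \<and> independent {a, b} \<longleftrightarrow> (\<forall>s t. s *\<^sub>R a + t *\<^sub>R b = 0 \<longrightarrow> s = 0 \<and> t = 0)" (is "?l \<longleftrightarrow> ?r")
proof
  assume l: ?l
  then have a: "a \<notin> span {b}" "b \<noteq> 0" by (auto simp: independent_insert dependent_zero)
  show ?r
  proof (intro allI impI)
    fix s t :: real assume 0: "s *\<^sub>R a + t *\<^sub>R b = 0"
    have "s = 0"
    proof (rule ccontr)
      assume "s \<noteq> 0"
      then have "a = (- t / s) *\<^sub>R b" by (rule solve_linear_relation[OF 0])
      then show False using a(1) by (metis insertI1 span_base span_scale)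
    qed
    then show "s = 0 \<and> t = 0" using 0 a by simp
  qed
next
  assume r: ?r
  have "b \<noteq> 0" using r[rule_format, of 0 1] by auto
  moreover have "a \<notin> span {b}"
  proof
    assume "a \<in> span {b}"
    then obtain k where "a = k *\<^sub>R b" by (auto simp: span_singleton)
    then show False using r[rule_format, of 1 "- k"] by simp
  qed
  moreover from this have "a \<noteq> b" by (auto simp: span_base)
  ultimately show ?l by (simp add: independent_insert)
qed

context flattened_metric
begin

text \<open>The kernel is a line, so a radical \<open>b\<close> would be a multiple of
  \<open>r\<close>, giving a linear relation between \<open>a\<close> and \<open>b\<close>.\<close>

lemma plane_kernel:
  assumes x: "x \<in> S" "x $ i = 0" and r: "G x *v r = 0" "r \<noteq> 0" "r = \<alpha> *\<^sub>R a + \<beta> *\<^sub>R b" "\<alpha> \<noteq> 0"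
    and ind: "\<And>s t. s *\<^sub>R a + t *\<^sub>R b = 0 \<Longrightarrow> s = 0 \<and> t = 0"
  shows "G x *v b \<noteq> 0"
proof
  assume "G x *v b = 0"
  then obtain k where k: "b = k *\<^sub>R r" using kernel_unique[OF x r(1,2)] by blast
  have "(k * \<alpha>) *\<^sub>R a + (k * \<beta> - 1) *\<^sub>R b = k *\<^sub>R r - b" by (simp add: r(3) algebra_simps)
  also have "\<dots> = 0" using k by simp
  finally have "k * \<alpha> = 0" "k * \<beta> = 1" using ind by force+
  then show False using r(4) by auto
qed

lemma gram_det_commute: "y \<in> S \<Longrightarrow> gram_det X Y y = gram_det Y X y"
  using met_commute[of y "X y" "Y y"] by (simp add: gram_det_def)

text \<open>One of \<alpha>, \<beta> is nonzero; \<open>gram_det_simple_zero\<close> is applied to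
  the two fields in the order that puts the nonzero coefficient first.\<close>

lemma plane_gram_det:
  assumes V: "open V" "V \<subseteq> S" and x: "x \<in> V" "x $ i = 0" and XY: "smooth_on V X" "smooth_on V Y"
    and r: "G x *v r = 0" "r \<noteq> 0" "r = \<alpha> *\<^sub>R X x + \<beta> *\<^sub>R Y x"
    and ind: "\<And>s t. s *\<^sub>R X x + t *\<^sub>R Y x = 0 \<Longrightarrow> s = 0 \<and> t = 0"
    and 0: "\<And>y. y \<in> V \<Longrightarrow> y $ i = 0 \<Longrightarrow> gram_det X Y y = 0"
  obtains e H where "e > 0" "ball x e \<subseteq> V" "smooth_on (ball x e) H"
    "\<And>y. y \<in> ball x e \<Longrightarrow> gram_det X Y y = det (G y) * H y" "\<And>y. y \<in> ball x e \<Longrightarrow> H y \<noteq> 0"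
proof -
  have xS: "x \<in> S" using x V by auto
  show ?thesis
  proof (cases "\<alpha> = 0")
    case False
    have "G x *v Y x \<noteq> 0" by (rule plane_kernel[OF xS x(2) r(1,2,3) False ind])
    from gram_det_simple_zero[OF V x XY r(1,3) False r(2) this 0] show ?thesis using that by blast
  next
    case True
    then have b: "\<beta> \<noteq> 0" using r by auto
    have r': "r = \<beta> *\<^sub>R Y x + \<alpha> *\<^sub>R X x" using r(3) by simp
    have "G x *v X x \<noteq> 0"
      by (rule plane_kernel[OF xS x(2) r(1,2) r' b]) (use ind in \<open>metis add.commute\<close>)
    moreover have "gram_det Y X y = 0" if "y \<in> V" "y $ i = 0" for y
      using 0[OF that] gram_det_commute[of y X Y] that V by auto
    ultimately obtain e H where H: "e > 0" "ball x e \<subseteq> V" "smooth_on (ball x e) H"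
      "\<And>y. y \<in> ball x e \<Longrightarrow> gram_det Y X y = det (G y) * H y" "\<And>y. y \<in> ball x e \<Longrightarrow> H y \<noteq> 0"
      using gram_det_simple_zero[OF V x XY(2,1) r(1) r' b r(2)] by blast
    have "gram_det X Y y = det (G y) * H y" if "y \<in> ball x e" for y
    proof -
      have "y \<in> S" using H(2) V(2) that by blast
      then show ?thesis using H(4)[OF that] gram_det_commute by simp
    qed
    then show ?thesis using that H by blast
  qed
qed

text \<open>By \<open>eq\<close> the symmetric form \<open>Gam\<close>(., ., r) is degenerate on the
  plane, and \<open>r\<close> is isotropic for it because the radical is tangent. An isotropic
  vector of a degenerate form on a plane lies in its kernel, so \<open>Gam\<close>(b, r, r) = 0,
  which says that \<open>b\<close> is tangent.\<close>

lemma plane_tangent: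
  assumes x: "x \<in> S" "x $ i = 0" and r: "G x *v r = 0" "r \<noteq> 0" "r = \<alpha> *\<^sub>R a + \<beta> *\<^sub>R b"
    and eq: "Gam G x b b r * Gam G x a a r = Gam G x a b r * Gam G x b a r"
  shows "a $ i = 0 \<and> b $ i = 0"
proof -
  have ri: "r $ i = 0" by (rule kernel_tangent[OF x r(1)])
  obtain k where k: "k \<noteq> 0" "\<And>u. Gam G x u r r = u $ i * k" using Gam_kernel_kernel[OF x r(1,2)] by blast
  have *: "b $ i = 0" if "r = \<alpha> *\<^sub>R a + \<beta> *\<^sub>R b" "Gam G x b b r * Gam G x a a r = Gam G x a b r * Gam G x b a r" for \<alpha> \<beta> a b
  proof -
    define p q s where "p = Gam G x a a r" and "q = Gam G x a b r" and "s = Gam G x b b r"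
    have ba: "Gam G x b a r = q" using Gam_commute[OF x(1)] by (simp add: q_def)
    have "Gam G x b r r = \<alpha> * q + \<beta> * s"
      using ba by (subst (1) that(1)) (simp add: Gam_linear x(1) s_def)
    moreover have "Gam G x a r r = \<alpha> * p + \<beta> * q"
      by (subst (1) that(1)) (simp add: Gam_linear x(1) p_def q_def)
    moreover have "\<alpha> * Gam G x a r r + \<beta> * Gam G x b r r = Gam G x r r r"
      by (subst (4) that(1)) (simp add: Gam_linear x(1))
    ultimately have e: "\<alpha> * q + \<beta> * s = b $ i * k" "\<alpha> * (\<alpha> * p + \<beta> * q) + \<beta> * (\<alpha> * q + \<beta> * s) = 0"
      using k(2)[of r] k(2)[of b] ri by simp_all
    have ps: "s * p = q * q" using that(2) ba by (simp add: p_def q_def s_def)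
    have "(\<alpha> * q + \<beta> * s)\<^sup>2 = s * (\<alpha> * (\<alpha> * p + \<beta> * q) + \<beta> * (\<alpha> * q + \<beta> * s)) + \<alpha>\<^sup>2 * (q * q - s * p)"
      by (simp add: power2_eq_square algebra_simps)
    then have "b $ i * k = 0" using e ps by simp
    then show ?thesis using k by simp
  qed
  have "b $ i = 0" using *[OF r(3) eq] .
  moreover have "a $ i = 0"
    by (rule *[of \<beta> b \<alpha> a]) (use r(3) eq in \<open>simp_all add: mult.commute\<close>)
  ultimately show ?thesis by simp
qed

lemma plane_curvature_zero:
  assumes V: "open V" "V \<subseteq> S" "flat_on V" and x: "x \<in> V" "x $ i = 0"
    and r: "G x *v r = 0" "r \<noteq> 0" "r = \<alpha> *\<^sub>R a + \<beta> *\<^sub>R b" and tan: "a $ i = 0" "b $ i = 0"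
    and n: "\<And>w. w $ i = 0 \<Longrightarrow> met G x n w = 0" "met G x n n = 1" "Gam G x r r n = - 1"
    and screen: "\<And>v. v $ i = 0 \<Longrightarrow> Gam G x v r n = 0 \<Longrightarrow> Gam G x v v n = 0"
    and D: "is_conn x a a D" "is_conn x b a E" "is_conn x b b F"
  shows "Hess G x a b a b + Gam G x b b D - Gam G x a b E = 0"
proof -
  have xS: "x \<in> S" using x V by auto
  have c: "Gam G x u v w = Gam G x v u w" for u v w by (rule Gam_commute[OF xS])
  have *: "Hess G x a b a b + Gam G x b b D - Gam G x a b E = 0"
    if al: "\<alpha> \<noteq> 0" and req: "r = \<alpha> *\<^sub>R a + \<beta> *\<^sub>R b" and bt: "b $ i = 0"
      and cn: "is_conn x a a D" "is_conn x b a E" "is_conn x b b F" for \<alpha> \<beta> a b D E F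
  proof -
    obtain D' E' where D': "is_conn x r r D'" "is_conn x b r E'"
      "Hess G x r b r b + Gam G x b b D' - Gam G x r b E' = \<alpha>\<^sup>2 * (Hess G x a b a b + Gam G x b b D - Gam G x a b E)"
      using flat_curvature_change_basis[OF xS cn, of \<alpha> \<beta>] unfolding req by blast
    \<comment> \<open>As \<H>(r, r) = -1, adding t r moves \<open>b\<close> into the screen, where
      \<H> vanishes on the diagonal. Hence \<H>(b, b) = -t^2, and the curvature formula gives t^2 -
      t^2 = 0.\<close>
    define t where "t = Gam G x b r n"
    have "Gam G x (b + t *\<^sub>R r) (b + t *\<^sub>R r) n = 0"
      using kernel_tangent[OF xS x(2) r(1)] bt n(3)
      by (intro screen) (simp_all add: Gam_linear xS t_def)
    then have "Gam G x b b n = - (t * t)"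
      using n(3) c[of r b n] by (simp add: Gam_linear xS t_def algebra_simps)
    then have "Gam G x r r n * Gam G x b b n - (Gam G x r b n)\<^sup>2 = 0"
      using n(3) c[of r b n] by (simp add: t_def power2_eq_square)
    with flat_curvature_radical[OF V x r(1,2) bt n(1,2) D'(1,2)] D'(3) al
    show ?thesis by simp
  qed
  show ?thesis
  proof (cases "\<alpha> = 0")
    case False
    then show ?thesis using * r(3) tan D by blast
  next
    case True
    \<comment> \<open>The argument is applied with \<open>a\<close> and \<open>b\<close> exchanged;
      the expression is symmetric, since \<open>D\<close> and \<open>F\<close> enter through their
      metric pairing.\<close>
    then have "\<beta> \<noteq> 0" "r = \<beta> *\<^sub>R b + \<alpha> *\<^sub>R a" using r by auto
    moreover have "is_conn x a b E" using D(2) c by (simp add: is_conn_def)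
    ultimately have "Hess G x b a b a + Gam G x a a F - Gam G x b a E = 0"
      using * tan(1) D by blast
    moreover have "Gam G x a a F = Gam G x b b D"
      using D met_commute[OF xS, of D F] by (simp add: is_conn_def)
    moreover have "Hess G x b a b a = Hess G x a b a b" by (simp add: Hess_def)
    ultimately show ?thesis using c[of b a E] by simp
  qed
qed

lemma Rm_third:
  assumes "x \<in> S" "det (G x) \<noteq> 0"
  shows "Rm G x a b (c + t *\<^sub>R d) w = Rm G x a b c w + t * Rm G x a b d w"
proof -
  have sw: "Gam G x u v (conn G x a b) = Gam G x a b (conn G x u v)" for u v a b
    using met_conn[OF assms, of u v "conn G x a b"] met_conn[OF assms, of a b "conn G x u v"] met_commute[OF assms(1)]
    by metis
  have lin: "linear (\<lambda>d. ddmet G x a d v w)" "linear (\<lambda>d. ddmet G x a b d w)" for a b v w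
  proof -
    have "linear (frechet_derivative (\<lambda>y. frechet_derivative G (at y) s) (at x))" for s
      by (intro linear_frechet_derivative smooth_on_differentiable[OF smooth_on_derivative[OF G]] assms)
    then have "linear (\<lambda>t. ddmet G x t s v w)" for s
      by (intro linearI) (simp_all add: ddmet_def linear_add linear_scale matrix_vector_mult_add_rdistrib
          inner_add_right scaleR_matrix_vector_assoc[symmetric])
    from this[of a] show "linear (\<lambda>d. ddmet G x a d v w)"
      by (simp add: ddmet_symmetric[OF assms(1), of a])
    show "linear (\<lambda>d. ddmet G x a b d w)"
      by (intro linearI) (simp_all add: ddmet_def inner_add_left)
  qed
  have r: "linear (\<lambda>d. ddmet G x a b w d)" for a b w
    using lin(2)[of a b w] by (simp add: ddmet_commute[OF assms(1), of _ _ w])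
  have "Hess G x a b (c + t *\<^sub>R d) w = Hess G x a b c w + t * Hess G x a b d w"
    unfolding Hess_def linear_add[OF lin(1)] linear_scale[OF lin(1)] linear_add[OF r] linear_scale[OF r] by (simp add: field_simps)
  then show ?thesis
    unfolding Rm_def sw[of b w] sw[of a w] by (simp add: Gam_linear assms(1) algebra_simps)
qed

end

section \<open>The frame of main normal and main radical\<close>

locale framed_metric = singular_metric \<A> g
  for \<A> :: "('a::{t2_space,second_countable_topology}, 'n::finite) chart set" and g +
  fixes N R :: "'a \<Rightarrow> real^'n"
  assumes main_normal: "main_normal \<A> g N" and main_radical: "main_radical \<A> g N R"

text \<open>Fixes one singular point and one adapted chart around it. Arguments that involve
  neighbouring singular points interpret the locale again with the same chart.\<close>

locale framed_point = framed_metric +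
  fixes c i p
  assumes ad: "adapted c i" and p: "p \<in> fst c" "p \<in> sing g"
begin

sublocale F: flattened_metric "snd c ` fst c" "GG c" i
  by (rule flattened_metric_chart[OF ad])

abbreviation "x \<equiv> snd c p"
abbreviation "V v \<equiv> vec_coords \<A> c p v"
abbreviation "r \<equiv> V (R p)"
abbreviation "n \<equiv> V (N p)"
abbreviation "\<Gamma> \<equiv> Gam (GG c) x"

lemma c: "c \<in> \<A>" using ad by (rule adaptedD)
lemma xS: "x \<in> snd c ` fst c" using p by simp
lemma xi: "x $ i = 0" using adaptedD(2)[OF ad] p by simp
lemma lin: "linear (vec_coords \<A> c p)" by (rule vec_coords_linear[OF c p(1)])

lemma tangent_iff: "v \<in> sing_tangent \<A> g p \<longleftrightarrow> V v $ i = 0" by (rule sing_tangent_adapted[OF ad p])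

lemma N_orthogonal: "v \<in> sing_tangent \<A> g p \<Longrightarrow> g p (N p) v = 0"
  using main_normal p by (simp add: main_normal_def)

lemma R_Rad: "R p \<in> Rad g p" using main_radical p by (simp add: main_radical_def)

lemma R_tangent: "R p \<in> sing_tangent \<A> g p"
  using tangent_radical R_Rad p by (auto simp: tangent_radical_def)

lemma n: "w $ i = 0 \<Longrightarrow> met (GG c) x n w = 0" "met (GG c) x n n = 1"
  using normal_chart[OF ad p N_orthogonal] main_normal p met_chart[OF c p(1), of "N p" "N p"]
  by (auto simp: main_normal_def)

lemma H_eq: "V v $ i = 0 \<Longrightarrow> V w $ i = 0 \<Longrightarrow> \<H> \<A> g p (N p) v w = \<Gamma> (V v) (V w) n"
  by (rule \<H>_chart[OF ad p N_orthogonal]) (simp_all add: tangent_iff)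

lemma r: "GG c x *v r = 0" "r $ i = 0" "\<Gamma> r r n = - 1" "r \<noteq> 0"
proof -
  show "GG c x *v r = 0" using kernel_chart[OF c p(1)] R_Rad by simp
  show ri: "r $ i = 0" using R_tangent tangent_iff by simp
  show "\<Gamma> r r n = - 1" using H_eq[OF ri ri] main_radical p by (simp add: main_radical_def)
  then show "r \<noteq> 0" by (auto simp: F.Gam_linear[OF xS])
qed

lemma screen_iff: "v \<in> screen \<A> g N R p \<longleftrightarrow> V v $ i = 0 \<and> \<Gamma> (V v) r n = 0"
  using H_eq[of v "R p"] r(2) by (auto simp: screen_def tangent_iff)

lemma \<nu>_iff: "\<nu> g N p v = 0 \<longleftrightarrow> V v $ i = 0"
  unfolding \<nu>_def met_chart[OF c p(1)] by (rule F.normal_decomposition(2)[OF xS n])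

lemma screen_part: "V v $ i = 0 \<Longrightarrow> V (screen_part \<A> g N R p v) = V v + \<Gamma> (V v) r n *\<^sub>R r"
  using \<nu>_iff[of v] H_eq[of v "R p"] r(2)
  by (simp add: screen_part_def \<rho>_def linear_add[OF lin] linear_scale[OF lin])

lemma V_eq_0 [simp]: "V v = 0 \<longleftrightarrow> v = 0"
  using vec_coords_inject[OF c p(1), of v 0] linear_0[OF lin] by simp

lemma plane_coords:
  assumes "radical_plane \<A> g R U X Y" "p \<in> U"
  obtains \<alpha> \<beta> where "r = \<alpha> *\<^sub>R V (X p) + \<beta> *\<^sub>R V (Y p)"
    "\<And>s t. s *\<^sub>R V (X p) + t *\<^sub>R V (Y p) = 0 \<Longrightarrow> s = 0 \<and> t = 0"
proof -
  have "R p \<in> span {X p, Y p}" "X p \<noteq> Y p \<and> independent {X p, Y p}"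
    using assms p by (auto simp: radical_plane_def)
  then obtain \<alpha> \<beta> where "R p = \<alpha> *\<^sub>R X p + \<beta> *\<^sub>R Y p"
    and i: "\<And>s t. s *\<^sub>R X p + t *\<^sub>R Y p = 0 \<Longrightarrow> s = 0 \<and> t = 0"
    unfolding in_span_pair independent_pair_iff by blast
  then have "r = \<alpha> *\<^sub>R V (X p) + \<beta> *\<^sub>R V (Y p)" by (simp add: linear_add[OF lin] linear_scale[OF lin])
  moreover have "s = 0 \<and> t = 0" if "s *\<^sub>R V (X p) + t *\<^sub>R V (Y p) = 0" for s t
  proof -
    have "V (s *\<^sub>R X p + t *\<^sub>R Y p) = 0" using that by (simp add: linear_add[OF lin] linear_scale[OF lin])
    then show ?thesis using i unfolding V_eq_0 by blast
  qed
  ultimately show ?thesis by (rule that)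
qed

text \<open>Projecting r = \<alpha> X + \<beta> Y along the radical gives a linear relation with the
  same coefficients between the screen parts. They are not both 0, as otherwise \<open>X\<close> and
  \<open>Y\<close> would be multiples of the same vector \<open>r\<close>.\<close>

lemma dim_screen_parts:
  assumes pl: "radical_plane \<A> g R U X Y" "p \<in> U" and \<nu>: "\<nu> g N p (X p) = 0" "\<nu> g N p (Y p) = 0"
  shows "dim (span {screen_part \<A> g N R p (X p), screen_part \<A> g N R p (Y p)}) = 1"
proof -
  obtain \<alpha> \<beta> where r': "r = \<alpha> *\<^sub>R V (X p) + \<beta> *\<^sub>R V (Y p)"
    and ind: "\<And>s t. s *\<^sub>R V (X p) + t *\<^sub>R V (Y p) = 0 \<Longrightarrow> s = 0 \<and> t = 0"
    by (rule plane_coords[OF pl]) blast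
  let ?a = "screen_part \<A> g N R p (X p)" and ?b = "screen_part \<A> g N R p (Y p)"
  have a: "V ?a = V (X p) + \<Gamma> (V (X p)) r n *\<^sub>R r" and b: "V ?b = V (Y p) + \<Gamma> (V (Y p)) r n *\<^sub>R r"
    using \<nu> \<nu>_iff screen_part by auto
  have "\<alpha> * \<Gamma> (V (X p)) r n + \<beta> * \<Gamma> (V (Y p)) r n = \<Gamma> (\<alpha> *\<^sub>R V (X p) + \<beta> *\<^sub>R V (Y p)) r n"
    by (simp add: F.Gam_linear[OF xS])
  also have "\<dots> = - 1" using r(3) r' by simp
  finally have g1: "\<alpha> * \<Gamma> (V (X p)) r n + \<beta> * \<Gamma> (V (Y p)) r n = - 1" .
  have "V (\<alpha> *\<^sub>R ?a + \<beta> *\<^sub>R ?b) = (\<alpha> *\<^sub>R V (X p) + \<beta> *\<^sub>R V (Y p)) + (\<alpha> * \<Gamma> (V (X p)) r n + \<beta> * \<Gamma> (V (Y p)) r n) *\<^sub>R r"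
    unfolding linear_add[OF lin] linear_scale[OF lin] a b by (simp add: algebra_simps)
  also have "\<dots> = 0" unfolding g1 r'[symmetric] by simp
  finally have rel: "\<alpha> *\<^sub>R ?a + \<beta> *\<^sub>R ?b = 0" by simp
  have ne: "\<not> (?a = 0 \<and> ?b = 0)"
  proof
    assume z: "?a = 0 \<and> ?b = 0"
    define A B u w where "A = V (X p)" and "B = V (Y p)" and "u = \<Gamma> (V (X p)) r n" and "w = \<Gamma> (V (Y p)) r n"
    have "A + u *\<^sub>R r = V ?a" "B + w *\<^sub>R r = V ?b" unfolding a b A_def B_def u_def w_def by (rule refl)+
    moreover have "V ?a = 0" "V ?b = 0" unfolding V_eq_0 using z by blast+
    ultimately have AB: "A + u *\<^sub>R r = 0" "B + w *\<^sub>R r = 0" by simp_all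
    have "w *\<^sub>R A + (- u) *\<^sub>R B = w *\<^sub>R (A + u *\<^sub>R r) - u *\<^sub>R (B + w *\<^sub>R r)"
      by (simp only: scaleR_add_right scaleR_scaleR mult.commute[of w u]) simp
    also have "\<dots> = 0" unfolding AB by simp
    finally have "w = 0 \<and> - u = 0" unfolding A_def B_def by (rule ind)
    then have "\<Gamma> (V (X p)) r n = 0" "\<Gamma> (V (Y p)) r n = 0" by (simp_all add: u_def w_def)
    then show False using g1 by simp
  qed
  have one: "dim (span {a, b}) = 1" if "s *\<^sub>R a + t *\<^sub>R b = 0" "s \<noteq> 0" "\<not> (a = 0 \<and> b = 0)" for s t and a b :: "real^'n"
  proof -
    have "a = (- t / s) *\<^sub>R b" by (rule solve_linear_relation[OF that(1,2)])
    moreover from this have "b \<noteq> 0" using that(3) by auto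
    ultimately have "a \<in> span {b}" by (metis insertI1 span_base span_scale)
    then have "span {a, b} = span {b}" by (rule span_redundant)
    then show ?thesis using \<open>b \<noteq> 0\<close> by (simp add: dim_span)
  qed
  show ?thesis
  proof (cases "\<alpha> = 0")
    case False
    then show ?thesis using one[OF rel _ ne] by simp
  next
    case True
    then have "\<beta> \<noteq> 0" using r' r(4) by auto
    moreover have "\<beta> *\<^sub>R ?b + \<alpha> *\<^sub>R ?a = 0" using rel by (simp add: add.commute)
    moreover have "\<not> (?b = 0 \<and> ?a = 0)" using ne by blast
    ultimately have "dim (span {?b, ?a}) = 1" by (intro one)
    then show ?thesis by (simp only: insert_commute)
  qed
qed

end

lemma (in framed_metric) framed_pointI:
  "adapted c i \<Longrightarrow> p \<in> fst c \<Longrightarrow> p \<in> sing g \<Longrightarrow> framed_point \<A> g N R c i p"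
  by (intro framed_point.intro framed_metric_axioms framed_point_axioms.intro)

text \<open>Work is needed only at points of the hypersurface; elsewhere the curvature is its own
  smooth extension.\<close>

lemma (in framed_metric) sing_curvI:
  assumes U: "open U"
    and ext: "\<And>p X' Y' Z' W'. p \<in> U \<Longrightarrow> p \<in> sing g \<Longrightarrow>
      smooth_field \<A> U X' \<Longrightarrow> smooth_field \<A> U Y' \<Longrightarrow> smooth_field \<A> U Z' \<Longrightarrow> smooth_field \<A> U W' \<Longrightarrow>
      (\<And>q. q \<in> U \<Longrightarrow> q \<in> sing g \<Longrightarrow> X' q = X q \<and> Y' q = Y q \<and> Z' q = X q \<and> W' q = Y q) \<Longrightarrow>
      \<exists>V F'. open V \<and> p \<in> V \<and> V \<subseteq> U \<and> smooth_extension \<A> g V (\<lambda>p. g p (riem \<A> g X' Y' Z' p) (W' p)) F' \<and> F' p = h p"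
  shows "sing_curv \<A> g U X Y h"
  unfolding sing_curv_def
proof (intro allI impI, elim conjE)
  fix X' Y' Z' W'
  assume s: "smooth_field \<A> U X'" "smooth_field \<A> U Y'" "smooth_field \<A> U Z'" "smooth_field \<A> U W'"
    and e: "\<forall>p\<in>U \<inter> sing g. X' p = X p \<and> Y' p = Y p \<and> Z' p = X p \<and> W' p = Y p"
  let ?F = "\<lambda>p. g p (riem \<A> g X' Y' Z' p) (W' p)"
  have "\<exists>F. smooth_extension \<A> g U ?F F \<and> (\<forall>p\<in>U \<inter> sing g. F p = h p)"
  proof (rule smooth_extension_local[where P = "\<lambda>p v. v = h p"])
    fix p assume pU: "p \<in> U"
    show "\<exists>V F'. open V \<and> p \<in> V \<and> V \<subseteq> U \<and> smooth_extension \<A> g V ?F F' \<and> (p \<in> sing g \<longrightarrow> F' p = h p)"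
    proof (cases "p \<in> sing g")
      case True
      have "\<exists>V F'. open V \<and> p \<in> V \<and> V \<subseteq> U \<and> smooth_extension \<A> g V ?F F' \<and> F' p = h p"
        by (rule ext[OF pU True s]) (use e in blast)
      then show ?thesis by blast
    next
      case False
      have "open (U - sing g)" using U open_compl_sing by (simp add: Diff_eq open_Int)
      moreover have "smooth_extension \<A> g (U - sing g) ?F ?F"
        using smooth_riem[OF U s] by (simp add: smooth_extension_def)
      ultimately show ?thesis using False pU by (intro exI[of _ "U - sing g"] exI[of _ ?F]) simp
    qed
  qed
  then show "\<exists>F. smooth_extension \<A> g U ?F F \<and> (\<forall>p\<in>U \<inter> sing g. F p = h p)" .
qed

section \<open>Extension of the curvature at a point of the hypersurface\<close>

context framed_point
begin

lemma \<nu>_tangent: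
  assumes "q \<in> fst c" "q \<in> sing g" shows "\<nu> g N q v = 0 \<longleftrightarrow> vec_coords \<A> c q v $ i = 0"
proof -
  interpret Q: framed_point \<A> g N R c i q by (rule framed_pointI[OF ad assms])
  show ?thesis by (rule Q.\<nu>_iff)
qed

lemma chart_image:
  assumes "open U" "p \<in> U"
  shows "open (snd c ` (fst c \<inter> U))" "snd c ` (fst c \<inter> U) \<subseteq> snd c ` fst c" "x \<in> snd c ` (fst c \<inter> U)"
  using open_image[OF c assms(1)] assms p by auto

lemma det_gram_chart:
  assumes "q \<in> fst c"
  shows "det (gram g q (X q) (Y q)) = F.gram_det (field_coords \<A> c X) (field_coords \<A> c Y) (snd c q)"
  using F.met_commute[of "snd c q" "vec_coords \<A> c q (Y q)" "vec_coords \<A> c q (X q)"] assms c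
  by (simp add: det_gram met_chart[OF c assms] F.gram_det_def power2_eq_square)

lemma gram_det_vanishes:
  assumes pl: "radical_plane \<A> g R U X Y" and y: "y \<in> snd c ` (fst c \<inter> U)" "y $ i = 0"
  shows "F.gram_det (field_coords \<A> c X) (field_coords \<A> c Y) y = 0"
proof -
  obtain q where q: "q \<in> fst c" "q \<in> U" "y = snd c q" using y(1) by auto
  have "q \<in> sing g" using adaptedD(2)[OF ad q(1)] y(2) q(3) by simp
  then have "rank (gram g q (X q) (Y q)) = 1" using pl q(2) by (simp add: radical_plane_def)
  from rank_gram(2)[OF this] show ?thesis unfolding q(3) det_gram_chart[OF q(1)] .
qed

lemma plane_smooth:
  assumes "radical_plane \<A> g R U X Y"
  shows "open U" "smooth_field \<A> U X" "smooth_field \<A> U Y"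
  using assms by (auto simp: radical_plane_def)

text \<open>Numerator and Gram determinant are both divisible by \<open>det\<close>, and the second
  quotient has no zeros, so the ratio of the two quotients is the extension.\<close>

lemma sect_curv_extends_at:
  assumes pl: "radical_plane \<A> g R U X Y" and pU: "p \<in> U"
    and E: "smooth_extension \<A> g U (\<lambda>p. g p (riem \<A> g X Y X p) (Y p)) E" "\<And>q. q \<in> U \<inter> sing g \<Longrightarrow> E q = 0"
  shows "\<exists>V F'. open V \<and> p \<in> V \<and> V \<subseteq> U \<and> smooth_extension \<A> g V (sect_curv \<A> g X Y) F'"
proof -
  note U = plane_smooth(1)[OF pl] and s = plane_smooth(2,3)[OF pl]
  note im = chart_image[OF U pU]
  let ?V = "snd c ` (fst c \<inter> U)"
  have sE: "smooth_on ?V (E \<circ> cinv c)" by (rule smooth_extension_coords[OF E(1) ad])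
  have 0: "(E \<circ> cinv c) y = 0" if y: "y \<in> ?V" "y $ i = 0" for y
  proof -
    obtain q where q: "q \<in> fst c" "q \<in> U" "y = snd c q" using y(1) by auto
    have "q \<in> sing g" using adaptedD(2)[OF ad q(1)] y(2) q(3) by simp
    then show ?thesis using E(2)[of q] q c by simp
  qed
  obtain e1 H1 where 1: "e1 > 0" "ball x e1 \<subseteq> ?V" "smooth_on (ball x e1) H1"
    "\<And>y. y \<in> ball x e1 \<Longrightarrow> (E \<circ> cinv c) y = det (GG c y) *\<^sub>R H1 y"
    by (rule F.quotient_by_det[OF im(1,2,3) xi sE 0]) blast+
  obtain \<alpha> \<beta> where r': "r = \<alpha> *\<^sub>R V (X p) + \<beta> *\<^sub>R V (Y p)"
    and ind: "\<And>s t. s *\<^sub>R V (X p) + t *\<^sub>R V (Y p) = 0 \<Longrightarrow> s = 0 \<and> t = 0"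
    by (rule plane_coords[OF pl pU]) blast
  let ?X = "field_coords \<A> c X" and ?Y = "field_coords \<A> c Y"
  have fx: "?X x = V (X p)" "?Y x = V (Y p)" using c p by simp_all
  obtain e2 H2 where 2: "e2 > 0" "ball x e2 \<subseteq> ?V" "smooth_on (ball x e2) H2"
    "\<And>y. y \<in> ball x e2 \<Longrightarrow> F.gram_det ?X ?Y y = det (GG c y) * H2 y" "\<And>y. y \<in> ball x e2 \<Longrightarrow> H2 y \<noteq> 0"
    by (rule F.plane_gram_det[OF im(1,2,3) xi smooth_field_coords[OF s(1) c] smooth_field_coords[OF s(2) c]
        r(1,4) r'[folded fx] ind[folded fx] gram_det_vanishes[OF pl]]) blast+
  let ?e = "min e1 e2"
  have sub: "ball x ?e \<subseteq> ball x e1" "ball x ?e \<subseteq> ball x e2" by auto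
  have "smooth_on (ball x ?e) (\<lambda>y. H1 y / H2 y)"
    using smooth_on_subset[OF 1(3) sub(1)] smooth_on_subset[OF 2(3) sub(2)] 2(5) sub(2)
    by (intro smooth_on_divide) auto
  moreover have "?e > 0" "ball x ?e \<subseteq> ?V" using 1(1,2) 2(1) sub(1) by auto
  moreover have "H1 (snd c q) / H2 (snd c q) = sect_curv \<A> g X Y q"
    if q: "q \<in> U" "q \<in> fst c" "q \<notin> sing g" "snd c q \<in> ball x ?e" for q
  proof -
    have b: "snd c q \<in> ball x e1" "snd c q \<in> ball x e2" using q(4) sub by blast+
    have d: "det (GG c (snd c q)) \<noteq> 0" using sing_chart[OF c q(2)] q(3) by simp
    have "E q = g q (riem \<A> g X Y X q) (Y q)" using E(1) q by (simp add: smooth_extension_def)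
    then have "g q (riem \<A> g X Y X q) (Y q) = det (GG c (snd c q)) * H1 (snd c q)"
      using 1(4)[OF b(1)] c q(2) by simp
    moreover have "det (gram g q (X q) (Y q)) = det (GG c (snd c q)) * H2 (snd c q)"
      unfolding det_gram_chart[OF q(2)] by (rule 2(4)[OF b(2)])
    ultimately show ?thesis using d by (simp add: sect_curv_def)
  qed
  ultimately have "\<exists>V F'. open V \<and> p \<in> V \<and> V \<subseteq> U \<and> smooth_extension \<A> g V (sect_curv \<A> g X Y) F' \<and> F' p = H1 x / H2 x"
    by (intro smooth_extension_ball[OF ad p(1)])
  then show ?thesis by blast
qed

lemma riem_coords:
  assumes "open U" "q \<in> U" "q \<in> fst c" "q \<notin> sing g" "smooth_field \<A> U X'" "smooth_field \<A> U Y'" "smooth_field \<A> U Z'"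
  shows "g q (riem \<A> g X' Y' Z' q) (W' q) =
    Rm (GG c) (snd c q) (field_coords \<A> c X' (snd c q)) (field_coords \<A> c Y' (snd c q))
      (field_coords \<A> c Z' (snd c q)) (field_coords \<A> c W' (snd c q))"
  using riem_chart[OF c assms(3,1,2,4,5,6,7)] c assms(3) by simp

lemma extension_coords:
  assumes U: "open U" and s: "smooth_field \<A> U X'" "smooth_field \<A> U Y'" "smooth_field \<A> U Z'"
    and E: "smooth_extension \<A> g U (\<lambda>p. g p (riem \<A> g X' Y' Z' p) (W' p)) E"
    and y: "y \<in> snd c ` (fst c \<inter> U)" "y $ i \<noteq> 0"
  shows "(E \<circ> cinv c) y = Rm (GG c) y (field_coords \<A> c X' y) (field_coords \<A> c Y' y) (field_coords \<A> c Z' y) (field_coords \<A> c W' y)"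
proof -
  obtain q where q: "q \<in> fst c" "q \<in> U" "y = snd c q" using y(1) by auto
  have "q \<notin> sing g" using adaptedD(2)[OF ad q(1)] y(2) q(3) by simp
  from riem_coords[OF U q(2,1) this s] smooth_extension_coords(2)[OF E ad y] show ?thesis
    unfolding q(3) using c q(1) by simp
qed

text \<open>The mere existence of an extension of the numerator yields the degeneracy relation from
  which \<open>plane_tangent\<close> concludes.\<close>

lemma tangent_if_extends:
  assumes pl: "radical_plane \<A> g R U X Y" and pU: "p \<in> U"
    and E: "smooth_extension \<A> g U (\<lambda>p. g p (riem \<A> g X Y X p) (Y p)) E"
  shows "\<nu> g N p (X p) = 0 \<and> \<nu> g N p (Y p) = 0"
proof -
  note U = plane_smooth(1)[OF pl] and s = plane_smooth(2,3)[OF pl]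
  note im = chart_image[OF U pU]
  let ?X = "field_coords \<A> c X" and ?Y = "field_coords \<A> c Y"
  have sm: "smooth_on (snd c ` (fst c \<inter> U)) ?X" "smooth_on (snd c ` (fst c \<inter> U)) ?Y"
    using smooth_field_coords[OF _ c] s by auto
  have fx: "?X x = V (X p)" "?Y x = V (Y p)" using c p by simp_all
  have eq: "\<Gamma> (V (Y p)) (V (Y p)) r * \<Gamma> (V (X p)) (V (X p)) r = \<Gamma> (V (X p)) (V (Y p)) r * \<Gamma> (V (Y p)) (V (X p)) r"
    using F.Rm_extends_imp[OF im(1,2,3) xi r(1) sm(1,2,1,2) smooth_extension_coords(1)[OF E ad]
        extension_coords[OF U s(1,2,1) E]] unfolding fx .
  obtain \<alpha> \<beta> where r': "r = \<alpha> *\<^sub>R V (X p) + \<beta> *\<^sub>R V (Y p)" by (rule plane_coords[OF pl pU]) blast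
  from F.plane_tangent[OF xS xi r(1,4) r' eq] show ?thesis by (simp add: \<nu>_iff)
qed

lemma flat_on_subset: "F.flat_on W \<Longrightarrow> W' \<subseteq> W \<Longrightarrow> F.flat_on W'"
  unfolding F.flat_on_def by blast

lemma curvature_extends_at:
  assumes flat: "F.flat_on (snd c ` fst c)" and U: "open U" "p \<in> U"
    and s: "smooth_field \<A> U X'" "smooth_field \<A> U Y'" "smooth_field \<A> U Z'" "smooth_field \<A> U W'"
    and tan: "\<And>q. q \<in> U \<Longrightarrow> q \<in> sing g \<Longrightarrow> \<nu> g N q (X' q) = 0 \<and> \<nu> g N q (Y' q) = 0 \<and> \<nu> g N q (Z' q) = 0 \<and> \<nu> g N q (W' q) = 0"
    and val: "Z' p = X' p" "W' p = Y' p"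
    and D: "F.is_conn x (V (X' p)) (V (X' p)) D" "F.is_conn x (V (Y' p)) (V (X' p)) E"
  shows "\<exists>W F'. open W \<and> p \<in> W \<and> W \<subseteq> U \<and> smooth_extension \<A> g W (\<lambda>p. g p (riem \<A> g X' Y' Z' p) (W' p)) F' \<and>
    F' p = Hess (GG c) x (V (X' p)) (V (Y' p)) (V (X' p)) (V (Y' p)) + \<Gamma> (V (Y' p)) (V (Y' p)) D - \<Gamma> (V (X' p)) (V (Y' p)) E"
proof -
  note im = chart_image[OF U]
  let ?V = "snd c ` (fst c \<inter> U)"
  let ?X = "field_coords \<A> c X'" and ?Y = "field_coords \<A> c Y'" and ?Z = "field_coords \<A> c Z'" and ?W = "field_coords \<A> c W'"
  note sm = smooth_field_coords[OF s(1) c] smooth_field_coords[OF s(2) c] smooth_field_coords[OF s(3) c] smooth_field_coords[OF s(4) c]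
  have t: "?X y $ i = 0 \<and> ?Y y $ i = 0 \<and> ?Z y $ i = 0 \<and> ?W y $ i = 0" if y: "y \<in> ?V" "y $ i = 0" for y
  proof -
    obtain q where q: "q \<in> fst c" "q \<in> U" "y = snd c q" using y(1) by auto
    have qs: "q \<in> sing g" using adaptedD(2)[OF ad q(1)] y(2) q(3) by simp
    from tan[OF q(2) qs] show ?thesis unfolding \<nu>_tangent[OF q(1) qs] q(3) using c q(1) by simp
  qed
  have fx: "?X x = V (X' p)" "?Y x = V (Y' p)" "?Z x = V (X' p)" "?W x = V (Y' p)" using c p val by simp_all
  obtain e E' where E': "e > 0" "ball x e \<subseteq> ?V" "smooth_on (ball x e) E'"
    "\<And>y. y \<in> ball x e \<Longrightarrow> y $ i \<noteq> 0 \<Longrightarrow> E' y = Rm (GG c) y (?X y) (?Y y) (?Z y) (?W y)"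
    "\<And>D E. F.is_conn x (?X x) (?Z x) D \<Longrightarrow> F.is_conn x (?Y x) (?Z x) E \<Longrightarrow>
      E' x = Hess (GG c) x (?X x) (?Y x) (?Z x) (?W x) + \<Gamma> (?Y x) (?W x) D - \<Gamma> (?X x) (?W x) E"
    by (rule F.Rm_extends[OF im(1,2) flat_on_subset[OF flat im(2)] im(3) xi sm t]) blast+
  have "\<exists>W F'. open W \<and> p \<in> W \<and> W \<subseteq> U \<and> smooth_extension \<A> g W (\<lambda>p. g p (riem \<A> g X' Y' Z' p) (W' p)) F' \<and> F' p = E' x"
  proof (rule smooth_extension_ball[OF ad p(1) E'(1,2,3)])
    fix q assume q: "q \<in> U" "q \<in> fst c" "q \<notin> sing g" "snd c q \<in> ball x e"
    have "snd c q $ i \<noteq> 0" using adaptedD(2)[OF ad q(2)] q(3) by simp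
    from E'(4)[OF q(4) this] riem_coords[OF U(1) q(1,2,3) s(1,2,3)]
    show "E' (snd c q) = g q (riem \<A> g X' Y' Z' q) (W' q)" by simp
  qed
  then show ?thesis using E'(5)[unfolded fx, OF D] by simp
qed

lemma screen_polarize:
  assumes B: "\<And>v. v \<in> screen \<A> g N R p \<Longrightarrow> \<Gamma> (V v) (V v) w = 0"
    and uv: "u \<in> screen \<A> g N R p" "v \<in> screen \<A> g N R p"
  shows "\<Gamma> (V u) (V v) w = 0"
proof -
  have "u + v \<in> screen \<A> g N R p"
    using uv by (simp add: screen_iff linear_add[OF lin] F.Gam_linear[OF xS])
  then have "\<Gamma> (V u + V v) (V u + V v) w = 0" using B[of "u + v"] by (simp add: linear_add[OF lin])
  then show ?thesis
    using B[OF uv(1)] B[OF uv(2)] F.Gam_commute[OF xS, of "V v" "V u" w] by (simp add: F.Gam_linear[OF xS])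
qed

lemma Gam_radical:
  obtains k where "k \<noteq> 0" "\<And>u. \<Gamma> u r r = u $ i * k"
  using F.Gam_kernel_kernel[OF xS xi r(1,4)] by blast

lemma II_eq: "II \<A> g p (R p) u v = \<Gamma> (V u) (V v) r"
  by (rule II_chart[OF c p(1) R_Rad])

text \<open>Every tangent vector becomes a screen vector by adding a multiple of \<open>r\<close>,
  and \<open>Gam\<close>(r, b, r) = \<open>Gam\<close>(b, r, r) = 0 for tangent \<open>b\<close>.
  The radical being a line, \<open>r\<close> stands for all radical vectors.\<close>

lemma flat_at:
  assumes B: "\<And>u v. u \<in> screen \<A> g N R p \<Longrightarrow> v \<in> screen \<A> g N R p \<Longrightarrow> II \<A> g p (R p) u v = 0"
    and ab: "a $ i = 0" "b $ i = 0" and t: "GG c x *v t = 0"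
  shows "\<Gamma> a b t = 0"
proof -
  let ?J = "chart_deriv c (chart_at \<A> p) p"
  let ?a = "a + \<Gamma> a r n *\<^sub>R r" and ?b = "b + \<Gamma> b r n *\<^sub>R r"
  have VJ: "V (?J u) = u" for u using c p by simp
  have "?J ?a \<in> screen \<A> g N R p" "?J ?b \<in> screen \<A> g N R p"
    unfolding screen_iff VJ using ab r(2,3) by (simp_all add: F.Gam_linear[OF xS])
  then have 0: "\<Gamma> ?a ?b r = 0" using B unfolding II_eq by (metis VJ)
  obtain k where k: "\<And>u. \<Gamma> u r r = u $ i * k" using Gam_radical by blast
  have "\<Gamma> r b r = 0" using F.Gam_commute[OF xS, of r b r] k ab by simp
  then have "\<Gamma> a b r = 0"
    using 0 k[of a] k[of r] ab r(2) by (simp add: F.Gam_linear[OF xS])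
  moreover obtain l where "t = l *\<^sub>R r" using F.kernel_unique[OF xS xi r(1,4) t] by blast
  ultimately show ?thesis by (simp add: F.Gam_linear[OF xS])
qed

text \<open>The second factor \<open>Gam\<close>(n, r, r) in \<open>III_chart\<close> is nonzero,
  because \<open>n\<close> is transverse to the hypersurface.\<close>

lemma III_eq:
  assumes flat: "F.flat_on (snd c ` fst c)" and uv: "u \<in> screen \<A> g N R p" "v \<in> screen \<A> g N R p"
  shows "III \<A> g R p u v (R p) = 0 \<longleftrightarrow> \<Gamma> (V u) (V v) n = 0"
proof -
  have t: "u \<in> sing_tangent \<A> g p" "v \<in> sing_tangent \<A> g p" using uv by (auto simp: screen_def)
  have gn: "g p (N p) (N p) = 1" using main_normal p by (simp add: main_normal_def)
  obtain k where "k \<noteq> 0" "\<And>u. \<Gamma> u r r = u $ i * k" using Gam_radical by blast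
  then have "\<Gamma> n r r \<noteq> 0" using F.normal_decomposition(3)[OF xS n] by simp
  moreover have "III \<A> g R p u v (R p) = \<Gamma> (V u) (V v) n * \<Gamma> n r r"
    by (rule III_chart[where R = R and n = "N p"]) (rule ad p flat N_orthogonal gn R_Rad t | assumption)+
  ultimately show ?thesis by simp
qed

text \<open>No smooth field extending \<open>R\<close> is given, so \<open>X\<close> is the adjugate
  applied to a constant vector: it is radical along the hypersurface, hence spans the line of
  \<open>R\<close> there. \<open>Y\<close> has constant components. The neighbourhood is shrunk
  until \<open>X\<close> is nonzero, \<open>Y\<close> is not null and the Gram determinant divided
  by \<open>det\<close> has no zeros.\<close>

lemma plane_exists:
  assumes v: "V v $ i = 0" "GG c x *v V v \<noteq> 0"
  obtains U X Y where "radical_plane \<A> g R U X Y" "p \<in> U" "U \<subseteq> fst c" "X p = R p" "Y p = v"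
    "\<And>q. q \<in> U \<inter> sing g \<Longrightarrow> \<nu> g N q (X q) = 0 \<and> \<nu> g N q (Y q) = 0"
proof -
  let ?S = "snd c ` fst c" and ?v = "V v"
  obtain w0 where w0: "adj_vec (GG c x) w0 = r" using F.kernel_field[OF xS xi r(1,4)] by blast
  define X0 where "X0 y = adj_vec (GG c y) w0" for y
  have sX0: "smooth_on ?S X0" unfolding X0_def by (intro F.smooth_on_adj_vec smooth_on_const F.S order_refl)
  have X0k: "GG c y *v X0 y = 0" if "y \<in> ?S" "y $ i = 0" for y
    using F.G_adj_vec[OF that(1)] F.det_zero[OF that(1)] that(2) by (simp add: X0_def)
  let ?W = "{y \<in> ?S. X0 y \<bullet> X0 y * met (GG c) y ?v ?v \<noteq> 0}"
  have "continuous_on ?S (\<lambda>y. X0 y \<bullet> X0 y * met (GG c) y ?v ?v)"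
    by (intro smooth_on_imp_continuous_on smooth_on_mult smooth_on_inner F.smooth_on_met smooth_on_const sX0 F.S order_refl)
  from continuous_open_preimage[OF this F.S, of "- {0}"]
  have W: "open ?W" by (auto simp: vimage_def Int_def open_Compl)
  have vv: "met (GG c) x ?v ?v \<noteq> 0" using F.kernel_of_null[OF xS xi] v(2) by blast
  have xW: "x \<in> ?W" using xS vv r(4) w0 by (simp add: X0_def)
  have WS: "?W \<subseteq> ?S" by auto
  have gd0: "F.gram_det X0 (\<lambda>y. ?v) y = 0" if "y \<in> ?W" "y $ i = 0" for y
    using X0k[of y] F.met_commute[of y "X0 y"] that by (simp add: F.gram_det_def met_def)
  obtain e H where H: "e > 0" "ball x e \<subseteq> ?W" "smooth_on (ball x e) H"
    "\<And>y. y \<in> ball x e \<Longrightarrow> F.gram_det X0 (\<lambda>y. ?v) y = det (GG c y) * H y" "\<And>y. y \<in> ball x e \<Longrightarrow> H y \<noteq> 0"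
    by (rule F.gram_det_simple_zero[OF W WS xW xi smooth_on_subset[OF sX0 WS] smooth_on_const[OF W, of ?v] r(1), of 1 0])
       (use r(4) w0 v(2) gd0 in \<open>auto simp: X0_def\<close>)
  define U where "U = {q \<in> fst c. snd c q \<in> ball x e}"
  let ?X = "lift_field \<A> c X0" and ?Y = "lift_field \<A> c (\<lambda>y. ?v)"
  have U: "open U" "p \<in> U" "U \<subseteq> fst c"
    unfolding U_def using open_chart_preimage[OF c open_ball] H(1) p by auto
  have sub: "snd c ` U \<subseteq> ?S" using U by auto
  have sXY: "smooth_field \<A> U ?X" "smooth_field \<A> U ?Y"
    by (intro smooth_lift_field c U smooth_on_subset[OF sX0 sub] smooth_on_const open_image'[OF c])+
  have cX: "vec_coords \<A> c q (?X q) = X0 (snd c q)" "vec_coords \<A> c q (?Y q) = ?v" if "q \<in> U" for q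
    using that U(3) c by (auto simp: field_coords_lift_field)
  have inW: "snd c q \<in> ?W" if "q \<in> U" for q using that H(2) by (auto simp: U_def)
  have met: "g q (?X q) u = met (GG c) (snd c q) (X0 (snd c q)) (vec_coords \<A> c q u)"
    "g q (?Y q) u = met (GG c) (snd c q) ?v (vec_coords \<A> c q u)" if "q \<in> U" for q u
    using met_chart[OF c] that U(3) cX[OF that] by auto
  have dg: "det (gram g q (?X q) (?Y q)) = det (GG c (snd c q)) * H (snd c q)" if "q \<in> U" for q
  proof -
    have "snd c q \<in> ball x e" "snd c q \<in> ?S" using that U(3) by (auto simp: U_def)
    from H(4)[OF this(1)] F.met_commute[OF this(2), of ?v "X0 (snd c q)"] show ?thesis
      by (simp add: det_gram met[OF that] cX[OF that] F.gram_det_def power2_eq_square)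
  qed
  have singU: "q \<in> sing g \<longleftrightarrow> snd c q $ i = 0" if "q \<in> U" for q using that U(3) adaptedD(2)[OF ad] by auto
  have onS: "GG c (snd c q) *v X0 (snd c q) = 0" "X0 (snd c q) \<noteq> 0" "met (GG c) (snd c q) ?v ?v \<noteq> 0" "snd c q \<in> ?S"
    if "q \<in> U" "q \<in> sing g" for q
    using X0k[of "snd c q"] inW[OF that(1)] singU[OF that(1)] that(2) by auto
  have "radical_plane \<A> g R U ?X ?Y"
    unfolding radical_plane_def
  proof (intro conjI ballI U sXY)
    fix q assume q: "q \<in> U - sing g"
    then have qU: "q \<in> U" "q \<notin> sing g" by simp_all
    then have qc: "q \<in> fst c" "snd c q \<in> ball x e" by (simp_all add: U_def)
    have "det (GG c (snd c q)) \<noteq> 0" using sing_chart[OF c qc(1)] qU(2) by simp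
    then show "rank (gram g q (?X q) (?Y q)) = 2"
      unfolding rank_gram(1) dg[OF qU(1)] using H(5)[OF qc(2)] by simp
  next
    fix q assume q: "q \<in> U \<inter> sing g"
    then have qU: "q \<in> U" "q \<in> sing g" "q \<in> fst c" using U(3) by auto
    have "det (gram g q (?X q) (?Y q)) = 0" using dg[OF qU(1)] sing_chart[OF c qU(3)] qU(2) by simp
    then show "rank (gram g q (?X q) (?Y q)) = 1"
      by (rule rank_gram(3)) (use met(2)[OF qU(1)] cX(2)[OF qU(1)] onS(3)[OF qU(1,2)] in simp)
    interpret Q: framed_point \<A> g N R c i q by (rule framed_pointI[OF ad qU(3,2)])
    obtain k where "vec_coords \<A> c q (R q) = k *\<^sub>R X0 (snd c q)"
      using F.kernel_unique[OF Q.xS Q.xi onS(1,2)[OF qU(1,2)] Q.r(1)] by blast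
    then have "vec_coords \<A> c q (R q) = vec_coords \<A> c q (k *\<^sub>R ?X q)"
      using cX(1)[OF qU(1)] by (simp add: linear_scale[OF Q.lin])
    then have "R q = k *\<^sub>R ?X q" using vec_coords_inject[OF c qU(3)] by blast
    then show "R q \<in> span {?X q, ?Y q}" unfolding in_span_pair by (intro exI[of _ k] exI[of _ 0]) simp
  next
    fix q assume qU: "q \<in> U"
    have "s = 0 \<and> t = 0" if 0: "s *\<^sub>R ?X q + t *\<^sub>R ?Y q = 0" for s t
    proof -
      have lq: "linear (vec_coords \<A> c q)" using qU U(3) c by (intro vec_coords_linear) auto
      have zc: "s *\<^sub>R X0 (snd c q) + t *\<^sub>R ?v = 0"
        using arg_cong[OF 0, of "vec_coords \<A> c q"] cX[OF qU]
        by (simp add: linear_add[OF lq] linear_scale[OF lq] linear_0[OF lq])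
      have nz: "X0 (snd c q) \<noteq> 0" "met (GG c) (snd c q) ?v ?v \<noteq> 0" "snd c q \<in> ?S" using inW[OF qU] by auto
      let ?m = "met (GG c) (snd c q)" and ?x = "X0 (snd c q)"
      \<comment> \<open>On the hypersurface the relation is paired with \<open>Y\<close>, which is
        orthogonal to the radical \<open>X\<close>; off it, the nonzero Gram determinant gives
        independence.\<close>
      have "t = 0"
      proof (cases "q \<in> sing g")
        case True
        have "?m ?v (s *\<^sub>R ?x + t *\<^sub>R ?v) = t * ?m ?v ?v"
          using onS(1)[OF qU True] unfolding met_linear by (simp add: met_def)
        then show ?thesis using nz(2) unfolding zc by (simp add: met_linear)
      next
        case False
        have qc: "q \<in> fst c" "snd c q \<in> ball x e" using qU by (simp_all add: U_def)
        have "det (GG c (snd c q)) \<noteq> 0" using sing_chart[OF c qc(1)] False by simp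
        then have "F.gram_det X0 (\<lambda>y. ?v) (snd c q) \<noteq> 0"
          using H(4)[OF qc(2)] H(5)[OF qc(2)] by simp
        moreover have "t * F.gram_det X0 (\<lambda>y. ?v) (snd c q) =
           ?m ?x ?x * ?m ?v (s *\<^sub>R ?x + t *\<^sub>R ?v) - ?m ?x ?v * ?m ?x (s *\<^sub>R ?x + t *\<^sub>R ?v)"
          using F.met_commute[OF nz(3), of ?v ?x]
          by (simp add: F.gram_det_def met_linear power2_eq_square algebra_simps)
        then have "t * F.gram_det X0 (\<lambda>y. ?v) (snd c q) = 0" unfolding zc by (simp add: met_linear)
        ultimately show ?thesis by simp
      qed
      then show ?thesis using zc nz(1) by simp
    qed
    then show "?X q \<noteq> ?Y q" "independent {?X q, ?Y q}" using independent_pair_iff by blast+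
  qed
  moreover have "?X p = R p"
    using cX(1)[OF U(2)] w0 vec_coords_inject[OF c p(1)] by (simp add: X0_def)
  moreover have "?Y p = v" using cX(2)[OF U(2)] vec_coords_inject[OF c p(1)] by simp
  moreover have "\<nu> g N q (?X q) = 0 \<and> \<nu> g N q (?Y q) = 0" if "q \<in> U \<inter> sing g" for q
  proof -
    have q: "q \<in> U" "q \<in> sing g" "q \<in> fst c" using that U(3) by auto
    show ?thesis
      unfolding \<nu>_tangent[OF q(3,2)] cX[OF q(1)]
      using F.kernel_tangent[OF onS(4)[OF q(1,2)] _ onS(1)[OF q(1,2)]] singU[OF q(1)] q(2) v(1) by simp
  qed
  ultimately show ?thesis using that U by blast
qed

end

context framed_point
begin

text \<open>The extension \<open>X\<close> of \<open>R\<close> in the third argument is perturbed by a transverse field multiplied by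
  the determinant of the metric; this changes the value of the curvature by a nonzero multiple of
  \<open>II(v, v)\<close>.\<close>

lemma well_defined_imp_II_zero:
  assumes wd: "\<And>U X Y. radical_plane \<A> g R U X Y \<Longrightarrow> (\<forall>q \<in> U \<inter> sing g. \<nu> g N q (X q) = 0 \<and> \<nu> g N q (Y q) = 0) \<Longrightarrow>
      \<exists>h. sing_curv \<A> g U X Y h"
    and v: "v \<in> screen \<A> g N R p"
  shows "\<Gamma> (V v) (V v) r = 0"
proof (cases "GG c x *v V v = 0")
  \<comment> \<open>A radical \<open>v\<close> spans no plane with \<open>R p\<close> and is treated
    directly.\<close>
  case True
  then obtain l where l: "V v = l *\<^sub>R r" using F.kernel_unique[OF xS xi r(1,4)] by blast
  obtain k where "\<And>u. \<Gamma> u r r = u $ i * k" using Gam_radical by blast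
  then show ?thesis unfolding l using r(2) by (simp add: F.Gam_linear[OF xS])
next
  case False
  have vi: "V v $ i = 0" using v by (simp add: screen_iff)
  obtain U X Y where pl: "radical_plane \<A> g R U X Y" and pU: "p \<in> U" "U \<subseteq> fst c" and XY: "X p = R p" "Y p = v"
    and tan: "\<And>q. q \<in> U \<inter> sing g \<Longrightarrow> \<nu> g N q (X q) = 0 \<and> \<nu> g N q (Y q) = 0"
    by (rule plane_exists[OF vi False]) blast
  obtain h where h: "sing_curv \<A> g U X Y h" using wd[OF pl] tan by blast
  note U = plane_smooth(1)[OF pl] and s = plane_smooth(2,3)[OF pl]
  note im = chart_image[OF U pU(1)]
  let ?U = "snd c ` (fst c \<inter> U)"
  let ?X = "field_coords \<A> c X" and ?Y = "field_coords \<A> c Y"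
  have UU: "?U = snd c ` U" using pU(2) by (simp add: Int_absorb1)
  note sm = smooth_field_coords[OF s(1) c] smooth_field_coords[OF s(2) c]
  define Z where "Z = lift_field \<A> c (\<lambda>y. ?X y + det (GG c y) *\<^sub>R axis i 1)"
  have sZ: "smooth_field \<A> U Z"
    unfolding Z_def
    by (rule smooth_lift_field[OF c U pU(2)])
       (use sm(1) im in \<open>unfold UU, intro smooth_on_add smooth_on_scaleR smooth_on_const F.smooth_on_det_G\<close>)
  have cZ: "vec_coords \<A> c q (Z q) = vec_coords \<A> c q (X q) + det (GG c (snd c q)) *\<^sub>R axis i 1" if "q \<in> U" for q
  proof -
    have "q \<in> fst c" using that pU(2) by blast
    then show ?thesis using c by (simp add: Z_def field_coords_lift_field)
  qed
  have ZX: "Z q = X q" if q: "q \<in> U \<inter> sing g" for q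
  proof -
    have qc: "q \<in> fst c" "q \<in> U" "q \<in> sing g" using q pU(2) by auto
    have "det (GG c (snd c q)) = 0" using sing_chart[OF c qc(1)] qc(3) by simp
    then have "vec_coords \<A> c q (Z q) = vec_coords \<A> c q (X q)" unfolding cZ[OF qc(2)] by simp
    then show ?thesis using vec_coords_inject[OF c qc(1)] by blast
  qed
  obtain F1 where F1: "smooth_extension \<A> g U (\<lambda>p. g p (riem \<A> g X Y X p) (Y p)) F1" "\<forall>q\<in>U \<inter> sing g. F1 q = h q"
    using h[unfolded sing_curv_def, rule_format, of X Y X Y] s by blast
  obtain F2 where F2: "smooth_extension \<A> g U (\<lambda>p. g p (riem \<A> g X Y Z p) (Y p)) F2" "\<forall>q\<in>U \<inter> sing g. F2 q = h q"
    using h[unfolded sing_curv_def, rule_format, of X Y Z Y] s sZ ZX by blast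
  let ?E = "\<lambda>y. (F2 \<circ> cinv c) y - (F1 \<circ> cinv c) y"
  have sE: "smooth_on ?U ?E"
    by (rule smooth_on_diff[OF im(1) smooth_extension_coords(1)[OF F2(1) ad] smooth_extension_coords(1)[OF F1(1) ad]])
  have E0: "?E y = 0" if y: "y \<in> ?U" "y $ i = 0" for y
  proof -
    obtain q where q: "q \<in> fst c" "q \<in> U" "y = snd c q" using y(1) by auto
    have "q \<in> sing g" using adaptedD(2)[OF ad q(1)] y(2) q(3) by simp
    then show ?thesis using F1(2) F2(2) q c by simp
  qed
  \<comment> \<open>Both extensions restrict to \<open>h\<close>, so their difference vanishes on
    the hypersurface. Divided by \<open>det\<close> it becomes an extension of the curvature with
    the transverse axis vector in the third slot.\<close>
  obtain e H where H: "e > 0" "ball x e \<subseteq> ?U" "smooth_on (ball x e) H"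
    "\<And>y. y \<in> ball x e \<Longrightarrow> ?E y = det (GG c y) *\<^sub>R H y"
    by (rule F.quotient_by_det[OF im(1,2,3) xi sE E0]) blast+
  have Heq: "H y = Rm (GG c) y (?X y) (?Y y) (axis i 1) (?Y y)" if y: "y \<in> ball x e" "y $ i \<noteq> 0" for y
  proof -
    have yU: "y \<in> ?U" using H(2) y(1) by blast
    then have yS: "y \<in> snd c ` fst c" by auto
    have d: "det (GG c y) \<noteq> 0" using F.det_zero[OF yS] y(2) by simp
    obtain q where q: "q \<in> fst c" "q \<in> U" "y = snd c q" using yU by auto
    have Zy: "field_coords \<A> c Z y = ?X y + det (GG c y) *\<^sub>R axis i 1"
      using cZ[OF q(2)] q(1,3) c by simp
    have "?E y = det (GG c y) * Rm (GG c) y (?X y) (?Y y) (axis i 1) (?Y y)"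
      unfolding extension_coords[OF U s(1,2) sZ F2(1) yU y(2)] extension_coords[OF U s(1,2,1) F1(1) yU y(2)] Zy
        F.Rm_third[OF yS d] by simp
    then show ?thesis using H(4)[OF y(1)] d by simp
  qed
  have sub: "smooth_on (ball x e) ?X" "smooth_on (ball x e) ?Y" "ball x e \<subseteq> snd c ` fst c" "x \<in> ball x e"
    using smooth_on_subset[OF sm(1) H(2)] smooth_on_subset[OF sm(2) H(2)] H(1,2) im(2) by auto
  have fx: "?X x = r" "?Y x = V v" using c p XY by simp_all
  have "\<Gamma> (V v) (V v) r * \<Gamma> r (axis i 1) r = \<Gamma> r (V v) r * \<Gamma> (V v) (axis i 1) r"
    using F.Rm_extends_imp[OF open_ball sub(3,4) xi r(1) sub(1,2) smooth_on_const[OF open_ball, of _ _ "axis i 1"] sub(2) H(3) Heq]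
    unfolding fx .
  moreover obtain k where k: "k \<noteq> 0" "\<And>u. \<Gamma> u r r = u $ i * k" using Gam_radical by blast
  have "\<Gamma> r (V v) r = 0" "\<Gamma> r (axis i 1) r = k"
    using F.Gam_commute[OF xS, of r "V v" r] F.Gam_commute[OF xS, of r "axis i 1" r] k(2)[of "V v"] k(2)[of "axis i 1"] vi
    by simp_all
  ultimately show ?thesis using k(1) by simp
qed

text \<open>On the plane of \<open>R p\<close> and a screen vector the curvature formula reduces to
  -\<H>(v, v), because \<H>(r, r) = -1 and \<H>(r, v) = 0.\<close>

lemma curvature_zero_imp_H_zero:
  assumes zero: "\<And>U X Y. radical_plane \<A> g R U X Y \<Longrightarrow> (\<forall>q \<in> U \<inter> sing g. \<nu> g N q (X q) = 0 \<and> \<nu> g N q (Y q) = 0) \<Longrightarrow>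
      sing_curv \<A> g U X Y (\<lambda>q. 0)"
    and flat: "F.flat_on (snd c ` fst c)" and v: "v \<in> screen \<A> g N R p"
  shows "\<Gamma> (V v) (V v) n = 0"
proof (cases "GG c x *v V v = 0")
  case True
  then obtain l where l: "V v = l *\<^sub>R r" using F.kernel_unique[OF xS xi r(1,4)] by blast
  then have "l = 0" using v r(3) by (simp add: screen_iff F.Gam_linear[OF xS])
  then show ?thesis unfolding l by (simp add: F.Gam_linear[OF xS])
next
  case False
  have vi: "V v $ i = 0" and vs: "\<Gamma> (V v) r n = 0" using v by (simp_all add: screen_iff)
  obtain U X Y where pl: "radical_plane \<A> g R U X Y" and pU: "p \<in> U" "U \<subseteq> fst c" and XY: "X p = R p" "Y p = v"
    and tan: "\<And>q. q \<in> U \<inter> sing g \<Longrightarrow> \<nu> g N q (X q) = 0 \<and> \<nu> g N q (Y q) = 0"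
    by (rule plane_exists[OF vi False]) blast
  note U = plane_smooth(1)[OF pl] and s = plane_smooth(2,3)[OF pl]
  have "sing_curv \<A> g U X Y (\<lambda>q. 0)" using zero[OF pl] tan by blast
  then obtain F1 where F1: "smooth_extension \<A> g U (\<lambda>p. g p (riem \<A> g X Y X p) (Y p)) F1" "\<forall>q\<in>U \<inter> sing g. F1 q = 0"
    using s unfolding sing_curv_def by blast
  have fl: "Gam (GG c) y a b t = 0" if "a $ i = 0" "b $ i = 0" "y \<in> snd c ` fst c" "y $ i = 0" "GG c y *v t = 0" for y a b t
    using flat that unfolding F.flat_on_def by blast
  obtain D where D: "F.is_conn x r r D" using F.is_conn_exists[OF xS xi fl[OF r(2,2)]] by blast
  obtain E where E: "F.is_conn x (V v) r E" using F.is_conn_exists[OF xS xi fl[OF vi r(2)]] by blast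
  have "\<exists>W F'. open W \<and> p \<in> W \<and> W \<subseteq> U \<and> smooth_extension \<A> g W (\<lambda>p. g p (riem \<A> g X Y X p) (Y p)) F' \<and>
    F' p = Hess (GG c) x (V (X p)) (V (Y p)) (V (X p)) (V (Y p)) + \<Gamma> (V (Y p)) (V (Y p)) D - \<Gamma> (V (X p)) (V (Y p)) E"
    by (rule curvature_extends_at[OF flat U pU(1) s(1,2,1,2)]) (use tan D E XY in simp_all)
  then obtain W F' where W: "open W" "p \<in> W" "smooth_extension \<A> g W (\<lambda>p. g p (riem \<A> g X Y X p) (Y p)) F'"
    and val: "F' p = Hess (GG c) x r (V v) r (V v) + \<Gamma> (V v) (V v) D - \<Gamma> r (V v) E"
    unfolding XY by blast
  have "F' p = 0"
    using smooth_extension_unique[OF W(3) F1(1) W(1) U W(2) pU(1)] F1(2) pU(1) p(2) by simp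
  with val F.flat_curvature_radical[OF F.S order_refl flat xS xi r(1,4) vi n D E]
  show ?thesis using vs r(3) F.Gam_commute[OF xS, of r "V v" n] by simp
qed

end

section \<open>From single points to the whole hypersurface\<close>

context framed_metric
begin

lemma II_flat_imp_flat_on:
  assumes "II_flat \<A> g N R" and ad: "adapted c i"
  shows "flattened_metric.flat_on (GG c) i (snd c ` fst c)"
proof -
  interpret F: flattened_metric "snd c ` fst c" "GG c" i by (rule flattened_metric_chart[OF ad])
  show ?thesis
    unfolding F.flat_on_def
  proof (intro ballI impI allI)
    fix y a b t :: "real^'n" assume y: "y \<in> snd c ` fst c" "y $ i = 0" and h: "a $ i = 0" "b $ i = 0" "GG c y *v t = 0"
    obtain q where q: "q \<in> fst c" "y = snd c q" using y(1) by auto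
    have "q \<in> sing g" using adaptedD(2)[OF ad q(1)] y(2) q(2) by simp
    then interpret framed_point \<A> g N R c i q by (intro framed_pointI ad q(1))
    show "Gam (GG c) y a b t = 0"
      unfolding q(2) by (rule flat_at[OF _ h[unfolded q(2)]]) (use assms(1) p in \<open>simp add: II_flat_def\<close>)
  qed
qed

text \<open>The value at each point is computed in some adapted chart, but \<open>ext\<close>
  mentions no chart, so values can be chosen point by point without comparing charts. The clause on
  III-flatness travels along so that the chosen \<open>h\<close> is also known to vanish in that
  case.\<close>

lemma curvature_well_defined:
  assumes fl: "II_flat \<A> g N R" and pl: "radical_plane \<A> g R U X Y"
    and tan: "\<forall>q \<in> U \<inter> sing g. \<nu> g N q (X q) = 0 \<and> \<nu> g N q (Y q) = 0"
  shows "\<exists>h. sing_curv \<A> g U X Y h \<and> (III_flat \<A> g N R \<longrightarrow> (\<forall>q \<in> U \<inter> sing g. h q = 0))"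
proof -
  have U: "open U" using pl by (simp add: radical_plane_def)
  define ext where "ext p s \<longleftrightarrow> (\<forall>X' Y' Z' W'. smooth_field \<A> U X' \<and> smooth_field \<A> U Y' \<and> smooth_field \<A> U Z' \<and> smooth_field \<A> U W' \<and>
      (\<forall>q. q \<in> U \<longrightarrow> q \<in> sing g \<longrightarrow> X' q = X q \<and> Y' q = Y q \<and> Z' q = X q \<and> W' q = Y q) \<longrightarrow>
      (\<exists>V F'. open V \<and> p \<in> V \<and> V \<subseteq> U \<and> smooth_extension \<A> g V (\<lambda>p. g p (riem \<A> g X' Y' Z' p) (W' p)) F' \<and> F' p = s))" for p s
  have "\<exists>s. ext p s \<and> (III_flat \<A> g N R \<longrightarrow> s = 0)" if pS: "p \<in> U" "p \<in> sing g" for p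
  proof -
    obtain c i where ad: "adapted c i" and pc: "p \<in> fst c" using adapted_chart_exists[OF pS(2)] .
    interpret framed_point \<A> g N R c i p by (rule framed_pointI[OF ad pc pS(2)])
    have flat: "F.flat_on (snd c ` fst c)" by (rule II_flat_imp_flat_on[OF fl ad])
    have f0: "Gam (GG c) y a b t = 0" if "a $ i = 0" "b $ i = 0" "y \<in> snd c ` fst c" "y $ i = 0" "GG c y *v t = 0" for y a b t
      using flat that unfolding F.flat_on_def by blast
    have "\<nu> g N p (X p) = 0" "\<nu> g N p (Y p) = 0" using tan pS by auto
    then have ti: "V (X p) $ i = 0" "V (Y p) $ i = 0" by (simp_all add: \<nu>_iff)
    obtain D where D: "F.is_conn x (V (X p)) (V (X p)) D" using F.is_conn_exists[OF xS xi f0[OF ti(1,1)]] by blast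
    obtain E where E: "F.is_conn x (V (Y p)) (V (X p)) E" using F.is_conn_exists[OF xS xi f0[OF ti(2,1)]] by blast
    obtain B where B: "F.is_conn x (V (Y p)) (V (Y p)) B" using F.is_conn_exists[OF xS xi f0[OF ti(2,2)]] by blast
    define s where "s = Hess (GG c) x (V (X p)) (V (Y p)) (V (X p)) (V (Y p)) + \<Gamma> (V (Y p)) (V (Y p)) D - \<Gamma> (V (X p)) (V (Y p)) E"
    have "ext p s"
      unfolding ext_def
    proof (intro allI impI, elim conjE)
      fix X' Y' Z' W'
      assume sm: "smooth_field \<A> U X'" "smooth_field \<A> U Y'" "smooth_field \<A> U Z'" "smooth_field \<A> U W'"
        and e: "\<forall>q. q \<in> U \<longrightarrow> q \<in> sing g \<longrightarrow> X' q = X q \<and> Y' q = Y q \<and> Z' q = X q \<and> W' q = Y q"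
      have ep: "X' p = X p" "Y' p = Y p" "Z' p = X p" "W' p = Y p" using e pS by auto
      have val: "Z' p = X' p" "W' p = Y' p" using ep by simp_all
      have tan': "\<nu> g N q (X' q) = 0 \<and> \<nu> g N q (Y' q) = 0 \<and> \<nu> g N q (Z' q) = 0 \<and> \<nu> g N q (W' q) = 0"
        if "q \<in> U" "q \<in> sing g" for q
        using e tan that by auto
      show "\<exists>V F'. open V \<and> p \<in> V \<and> V \<subseteq> U \<and> smooth_extension \<A> g V (\<lambda>p. g p (riem \<A> g X' Y' Z' p) (W' p)) F' \<and> F' p = s"
        using curvature_extends_at[OF flat U pS(1) sm tan' val D[folded ep(1)] E[folded ep(1,2)]]
        unfolding ep s_def .
    qed
    moreover have "s = 0" if III: "III_flat \<A> g N R"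
    proof -
      obtain \<alpha> \<beta> where r': "r = \<alpha> *\<^sub>R V (X p) + \<beta> *\<^sub>R V (Y p)" by (rule plane_coords[OF pl pS(1)]) blast
      have scr: "\<Gamma> u u n = 0" if "u $ i = 0" "\<Gamma> u r n = 0" for u
      proof -
        let ?u = "chart_deriv c (chart_at \<A> p) p u"
        have Vu: "V ?u = u" using c pc by simp
        have "?u \<in> screen \<A> g N R p" unfolding screen_iff Vu using that by blast
        then show ?thesis
          using III_eq[OF flat, of ?u ?u] III pS(2) unfolding III_flat_def Vu by blast
      qed
      show ?thesis
        unfolding s_def by (rule F.plane_curvature_zero[OF F.S order_refl flat xS xi r(1,4) r' ti n r(3) scr D E B])
    qed
    ultimately show ?thesis by blast
  qed
  then have "\<forall>p \<in> U \<inter> sing g. \<exists>s. ext p s \<and> (III_flat \<A> g N R \<longrightarrow> s = 0)" by blast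
  from bchoice[OF this] obtain h where h: "\<forall>p \<in> U \<inter> sing g. ext p (h p) \<and> (III_flat \<A> g N R \<longrightarrow> h p = 0)" ..
  have "sing_curv \<A> g U X Y h"
  proof (rule sing_curvI[OF U])
    fix p X' Y' Z' W'
    assume p: "p \<in> U" "p \<in> sing g"
      and s: "smooth_field \<A> U X'" "smooth_field \<A> U Y'" "smooth_field \<A> U Z'" "smooth_field \<A> U W'"
        "\<And>q. q \<in> U \<Longrightarrow> q \<in> sing g \<Longrightarrow> X' q = X q \<and> Y' q = Y q \<and> Z' q = X q \<and> W' q = Y q"
    have "ext p (h p)" using h p by blast
    then show "\<exists>V F'. open V \<and> p \<in> V \<and> V \<subseteq> U \<and> smooth_extension \<A> g V (\<lambda>p. g p (riem \<A> g X' Y' Z' p) (W' p)) F' \<and> F' p = h p"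
      unfolding ext_def by (elim allE[of _ X'] allE[of _ Y'] allE[of _ Z'] allE[of _ W'] impE) (intro conjI allI impI s)
  qed
  with h show ?thesis by blast
qed

lemma well_defined_imp_II_flat:
  assumes wd: "\<And>U X Y. radical_plane \<A> g R U X Y \<Longrightarrow> (\<forall>q \<in> U \<inter> sing g. \<nu> g N q (X q) = 0 \<and> \<nu> g N q (Y q) = 0) \<Longrightarrow>
      \<exists>h. sing_curv \<A> g U X Y h"
  shows "II_flat \<A> g N R"
  unfolding II_flat_def
proof (intro ballI)
  fix p u v assume p: "p \<in> sing g" and uv: "u \<in> screen \<A> g N R p" "v \<in> screen \<A> g N R p"
  obtain c i where ad: "adapted c i" and pc: "p \<in> fst c" using adapted_chart_exists[OF p] .
  interpret framed_point \<A> g N R c i p by (rule framed_pointI[OF ad pc p])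
  show "II \<A> g p (R p) u v = 0"
    unfolding II_eq by (rule screen_polarize[OF well_defined_imp_II_zero[OF wd] uv])
qed

lemma curvature_zero_imp_III_flat:
  assumes zero: "\<And>U X Y. radical_plane \<A> g R U X Y \<Longrightarrow> (\<forall>q \<in> U \<inter> sing g. \<nu> g N q (X q) = 0 \<and> \<nu> g N q (Y q) = 0) \<Longrightarrow>
      sing_curv \<A> g U X Y (\<lambda>q. 0)"
  shows "III_flat \<A> g N R"
proof -
  have fl: "II_flat \<A> g N R" by (rule well_defined_imp_II_flat) (use zero in blast)
  have "III \<A> g R p u v (R p) = 0" if p: "p \<in> sing g" and uv: "u \<in> screen \<A> g N R p" "v \<in> screen \<A> g N R p" for p u v
  proof -
    obtain c i where ad: "adapted c i" and pc: "p \<in> fst c" using adapted_chart_exists[OF p] .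
    interpret framed_point \<A> g N R c i p by (rule framed_pointI[OF ad pc p])
    have flat: "F.flat_on (snd c ` fst c)" by (rule II_flat_imp_flat_on[OF fl ad])
    show ?thesis
      unfolding III_eq[OF flat uv] by (rule screen_polarize[OF curvature_zero_imp_H_zero[OF zero flat] uv])
  qed
  with fl show ?thesis by (simp add: III_flat_def)
qed

lemma framed_point_exists:
  assumes "p \<in> sing g"
  obtains c i where "framed_point \<A> g N R c i p"
proof -
  obtain c i where "adapted c i" "p \<in> fst c" using adapted_chart_exists[OF assms] .
  from framed_pointI[OF this assms] show ?thesis by (rule that)
qed

text \<open>The extension is multiplied by the Gram determinant, which is smooth everywhere and
  vanishes on the hypersurface.\<close>

lemma sect_curv_extension_imp:
  assumes pl: "radical_plane \<A> g R U X Y" and F: "smooth_extension \<A> g U (sect_curv \<A> g X Y) F"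
  shows "\<exists>E. smooth_extension \<A> g U (\<lambda>p. g p (riem \<A> g X Y X p) (Y p)) E \<and> (\<forall>p \<in> U \<inter> sing g. E p = 0)"
proof -
  have U: "open U" and s: "smooth_field \<A> U X" "smooth_field \<A> U Y" using pl by (auto simp: radical_plane_def)
  let ?d = "\<lambda>p. det (gram g p (X p) (Y p))"
  have mult: "smooth_fun \<A> U (\<lambda>p. f p * h p)" "smooth_fun \<A> U (\<lambda>p. f p - h p)" if "smooth_fun \<A> U f" "smooth_fun \<A> U h" for f h
  proof -
    have "smooth_on (snd c ` (fst c \<inter> U)) ((\<lambda>p. f p * h p) \<circ> cinv c)" "smooth_on (snd c ` (fst c \<inter> U)) ((\<lambda>p. f p - h p) \<circ> cinv c)"
      if c: "c \<in> \<A>" for c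
      using smooth_on_mult[OF open_image[OF c U] smooth_fun_coords[OF \<open>smooth_fun \<A> U f\<close> c] smooth_fun_coords[OF \<open>smooth_fun \<A> U h\<close> c]]
        smooth_on_diff[OF open_image[OF c U] smooth_fun_coords[OF \<open>smooth_fun \<A> U f\<close> c] smooth_fun_coords[OF \<open>smooth_fun \<A> U h\<close> c]]
      by (simp_all add: o_def)
    then show "smooth_fun \<A> U (\<lambda>p. f p * h p)" "smooth_fun \<A> U (\<lambda>p. f p - h p)" by (simp_all add: smooth_fun_def)
  qed
  have "smooth_fun \<A> U ?d" unfolding det_gram by (intro mult smooth_g[OF U] s)
  then have "smooth_fun \<A> U (\<lambda>p. F p * ?d p)" using F by (intro mult) (simp_all add: smooth_extension_def)
  moreover have "F p * ?d p = g p (riem \<A> g X Y X p) (Y p)" if p: "p \<in> U - sing g" for p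
  proof -
    have "rank (gram g p (X p) (Y p)) = 2" using pl p by (simp add: radical_plane_def)
    then have "?d p \<noteq> 0" unfolding rank_gram(1) .
    moreover have "F p = sect_curv \<A> g X Y p" using F p by (simp add: smooth_extension_def)
    ultimately show ?thesis by (simp add: sect_curv_def)
  qed
  moreover have "F p * ?d p = 0" if p: "p \<in> U \<inter> sing g" for p
  proof -
    have "rank (gram g p (X p) (Y p)) = 1" using pl p by (simp add: radical_plane_def)
    from rank_gram(2)[OF this] show ?thesis by simp
  qed
  ultimately show ?thesis
    by (intro exI[of _ "\<lambda>p. F p * ?d p"]) (simp add: smooth_extension_def)
qed

lemma sect_curv_extension_if:
  assumes pl: "radical_plane \<A> g R U X Y"
    and E: "smooth_extension \<A> g U (\<lambda>p. g p (riem \<A> g X Y X p) (Y p)) E" "\<And>p. p \<in> U \<inter> sing g \<Longrightarrow> E p = 0"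
  shows "\<exists>F. smooth_extension \<A> g U (sect_curv \<A> g X Y) F"
proof -
  have U: "open U" and s: "smooth_field \<A> U X" "smooth_field \<A> U Y" using pl by (auto simp: radical_plane_def)
  let ?K = "sect_curv \<A> g X Y" and ?U = "U - sing g"
  have oU: "open ?U" using U open_compl_sing by (simp add: Diff_eq open_Int)
  have "smooth_fun \<A> ?U ?K"
    unfolding smooth_fun_def
  proof
    fix c assume c: "c \<in> \<A>"
    have sU: "smooth_field \<A> ?U X" "smooth_field \<A> ?U Y" using s smooth_field_subset by blast+
    note sm = smooth_fun_coords[OF smooth_riem[OF U s(1,2,1,2)] c]
    let ?d = "\<lambda>p. det (gram g p (X p) (Y p))"
    have "smooth_on (snd c ` (fst c \<inter> ?U)) (\<lambda>y. ((\<lambda>p. g p (X p) (X p)) \<circ> cinv c) y * ((\<lambda>p. g p (Y p) (Y p)) \<circ> cinv c) y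
        - ((\<lambda>p. g p (X p) (Y p)) \<circ> cinv c) y * ((\<lambda>p. g p (Y p) (X p)) \<circ> cinv c) y)"
      by (intro smooth_on_diff smooth_on_mult open_image[OF c oU] smooth_fun_coords[OF smooth_g[OF oU] c] sU)
    then have sd: "smooth_on (snd c ` (fst c \<inter> ?U)) (?d \<circ> cinv c)" by (simp add: det_gram o_def)
    have "(?d \<circ> cinv c) y \<noteq> 0" if y: "y \<in> snd c ` (fst c \<inter> ?U)" for y
    proof -
      obtain q where q: "q \<in> fst c" "q \<in> ?U" "y = snd c q" using y by auto
      have "rank (gram g q (X q) (Y q)) = 2" using pl q(2) by (simp add: radical_plane_def)
      then show ?thesis unfolding rank_gram(1) using q c by simp
    qed
    from smooth_on_divide[OF open_image[OF c oU] sm sd this]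
    show "smooth_on (snd c ` (fst c \<inter> ?U)) (?K \<circ> cinv c)" by (simp add: sect_curv_def o_def)
  qed
  then have off: "smooth_extension \<A> g ?U ?K ?K" by (simp add: smooth_extension_def)
  have "\<exists>F. smooth_extension \<A> g U ?K F \<and> (\<forall>p\<in>U \<inter> sing g. (\<lambda>p v. True) p (F p))"
  proof (rule smooth_extension_local)
    fix p assume pU: "p \<in> U"
    have "\<exists>V F'. open V \<and> p \<in> V \<and> V \<subseteq> U \<and> smooth_extension \<A> g V ?K F'"
    proof (cases "p \<in> sing g")
      case True
      obtain c i where "framed_point \<A> g N R c i p" using framed_point_exists[OF True] .
      then interpret framed_point \<A> g N R c i p .
      show ?thesis by (rule sect_curv_extends_at[OF pl pU E])
    next
      case False
      then show ?thesis using oU off pU by (intro exI[of _ ?U] exI[of _ ?K]) simp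
    qed
    then show "\<exists>V F'. open V \<and> p \<in> V \<and> V \<subseteq> U \<and> smooth_extension \<A> g V ?K F' \<and> (p \<in> sing g \<longrightarrow> (\<lambda>p v. True) p (F' p))"
      by simp
  qed
  then show ?thesis by blast
qed

end

theorem proposition18:
  fixes \<A> :: "('a::{t2_space,second_countable_topology}, 'n::finite) chart set"
    and g :: "('a, 'n) metric"
    and N R :: "'a \<Rightarrow> real^'n"
  assumes "smooth_structure \<A>" and "connected (UNIV :: 'a set)" and "CARD('n) > 2"
    and "transverse_singular \<A> g" and "riemann_lorentz g" and "tangent_radical \<A> g"
    and "main_normal \<A> g N" and "main_radical \<A> g N R"
  shows
    "(\<forall>U X Y. radical_plane \<A> g R U X Y \<longrightarrow>
       ((\<exists>F. smooth_extension \<A> g U (sect_curv \<A> g X Y) F) \<longleftrightarrow>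
        (\<exists>F. smooth_extension \<A> g U (\<lambda>p. g p (riem \<A> g X Y X p) (Y p)) F \<and>
             (\<forall>p \<in> U \<inter> sing g. F p = 0))) \<and>
       ((\<exists>F. smooth_extension \<A> g U (sect_curv \<A> g X Y) F) \<longrightarrow>
        (\<forall>p \<in> U \<inter> sing g. \<nu> g N p (X p) = 0 \<and> \<nu> g N p (Y p) = 0)))
     \<and>
     (\<forall>U X Y. radical_plane \<A> g R U X Y \<longrightarrow>
       (\<forall>p \<in> U \<inter> sing g. \<nu> g N p (X p) = 0 \<and> \<nu> g N p (Y p) = 0 \<longrightarrow>
          dim (span {screen_part \<A> g N R p (X p), screen_part \<A> g N R p (Y p)}) = 1))
     \<and>
     ((\<forall>U X Y. radical_plane \<A> g R U X Y \<longrightarrow>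
         (\<forall>p \<in> U \<inter> sing g. \<nu> g N p (X p) = 0 \<and> \<nu> g N p (Y p) = 0) \<longrightarrow>
         sing_curv \<A> g U X Y (\<lambda>p. 0))
       \<longleftrightarrow> III_flat \<A> g N R)
     \<and>
     (III_flat \<A> g N R \<longrightarrow> II_flat \<A> g N R)
     \<and>
     (II_flat \<A> g N R \<longleftrightarrow>
       (\<forall>U X Y. radical_plane \<A> g R U X Y \<longrightarrow>
         (\<forall>p \<in> U \<inter> sing g. \<nu> g N p (X p) = 0 \<and> \<nu> g N p (Y p) = 0) \<longrightarrow>
         (\<exists>h. sing_curv \<A> g U X Y h)))"
proof -
  have "smooth_symmetric_tensor \<A> g" using assms(4) by (simp add: transverse_singular_def)
  then interpret framed_metric \<A> g N R
    by (intro framed_metric.intro framed_metric_axioms.intro singular_metric.intro singular_metric_axioms.intro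
        manifold_metric.intro manifold_metric_axioms.intro smooth_manifold.intro assms)
  have tangent: "\<nu> g N p (X p) = 0 \<and> \<nu> g N p (Y p) = 0"
    if pl: "radical_plane \<A> g R U X Y" and F: "smooth_extension \<A> g U (sect_curv \<A> g X Y) F" and pU: "p \<in> U \<inter> sing g" for U X Y F p
  proof -
    obtain E where E: "smooth_extension \<A> g U (\<lambda>p. g p (riem \<A> g X Y X p) (Y p)) E"
      using sect_curv_extension_imp[OF pl F] by blast
    have "p \<in> sing g" using pU by blast
    then obtain c i where "framed_point \<A> g N R c i p" using framed_point_exists by blast
    then interpret framed_point \<A> g N R c i p .
    show ?thesis using tangent_if_extends[OF pl _ E] pU by blast
  qed
  have dims: "dim (span {screen_part \<A> g N R p (X p), screen_part \<A> g N R p (Y p)}) = 1"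
    if pl: "radical_plane \<A> g R U X Y" and pU: "p \<in> U \<inter> sing g" and \<nu>: "\<nu> g N p (X p) = 0" "\<nu> g N p (Y p) = 0" for U X Y p
  proof -
    have "p \<in> sing g" using pU by blast
    then obtain c i where "framed_point \<A> g N R c i p" using framed_point_exists by blast
    then interpret framed_point \<A> g N R c i p .
    show ?thesis using dim_screen_parts[OF pl _ \<nu>] pU by blast
  qed
  have zero: "sing_curv \<A> g U X Y (\<lambda>p. 0)"
    if III: "III_flat \<A> g N R" and pl: "radical_plane \<A> g R U X Y"
      and tan: "\<forall>p \<in> U \<inter> sing g. \<nu> g N p (X p) = 0 \<and> \<nu> g N p (Y p) = 0" for U X Y
  proof -
    have "II_flat \<A> g N R" using III by (simp add: III_flat_def)
    from curvature_well_defined[OF this pl tan] obtain h where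
      h: "sing_curv \<A> g U X Y h" "\<forall>q \<in> U \<inter> sing g. h q = 0" using III by blast
    \<comment> \<open>\<open>sing_curv\<close> tests its last argument only on
      \<open>U \<inter> sing g\<close>, where \<open>h\<close> is 0.\<close>
    then show ?thesis unfolding sing_curv_def by (metis (no_types, lifting))
  qed
  show ?thesis
  proof (intro conjI allI impI iffI ballI)
    fix U X Y assume pl: "radical_plane \<A> g R U X Y"
    show "\<exists>F. smooth_extension \<A> g U (\<lambda>p. g p (riem \<A> g X Y X p) (Y p)) F \<and> (\<forall>p \<in> U \<inter> sing g. F p = 0)"
      if "\<exists>F. smooth_extension \<A> g U (sect_curv \<A> g X Y) F"
      using sect_curv_extension_imp[OF pl] that by blast
    show "\<exists>F. smooth_extension \<A> g U (sect_curv \<A> g X Y) F"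
      if "\<exists>F. smooth_extension \<A> g U (\<lambda>p. g p (riem \<A> g X Y X p) (Y p)) F \<and> (\<forall>p \<in> U \<inter> sing g. F p = 0)"
      using sect_curv_extension_if[OF pl] that by blast
    fix p assume "p \<in> U \<inter> sing g"
    show "\<nu> g N p (X p) = 0" "\<nu> g N p (Y p) = 0" if "\<exists>F. smooth_extension \<A> g U (sect_curv \<A> g X Y) F"
      using tangent[OF pl] that \<open>p \<in> U \<inter> sing g\<close> by blast+
    show "dim (span {screen_part \<A> g N R p (X p), screen_part \<A> g N R p (Y p)}) = 1"
      if "\<nu> g N p (X p) = 0 \<and> \<nu> g N p (Y p) = 0"
      using dims[OF pl \<open>p \<in> U \<inter> sing g\<close>] that by blast
  next
    assume "\<forall>U X Y. radical_plane \<A> g R U X Y \<longrightarrow>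
         (\<forall>p \<in> U \<inter> sing g. \<nu> g N p (X p) = 0 \<and> \<nu> g N p (Y p) = 0) \<longrightarrow> sing_curv \<A> g U X Y (\<lambda>p. 0)"
    then show "III_flat \<A> g N R" by (intro curvature_zero_imp_III_flat) blast
  next
    assume "\<forall>U X Y. radical_plane \<A> g R U X Y \<longrightarrow>
         (\<forall>p \<in> U \<inter> sing g. \<nu> g N p (X p) = 0 \<and> \<nu> g N p (Y p) = 0) \<longrightarrow> (\<exists>h. sing_curv \<A> g U X Y h)"
    then show "II_flat \<A> g N R" by (intro well_defined_imp_II_flat) blast
  next
    assume "III_flat \<A> g N R"
    then show "II_flat \<A> g N R" by (simp add: III_flat_def)
  next
    fix U X Y
    assume "III_flat \<A> g N R" "radical_plane \<A> g R U X Y" "\<forall>p \<in> U \<inter> sing g. \<nu> g N p (X p) = 0 \<and> \<nu> g N p (Y p) = 0"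
    then show "sing_curv \<A> g U X Y (\<lambda>p. 0)" by (rule zero)
  next
    fix U X Y
    assume "II_flat \<A> g N R" "radical_plane \<A> g R U X Y" "\<forall>p \<in> U \<inter> sing g. \<nu> g N p (X p) = 0 \<and> \<nu> g N p (Y p) = 0"
    from curvature_well_defined[OF this] show "\<exists>h. sing_curv \<A> g U X Y h" by blast
  qed
qed

end
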